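(* Let $\Theta=W^{1,\infty}(\mathbb{R}^d,\mathbb{R}^d)$, let $\Omega$ be an open bounded domain of $\mathbb{R}^d$, and let $J$ be a real-valued shape function defined on $\{(\mathrm{Id}+\theta)(\Omega):\|\theta\|_\Theta<1\}$. Define $\mathcal J_\Omega(\theta)=J[(\mathrm{Id}+\theta)(\Omega)]$ for $\theta\in\Theta$, $\|\theta\|_\Theta<1$. (i) If $\mathcal J_\Omega$ is differentiable at $0$ and $\Omega$ is $C^2$, then there exists a continuous linear form $\ell_1$ on $C^1(\partial\Omega)$ such that $\mathcal J_\Omega'(0)\xi=\ell_1(\xi_{|\partial\Omega}\cdot\boldsymbol n)$ for all $\xi\in C^\infty(\mathbb{R}^d,\mathbb{R}^d)\cap\Theta$. (ii) If moreover $\mathcal J_\Omega$ is twice differentiable at $0$ and $\Omega$ is $C^3$, then there exists a continuous symmetric bilinear form $\ell_2$ on $C^2(\partial\Omega)\times C^2(\partial\Omega)$ such that for all $\xi,\zeta\in C^\infty(\mathbb{R}^d,\mathbb{R}^d)\cap\Theta$, $$\mathcal J_\Omega''(0)(\xi,\zeta)=\ell_2(\xi\cdot\boldsymbol n,\zeta\cdot\boldsymbol n)+\ell_1\big(\boldsymbol B(\zeta_\tau,\xi_\tau)-\nabla_\tau(\zeta\cdot\boldsymbol n)\cdot\xi_\tau-\nabla_\tau(\xi\cdot\boldsymbol n)\cdot\zeta_\tau\big).$$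
   Context: Differentiability is in the Fréchet sense on the Banach space $\Theta$. $\boldsymbol n$ is the unit exterior normal on $\partial\Omega$, $\nabla_\tau$ is the tangential gradient on $\partial\Omega$, $\xi_\tau=\xi-(\xi\cdot\boldsymbol n)\boldsymbol n$ and $\zeta_\tau$ are the tangential components on $\partial\Omega$, and $\boldsymbol B=D_\tau\boldsymbol n$ is the second fundamental form of $\partial\Omega$, i.e. $\boldsymbol B(\zeta_\tau,\xi_\tau)=(D_\tau\boldsymbol n\,\zeta_\tau)\cdot\xi_\tau$. *)

theory Defs
  imports "HOL-Analysis.Analysis"
begin

section \<open>Functions of class C^k\<close>

primrec Ck_on :: "'a::real_normed_vector set \<Rightarrow> nat \<Rightarrow> ('a \<Rightarrow> 'b::real_normed_vector) \<Rightarrow> bool"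
where
  "Ck_on U 0 f \<longleftrightarrow> continuous_on U f"
| "Ck_on U (Suc k) f \<longleftrightarrow>
     (\<forall>x\<in>U. f differentiable (at x)) \<and> (\<forall>v. Ck_on U k (\<lambda>x. frechet_derivative f (at x) v))"

definition smooth :: "('a::real_normed_vector \<Rightarrow> 'b::real_normed_vector) \<Rightarrow> bool"
  where "smooth f \<longleftrightarrow> (\<forall>k. Ck_on UNIV k f)"

section \<open>The space W^{1,infinity}\<close>

definition test_function :: "('a::euclidean_space \<Rightarrow> real) \<Rightarrow> bool"
  where "test_function \<phi> \<longleftrightarrow> smooth \<phi> \<and> compact (closure {x. \<phi> x \<noteq> 0})"

definition ess_bounded :: "('a::euclidean_space \<Rightarrow> 'b::real_normed_vector) \<Rightarrow> bool"
  where "ess_bounded f \<longleftrightarrow> (\<exists>M. AE x in lborel. norm (f x) \<le> M)"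

definition ess_norm :: "('a::euclidean_space \<Rightarrow> 'b::real_normed_vector) \<Rightarrow> real"
  where "ess_norm f = Inf {M. AE x in lborel. norm (f x) \<le> M}"

text \<open>\<open>g\<close> is an essentially bounded weak (distributional) derivative of \<open>f\<close>. It is only used
  for bounded continuous \<open>f\<close>, so that both integrands are integrable.\<close>

definition weak_derivative ::
    "('a::euclidean_space \<Rightarrow> 'b::euclidean_space) \<Rightarrow> ('a \<Rightarrow> 'a \<Rightarrow>\<^sub>L 'b) \<Rightarrow> bool"
  where "weak_derivative f g \<longleftrightarrow>
    (\<forall>v. (\<lambda>x. blinfun_apply (g x) v) \<in> borel_measurable borel) \<and> ess_bounded g \<and>
    (\<forall>\<phi> v. test_function \<phi> \<longrightarrow>
      (LINT x|lborel. \<phi> x *\<^sub>R blinfun_apply (g x) v) =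
      - (LINT x|lborel. frechet_derivative \<phi> (at x) v *\<^sub>R f x))"

lemma AE_lborel_const: "(AE x in (lborel :: 'a::euclidean_space measure). P) \<longleftrightarrow> P"
proof -
  have "emeasure (lborel :: 'a measure) (space lborel) \<noteq> 0" by simp
  then show ?thesis by (simp add: AE_iff_null null_sets_def)
qed

lemma ess_bound_nonneg:
  fixes f :: "'a::euclidean_space \<Rightarrow> 'b::real_normed_vector"
  assumes "AE x in lborel. norm (f x) \<le> M"
  shows "0 \<le> M"
proof -
  have "AE x in (lborel :: 'a measure). 0 \<le> M"
    using assms by eventually_elim (use norm_ge_zero order_trans in blast)
  then show ?thesis by (simp only: AE_lborel_const)
qed

lemma ess_norm_le: "(AE x in lborel. norm (f x) \<le> M) \<Longrightarrow> ess_norm f \<le> M"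
  unfolding ess_norm_def
  by (rule cInf_lower) (auto intro!: bdd_belowI[of _ 0] dest: ess_bound_nonneg)

lemma ess_norm_nonneg: "ess_bounded f \<Longrightarrow> 0 \<le> ess_norm f"
  unfolding ess_norm_def ess_bounded_def
  by (rule cInf_greatest) (auto dest: ess_bound_nonneg)

lemma AE_ess_norm:
  assumes "ess_bounded f"
  shows "AE x in lborel. norm (f x) \<le> ess_norm f"
proof -
  have "AE x in lborel. norm (f x) \<le> ess_norm f + inverse (real (Suc n))" for n
  proof -
    have "Inf {M. AE x in lborel. norm (f x) \<le> M} < ess_norm f + inverse (real (Suc n))"
      unfolding ess_norm_def by simp
    then obtain M where M: "AE x in lborel. norm (f x) \<le> M" "M < ess_norm f + inverse (real (Suc n))"
      using assms cInf_lessD[of "{M. AE x in lborel. norm (f x) \<le> M}"]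
      unfolding ess_bounded_def by auto
    show ?thesis using M(1) by eventually_elim (use M(2) in auto)
  qed
  then have "AE x in lborel. \<forall>n. norm (f x) \<le> ess_norm f + inverse (real (Suc n))"
    by (simp add: AE_all_countable)
  then show ?thesis
  proof eventually_elim
    case (elim x)
    show ?case
    proof (rule field_le_epsilon)
      fix e :: real assume "0 < e"
      then obtain n where "inverse (real (Suc n)) < e" using reals_Archimedean by blast
      then show "norm (f x) \<le> ess_norm f + e" using elim[rule_format, of n] by linarith
    qed
  qed
qed

lemma AE_ess_add:
  assumes "ess_bounded f" "ess_bounded g"
  shows "AE x in lborel. norm (f x + g x) \<le> ess_norm f + ess_norm g"
  using AE_ess_norm[OF assms(1)] AE_ess_norm[OF assms(2)]
  by eventually_elim (use norm_triangle_mono in blast)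

lemma AE_ess_scaleR:
  assumes "ess_bounded f"
  shows "AE x in lborel. norm (c *\<^sub>R f x) \<le> \<bar>c\<bar> * ess_norm f"
  using AE_ess_norm[OF assms] by eventually_elim (simp add: mult_left_mono)

lemma test_function_derivative:
  assumes "test_function \<phi>"
  shows "continuous_on UNIV \<phi>" "continuous_on UNIV (\<lambda>x. frechet_derivative \<phi> (at x) v)"
    and "x \<notin> closure {x. \<phi> x \<noteq> 0} \<Longrightarrow> frechet_derivative \<phi> (at x) v = 0"
proof -
  have s: "Ck_on UNIV k \<phi>" for k using assms by (auto simp: test_function_def smooth_def)
  show "continuous_on UNIV \<phi>" using s[of 0] by simp
  show "continuous_on UNIV (\<lambda>x. frechet_derivative \<phi> (at x) v)" using s[of "Suc 0"] by simp
  assume x: "x \<notin> closure {x. \<phi> x \<noteq> 0}"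
  have "((\<lambda>x. 0) has_derivative (\<lambda>_. 0)) (at x)" by simp
  then have "(\<phi> has_derivative (\<lambda>_. 0)) (at x)"
    by (rule has_derivative_transform_within_open[of _ _ _ UNIV "- closure {x. \<phi> x \<noteq> 0}"])
       (use x closure_subset[of "{x. \<phi> x \<noteq> 0}"] in auto)
  then have "(\<lambda>_. 0) = frechet_derivative \<phi> (at x)" by (rule frechet_derivative_at)
  then show "frechet_derivative \<phi> (at x) v = 0" by metis
qed

lemma integrable_compact_support:
  fixes \<psi> :: "'a::euclidean_space \<Rightarrow> real"
  assumes "continuous_on UNIV \<psi>" "compact K" "\<And>x. x \<notin> K \<Longrightarrow> \<psi> x = 0"
  shows "integrable lborel \<psi>"
proof -
  have "integrable lborel (\<lambda>x. indicator K x *\<^sub>R \<psi> x)"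
    by (rule borel_integrable_compact[OF assms(2) continuous_on_subset[OF assms(1)]]) simp
  moreover have "(\<lambda>x. indicator K x *\<^sub>R \<psi> x) = \<psi>"
    using assms(3) by (fastforce simp: indicator_def)
  ultimately show ?thesis by simp
qed

lemma integrable_scaleR_ess_bounded:
  fixes \<psi> :: "'a::euclidean_space \<Rightarrow> real" and h :: "'a \<Rightarrow> 'b::euclidean_space"
  assumes "integrable lborel \<psi>" "h \<in> borel_measurable borel" "ess_bounded h"
  shows "integrable lborel (\<lambda>x. \<psi> x *\<^sub>R h x)"
proof (rule Bochner_Integration.integrable_bound)
  show "integrable lborel (\<lambda>x. ess_norm h * \<psi> x)" using assms(1) by simp
  show "(\<lambda>x. \<psi> x *\<^sub>R h x) \<in> borel_measurable lborel" using assms(1,2) by measurable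
  show "AE x in lborel. norm (\<psi> x *\<^sub>R h x) \<le> norm (ess_norm h * \<psi> x)"
    using AE_ess_norm[OF assms(3)]
  proof eventually_elim
    case (elim x)
    have "norm (\<psi> x *\<^sub>R h x) \<le> \<bar>\<psi> x\<bar> * ess_norm h" using elim by (simp add: mult_left_mono)
    then show ?case using ess_norm_nonneg[OF assms(3)] by (simp add: abs_mult mult.commute)
  qed
qed

lemma test_integrable:
  fixes h :: "'a::euclidean_space \<Rightarrow> 'b::euclidean_space"
  assumes "test_function \<phi>" "h \<in> borel_measurable borel" "ess_bounded h"
  shows "integrable lborel (\<lambda>x. \<phi> x *\<^sub>R h x)"
    and "integrable lborel (\<lambda>x. frechet_derivative \<phi> (at x) v *\<^sub>R h x)"
proof -
  have K: "compact (closure {x. \<phi> x \<noteq> 0})" using assms(1) by (simp add: test_function_def)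
  have "integrable lborel \<phi>"
    by (rule integrable_compact_support[OF test_function_derivative(1)[OF assms(1)] K])
       (use closure_subset[of "{x. \<phi> x \<noteq> 0}"] in auto)
  then show "integrable lborel (\<lambda>x. \<phi> x *\<^sub>R h x)"
    by (rule integrable_scaleR_ess_bounded) fact+
  have "integrable lborel (\<lambda>x. frechet_derivative \<phi> (at x) v)"
    by (rule integrable_compact_support[OF test_function_derivative(2)[OF assms(1)] K])
       (rule test_function_derivative(3)[OF assms(1)])
  then show "integrable lborel (\<lambda>x. frechet_derivative \<phi> (at x) v *\<^sub>R h x)"
    by (rule integrable_scaleR_ess_bounded) fact+
qed

lemma ess_bounded_blinfun_apply:
  assumes "ess_bounded g" shows "ess_bounded (\<lambda>x. blinfun_apply (g x) v)"
  unfolding ess_bounded_def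
proof
  show "AE x in lborel. norm (blinfun_apply (g x) v) \<le> ess_norm g * norm v"
    using AE_ess_norm[OF assms]
  proof eventually_elim
    case (elim x)
    have "norm (blinfun_apply (g x) v) \<le> norm (g x) * norm v" by (rule norm_blinfun)
    also have "\<dots> \<le> ess_norm g * norm v" using elim by (simp add: mult_right_mono)
    finally show ?case .
  qed
qed

lemma weak_derivative_add:
  assumes f: "continuous_on UNIV f" "ess_bounded f" "weak_derivative f g"
    and f': "continuous_on UNIV f'" "ess_bounded f'" "weak_derivative f' g'"
  shows "weak_derivative (\<lambda>x. f x + f' x) (\<lambda>x. g x + g' x)"
proof -
  have g: "(\<lambda>x. blinfun_apply (g x) v) \<in> borel_measurable borel" "ess_bounded g"
    and g': "(\<lambda>x. blinfun_apply (g' x) v) \<in> borel_measurable borel" "ess_bounded g'" for v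
    using f(3) f'(3) by (auto simp: weak_derivative_def)
  have bf: "f \<in> borel_measurable borel" "f' \<in> borel_measurable borel"
    using f(1) f'(1) by (auto intro: borel_measurable_continuous_onI)
  have "(LINT x|lborel. \<phi> x *\<^sub>R blinfun_apply (g x + g' x) v) =
      - (LINT x|lborel. frechet_derivative \<phi> (at x) v *\<^sub>R (f x + f' x))" if t: "test_function \<phi>" for \<phi> v
  proof -
    note i = test_integrable[OF t bf(1) f(2)] test_integrable[OF t bf(2) f'(2)]
      test_integrable[OF t g(1) ess_bounded_blinfun_apply[OF g(2)]]
      test_integrable[OF t g'(1) ess_bounded_blinfun_apply[OF g'(2)]]
    have "(LINT x|lborel. \<phi> x *\<^sub>R blinfun_apply (g x) v) =
      - (LINT x|lborel. frechet_derivative \<phi> (at x) v *\<^sub>R f x)"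
      "(LINT x|lborel. \<phi> x *\<^sub>R blinfun_apply (g' x) v) =
      - (LINT x|lborel. frechet_derivative \<phi> (at x) v *\<^sub>R f' x)"
      using f(3) f'(3) t by (simp_all add: weak_derivative_def)
    then show ?thesis by (simp add: blinfun.add_left scaleR_add_right i)
  qed
  moreover have "ess_bounded (\<lambda>x. g x + g' x)"
    using AE_ess_add[OF g(2) g'(2)] unfolding ess_bounded_def by blast
  moreover have "(\<lambda>x. blinfun_apply (g x + g' x) v) \<in> borel_measurable borel" for v
    using borel_measurable_add[OF g(1)[of v] g'(1)[of v]] by (simp add: blinfun.add_left)
  ultimately show ?thesis by (simp add: weak_derivative_def)
qed

lemma weak_derivative_scaleR:
  assumes "weak_derivative f g"
  shows "weak_derivative (\<lambda>x. c *\<^sub>R f x) (\<lambda>x. c *\<^sub>R g x)"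
proof -
  have g: "(\<lambda>x. blinfun_apply (g x) v) \<in> borel_measurable borel" "ess_bounded g" for v
    using assms by (auto simp: weak_derivative_def)
  have "(LINT x|lborel. \<phi> x *\<^sub>R blinfun_apply (c *\<^sub>R g x) v) =
      - (LINT x|lborel. frechet_derivative \<phi> (at x) v *\<^sub>R c *\<^sub>R f x)" if t: "test_function \<phi>" for \<phi> v
  proof -
    have "(LINT x|lborel. \<phi> x *\<^sub>R blinfun_apply (c *\<^sub>R g x) v) =
        (LINT x|lborel. c *\<^sub>R (\<phi> x *\<^sub>R blinfun_apply (g x) v))"
      by (simp only: blinfun.scaleR_left scaleR_left_commute)
    also have "\<dots> = c *\<^sub>R (LINT x|lborel. \<phi> x *\<^sub>R blinfun_apply (g x) v)"
      by (rule integral_scaleR_right)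
    also have "\<dots> = - (c *\<^sub>R (LINT x|lborel. frechet_derivative \<phi> (at x) v *\<^sub>R f x))"
      using assms t by (simp add: weak_derivative_def)
    also have "c *\<^sub>R (LINT x|lborel. frechet_derivative \<phi> (at x) v *\<^sub>R f x) =
        (LINT x|lborel. c *\<^sub>R (frechet_derivative \<phi> (at x) v *\<^sub>R f x))"
      by (rule integral_scaleR_right[symmetric])
    also have "\<dots> = (LINT x|lborel. frechet_derivative \<phi> (at x) v *\<^sub>R c *\<^sub>R f x)"
      by (simp only: scaleR_left_commute)
    finally show ?thesis .
  qed
  moreover have "ess_bounded (\<lambda>x. c *\<^sub>R g x)"
    using AE_ess_scaleR[OF g(2), of c] unfolding ess_bounded_def by blast
  moreover have "(\<lambda>x. blinfun_apply (c *\<^sub>R g x) v) \<in> borel_measurable borel" for v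
    using borel_measurable_scaleR[OF borel_measurable_const g(1)[of v], of c]
    by (simp add: blinfun.scaleR_left)
  ultimately show ?thesis by (simp add: weak_derivative_def)
qed

lemma weak_derivative_zero: "weak_derivative (\<lambda>_. 0) (\<lambda>_. 0)"
  by (auto simp: weak_derivative_def ess_bounded_def intro!: exI[of _ 0])

text \<open>Every class in W^{1,infinity} has exactly one continuous representative; elements of the
  space are identified with it, so that the image of a set under \<open>Id + \<theta>\<close> makes sense.\<close>

typedef (overloaded) ('a::euclidean_space, 'b::euclidean_space) W1inf =
  "{f :: 'a \<Rightarrow> 'b. continuous_on UNIV f \<and> ess_bounded f \<and> (\<exists>g. weak_derivative f g)}"
  morphisms apply_W1inf W1inf
proof -
  have "(\<lambda>_. 0) \<in> {f :: 'a \<Rightarrow> 'b. continuous_on UNIV f \<and> ess_bounded f \<and> (\<exists>g. weak_derivative f g)}"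
    using weak_derivative_zero by (auto simp: ess_bounded_def intro!: exI[of _ 0])
  then show ?thesis by blast
qed

setup_lifting type_definition_W1inf

lemma W1inf_D:
  "continuous_on UNIV (apply_W1inf \<theta>)" "ess_bounded (apply_W1inf \<theta>)"
  "\<exists>g. weak_derivative (apply_W1inf \<theta>) g"
  using apply_W1inf[of \<theta>] by auto

text \<open>Essential bound of the weak derivative. Weak derivatives are unique almost everywhere, so
  the infimum over \<open>g\<close> is over a single value; written this way it needs no choice of \<open>g\<close>.\<close>

definition weak_derivative_norm :: "('a::euclidean_space \<Rightarrow> 'b::euclidean_space) \<Rightarrow> real"
  where "weak_derivative_norm f = (INF g\<in>{g. weak_derivative f g}. ess_norm g)"

lemma weak_derivative_ess_bounded: "weak_derivative f g \<Longrightarrow> ess_bounded g"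
  by (simp add: weak_derivative_def)

lemma weak_derivative_norm_le:
  assumes "weak_derivative f g"
  shows "weak_derivative_norm f \<le> ess_norm g"
  unfolding weak_derivative_norm_def
  by (rule cINF_lower)
     (use assms in \<open>auto intro!: bdd_belowI[of _ 0] ess_norm_nonneg weak_derivative_ess_bounded\<close>)

lemma weak_derivative_norm_ge:
  assumes "\<exists>g. weak_derivative f g" "\<And>g. weak_derivative f g \<Longrightarrow> c \<le> ess_norm g"
  shows "c \<le> weak_derivative_norm f"
  unfolding weak_derivative_norm_def by (rule cINF_greatest) (use assms in auto)

lemma weak_derivative_norm_nonneg:
  "\<exists>g. weak_derivative f g \<Longrightarrow> 0 \<le> weak_derivative_norm f"
  by (rule weak_derivative_norm_ge) (auto intro: ess_norm_nonneg weak_derivative_ess_bounded)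

lemma weak_derivative_norm_zero:
  "weak_derivative_norm (\<lambda>_ :: 'a::euclidean_space. 0 :: 'b::euclidean_space) \<le> 0"
proof -
  have "ess_norm (\<lambda>_ :: 'a. 0 :: 'a \<Rightarrow>\<^sub>L 'b) \<le> 0" by (rule ess_norm_le) simp
  then show ?thesis
    using weak_derivative_norm_le[OF weak_derivative_zero] by (rule order_trans[rotated])
qed

lemma ess_norm_scaleR_le: "ess_bounded f \<Longrightarrow> ess_norm (\<lambda>x. c *\<^sub>R f x) \<le> \<bar>c\<bar> * ess_norm f"
  by (rule ess_norm_le) (rule AE_ess_scaleR)

lemma weak_derivative_norm_scaleR_le:
  fixes f :: "'a::euclidean_space \<Rightarrow> 'b::euclidean_space"
  assumes "\<exists>g. weak_derivative f g"
  shows "weak_derivative_norm (\<lambda>x. c *\<^sub>R f x) \<le> \<bar>c\<bar> * weak_derivative_norm f"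
proof (cases "c = 0")
  case True
  then show ?thesis
    using weak_derivative_norm_zero[where 'a = 'a and 'b = 'b] by simp
next
  case False
  have "weak_derivative_norm (\<lambda>x. c *\<^sub>R f x) / \<bar>c\<bar> \<le> weak_derivative_norm f"
  proof (rule weak_derivative_norm_ge[OF assms])
    fix g assume g: "weak_derivative f g"
    have "weak_derivative_norm (\<lambda>x. c *\<^sub>R f x) \<le> ess_norm (\<lambda>x. c *\<^sub>R g x)"
      by (rule weak_derivative_norm_le) (rule weak_derivative_scaleR[OF g])
    also have "\<dots> \<le> \<bar>c\<bar> * ess_norm g"
      by (rule ess_norm_scaleR_le) (rule weak_derivative_ess_bounded[OF g])
    finally show "weak_derivative_norm (\<lambda>x. c *\<^sub>R f x) / \<bar>c\<bar> \<le> ess_norm g"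
      using False by (simp add: field_simps)
  qed
  then show ?thesis using False by (simp add: field_simps)
qed

lemma W1inf_add:
  assumes f: "continuous_on UNIV f" "ess_bounded f" "\<exists>g. weak_derivative f g"
    and f': "continuous_on UNIV f'" "ess_bounded f'" "\<exists>g. weak_derivative f' g"
  shows "continuous_on UNIV (\<lambda>x. f x + f' x) \<and> ess_bounded (\<lambda>x. f x + f' x) \<and>
    (\<exists>g. weak_derivative (\<lambda>x. f x + f' x) g)"
proof (intro conjI)
  show "continuous_on UNIV (\<lambda>x. f x + f' x)" using f f' by (intro continuous_intros)
  show "ess_bounded (\<lambda>x. f x + f' x)"
    using AE_ess_add[OF f(2) f'(2)] unfolding ess_bounded_def by blast
  show "\<exists>g. weak_derivative (\<lambda>x. f x + f' x) g" using weak_derivative_add f f' by blast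
qed

lemma W1inf_scaleR:
  assumes f: "continuous_on UNIV f" "ess_bounded f" "\<exists>g. weak_derivative f g"
  shows "continuous_on UNIV (\<lambda>x. c *\<^sub>R f x) \<and> ess_bounded (\<lambda>x. c *\<^sub>R f x) \<and>
    (\<exists>g. weak_derivative (\<lambda>x. c *\<^sub>R f x) g)"
proof (intro conjI)
  show "continuous_on UNIV (\<lambda>x. c *\<^sub>R f x)" using f by (intro continuous_intros)
  show "ess_bounded (\<lambda>x. c *\<^sub>R f x)"
    using AE_ess_scaleR[OF f(2), of c] unfolding ess_bounded_def by blast
  show "\<exists>g. weak_derivative (\<lambda>x. c *\<^sub>R f x) g" using weak_derivative_scaleR f by blast
qed

instantiation W1inf :: (euclidean_space, euclidean_space) real_vector
begin

lift_definition zero_W1inf :: "('a, 'b) W1inf" is "\<lambda>_. 0"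
  using weak_derivative_zero by (auto simp: ess_bounded_def intro!: exI[of _ 0])

lift_definition plus_W1inf :: "('a, 'b) W1inf \<Rightarrow> ('a, 'b) W1inf \<Rightarrow> ('a, 'b) W1inf"
  is "\<lambda>f g x. f x + g x"
  using W1inf_add by blast

lift_definition scaleR_W1inf :: "real \<Rightarrow> ('a, 'b) W1inf \<Rightarrow> ('a, 'b) W1inf"
  is "\<lambda>c f x. c *\<^sub>R f x"
  using W1inf_scaleR by blast

lift_definition uminus_W1inf :: "('a, 'b) W1inf \<Rightarrow> ('a, 'b) W1inf"
  is "\<lambda>f x. - f x"
proof -
  fix f :: "'a \<Rightarrow> 'b"
  assume "continuous_on UNIV f \<and> ess_bounded f \<and> (\<exists>h. weak_derivative f h)"
  then show "continuous_on UNIV (\<lambda>x. - f x) \<and> ess_bounded (\<lambda>x. - f x) \<and>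
      (\<exists>h. weak_derivative (\<lambda>x. - f x) h)"
    using W1inf_scaleR[of f "-1"] by simp
qed

lift_definition minus_W1inf :: "('a, 'b) W1inf \<Rightarrow> ('a, 'b) W1inf \<Rightarrow> ('a, 'b) W1inf"
  is "\<lambda>f g x. f x - g x"
proof -
  fix f g :: "'a \<Rightarrow> 'b"
  assume f: "continuous_on UNIV f \<and> ess_bounded f \<and> (\<exists>h. weak_derivative f h)"
    and g: "continuous_on UNIV g \<and> ess_bounded g \<and> (\<exists>h. weak_derivative g h)"
  have "continuous_on UNIV (\<lambda>x. - g x) \<and> ess_bounded (\<lambda>x. - g x) \<and>
      (\<exists>h. weak_derivative (\<lambda>x. - g x) h)"
    using W1inf_scaleR[of g "-1"] g by simp
  then show "continuous_on UNIV (\<lambda>x. f x - g x) \<and> ess_bounded (\<lambda>x. f x - g x) \<and>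
      (\<exists>h. weak_derivative (\<lambda>x. f x - g x) h)"
    using W1inf_add[of f "\<lambda>x. - g x"] f by simp
qed

instance
  by standard (transfer; simp add: algebra_simps)+

end

instantiation W1inf :: (euclidean_space, euclidean_space) real_normed_vector
begin

text \<open>Sum of the two essential bounds, with the operator norm on the derivative. Equivalent choices
  give the same derivatives.\<close>

definition norm_W1inf :: "('a, 'b) W1inf \<Rightarrow> real"
  where "norm \<theta> = ess_norm (apply_W1inf \<theta>) + weak_derivative_norm (apply_W1inf \<theta>)"
  for \<theta> :: "('a, 'b) W1inf"

definition dist_W1inf :: "('a, 'b) W1inf \<Rightarrow> ('a, 'b) W1inf \<Rightarrow> real"
  where "dist \<theta> \<eta> = norm (\<theta> - \<eta>)" for \<theta> \<eta> :: "('a, 'b) W1inf"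

definition sgn_W1inf :: "('a, 'b) W1inf \<Rightarrow> ('a, 'b) W1inf"
  where "sgn \<theta> = \<theta> /\<^sub>R norm \<theta>" for \<theta> :: "('a, 'b) W1inf"

definition uniformity_W1inf :: "(('a, 'b) W1inf \<times> ('a, 'b) W1inf) filter"
  where "uniformity_W1inf = (INF e\<in>{0 <..}. principal {(\<theta>, \<eta>). dist \<theta> \<eta> < e})"

definition open_W1inf :: "('a, 'b) W1inf set \<Rightarrow> bool"
  where "open_W1inf U \<longleftrightarrow> (\<forall>\<theta>\<in>U. eventually (\<lambda>(\<theta>', \<eta>). \<theta>' = \<theta> \<longrightarrow> \<eta> \<in> U) uniformity)"

instance
proof
  fix \<theta> \<eta> :: "('a, 'b) W1inf" and a :: real and U :: "('a, 'b) W1inf set"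
  show "dist \<theta> \<eta> = norm (\<theta> - \<eta>)" by (rule dist_W1inf_def)
  show "sgn \<theta> = \<theta> /\<^sub>R norm \<theta>" by (rule sgn_W1inf_def)
  show "uniformity = (INF e\<in>{0 <..}. principal {(x, y). dist (x :: ('a, 'b) W1inf) y < e})"
    by (rule uniformity_W1inf_def)
  show "open U \<longleftrightarrow> (\<forall>x\<in>U. eventually (\<lambda>(x', y). x' = x \<longrightarrow> y \<in> U) uniformity)"
    by (rule open_W1inf_def)
  show "norm \<theta> = 0 \<longleftrightarrow> \<theta> = 0"
  proof
    assume "norm \<theta> = 0"
    then have "ess_norm (apply_W1inf \<theta>) = 0"
      using ess_norm_nonneg[OF W1inf_D(2)[of \<theta>]] weak_derivative_norm_nonneg[OF W1inf_D(3)[of \<theta>]]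
      unfolding norm_W1inf_def by linarith
    then have ae: "AE x in lborel. apply_W1inf \<theta> x = 0"
      using AE_ess_norm[OF W1inf_D(2)[of \<theta>]] by simp
    define S where "S = {x. apply_W1inf \<theta> x \<noteq> 0}"
    have o: "open S" unfolding S_def
      using W1inf_D(1)[of \<theta>] by (intro open_Collect_neq continuous_on_const)
    have "S \<in> null_sets lborel"
      using ae o AE_iff_null_sets[of S lborel] by (simp add: S_def)
    then have "negligible S" using negligible_iff_null_sets null_sets_completionI by blast
    then have "S = {}" using o open_not_negligible by blast
    then show "\<theta> = 0" unfolding S_def by transfer auto
  next
    assume "\<theta> = 0"
    then have z: "apply_W1inf \<theta> = (\<lambda>_. 0)" by (simp add: zero_W1inf.rep_eq)
    have "ess_norm (\<lambda>_ :: 'a. 0 :: 'b) \<le> 0"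
      by (rule ess_norm_le) simp
    then show "norm \<theta> = 0"
      using weak_derivative_norm_zero[where 'a = 'a and 'b = 'b]
        ess_norm_nonneg[OF W1inf_D(2)[of \<theta>]] weak_derivative_norm_nonneg[OF W1inf_D(3)[of \<theta>]]
      unfolding norm_W1inf_def z by linarith
  qed
  show "norm (\<theta> + \<eta>) \<le> norm \<theta> + norm \<eta>"
  proof -
    let ?f = "apply_W1inf \<theta>" and ?h = "apply_W1inf \<eta>"
    have "ess_norm (\<lambda>x. ?f x + ?h x) \<le> ess_norm ?f + ess_norm ?h"
      by (rule ess_norm_le) (rule AE_ess_add[OF W1inf_D(2) W1inf_D(2)])
    moreover have "weak_derivative_norm (\<lambda>x. ?f x + ?h x) - weak_derivative_norm ?h
        \<le> weak_derivative_norm ?f"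
    proof (rule weak_derivative_norm_ge[OF W1inf_D(3)])
      fix g assume g: "weak_derivative ?f g"
      have "weak_derivative_norm (\<lambda>x. ?f x + ?h x) - ess_norm g \<le> weak_derivative_norm ?h"
      proof (rule weak_derivative_norm_ge[OF W1inf_D(3)])
        fix k assume k: "weak_derivative ?h k"
        have "weak_derivative_norm (\<lambda>x. ?f x + ?h x) \<le> ess_norm (\<lambda>x. g x + k x)"
          by (rule weak_derivative_norm_le)
             (rule weak_derivative_add[OF W1inf_D(1,2) g W1inf_D(1,2) k])
        also have "\<dots> \<le> ess_norm g + ess_norm k"
          by (rule ess_norm_le)
             (rule AE_ess_add[OF weak_derivative_ess_bounded[OF g] weak_derivative_ess_bounded[OF k]])
        finally show "weak_derivative_norm (\<lambda>x. ?f x + ?h x) - ess_norm g \<le> ess_norm k" by simp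
      qed
      then show "weak_derivative_norm (\<lambda>x. ?f x + ?h x) - weak_derivative_norm ?h \<le> ess_norm g"
        by simp
    qed
    ultimately show ?thesis by (simp add: norm_W1inf_def plus_W1inf.rep_eq)
  qed
  have le: "norm (c *\<^sub>R \<xi>) \<le> \<bar>c\<bar> * norm \<xi>" for c and \<xi> :: "('a, 'b) W1inf"
    using ess_norm_scaleR_le[OF W1inf_D(2)[of \<xi>], of c]
      weak_derivative_norm_scaleR_le[OF W1inf_D(3)[of \<xi>], of c]
    by (simp add: norm_W1inf_def scaleR_W1inf.rep_eq distrib_left)
  show "norm (a *\<^sub>R \<theta>) = \<bar>a\<bar> * norm \<theta>"
  proof (cases "a = 0")
    case True
    have "0 \<le> norm (a *\<^sub>R \<theta>)"
      using ess_norm_nonneg[OF W1inf_D(2)[of "a *\<^sub>R \<theta>"]]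
        weak_derivative_norm_nonneg[OF W1inf_D(3)[of "a *\<^sub>R \<theta>"]] by (simp add: norm_W1inf_def)
    then show ?thesis using le[of a \<theta>] True by simp
  next
    case False
    have "inverse a *\<^sub>R (a *\<^sub>R \<theta>) = \<theta>" using False by transfer simp
    then have "norm \<theta> \<le> \<bar>inverse a\<bar> * norm (a *\<^sub>R \<theta>)" using le[of "inverse a" "a *\<^sub>R \<theta>"] by simp
    then have "\<bar>a\<bar> * norm \<theta> \<le> norm (a *\<^sub>R \<theta>)" using False by (simp add: field_simps)
    then show ?thesis using le[of a \<theta>] by simp
  qed
qed

end

section \<open>Second Frechet derivatives\<close>

definition frechet_blinfun ::
    "('a::real_normed_vector \<Rightarrow> 'b::real_normed_vector) \<Rightarrow> 'a \<Rightarrow> 'a \<Rightarrow>\<^sub>L 'b"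
  where "frechet_blinfun f x = Blinfun (frechet_derivative f (at x))"

definition twice_differentiable_at ::
    "('a::real_normed_vector \<Rightarrow> 'b::real_normed_vector) \<Rightarrow> 'a \<Rightarrow> bool"
  where "twice_differentiable_at f x \<longleftrightarrow>
    (\<forall>\<^sub>F y in nhds x. f differentiable (at y)) \<and> frechet_blinfun f differentiable (at x)"

definition second_frechet_derivative ::
    "('a::real_normed_vector \<Rightarrow> 'b::real_normed_vector) \<Rightarrow> 'a \<Rightarrow> 'a \<Rightarrow> 'a \<Rightarrow> 'b"
  where "second_frechet_derivative f x h k =
    blinfun_apply (frechet_derivative (frechet_blinfun f) (at x) h) k"

section \<open>Domains of class C^k and their boundary\<close>

text \<open>Near each boundary point, \<open>\<Omega>\<close> is the epigraph of a C^k function over a hyperplane. The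
  direction \<open>\<nu>\<close> is the vertical axis of the local orthonormal frame, \<open>y - (y \<bullet> \<nu>) *\<^sub>R \<nu>\<close> is the
  horizontal part of \<open>y\<close>, and only the values of \<open>\<gamma>\<close> on the hyperplane orthogonal to \<open>\<nu>\<close> matter.\<close>

definition Ck_domain :: "nat \<Rightarrow> 'a::euclidean_space set \<Rightarrow> bool"
  where "Ck_domain k \<Omega> \<longleftrightarrow> open \<Omega> \<and>
    (\<forall>x\<in>frontier \<Omega>. \<exists>\<nu> (\<gamma> :: 'a \<Rightarrow> real) r. norm \<nu> = 1 \<and> r > 0 \<and> Ck_on UNIV k \<gamma> \<and>
      \<Omega> \<inter> ball x r = {y \<in> ball x r. y \<bullet> \<nu> > \<gamma> (y - (y \<bullet> \<nu>) *\<^sub>R \<nu>)})"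

text \<open>Velocities at \<open>x\<close> of curves running in \<open>S\<close>.\<close>

definition tangent_space :: "'a::real_normed_vector set \<Rightarrow> 'a \<Rightarrow> 'a set"
  where "tangent_space S x =
    {v. \<exists>c :: real \<Rightarrow> 'a. c 0 = x \<and> (\<forall>\<^sub>F t in nhds 0. c t \<in> S) \<and>
      (c has_vector_derivative v) (at 0)}"

definition exterior_normal :: "'a::euclidean_space set \<Rightarrow> 'a \<Rightarrow> 'a"
  where "exterior_normal \<Omega> x = (THE \<nu>. norm \<nu> = 1 \<and>
    (\<forall>v\<in>tangent_space (frontier \<Omega>) x. \<nu> \<bullet> v = 0) \<and>
    (\<forall>\<^sub>F t in at_right 0. x + t *\<^sub>R \<nu> \<notin> closure \<Omega> \<and> x - t *\<^sub>R \<nu> \<in> \<Omega>))"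

definition tangential_part :: "'a::euclidean_space set \<Rightarrow> ('a \<Rightarrow> 'a) \<Rightarrow> 'a \<Rightarrow> 'a"
  where "tangential_part \<Omega> \<xi> x = \<xi> x - (\<xi> x \<bullet> exterior_normal \<Omega> x) *\<^sub>R exterior_normal \<Omega> x"

text \<open>The differential along the boundary of a map \<open>f\<close> given on the boundary. Differentiability
  within \<open>frontier \<Omega>\<close> determines a linear map on the tangent space only; it is extended by 0 in
  the normal direction, so that \<open>tangential_derivative \<Omega> f x v = Df(x) v\<^sub>\<tau>\<close> for any
  differentiable extension of \<open>f\<close>.\<close>

definition tangential_derivative ::
    "'a::euclidean_space set \<Rightarrow> ('a \<Rightarrow> 'b::real_normed_vector) \<Rightarrow> 'a \<Rightarrow> 'a \<Rightarrow> 'b"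
  where "tangential_derivative \<Omega> f x = (THE L.
    (f has_derivative L) (at x within frontier \<Omega>) \<and> L (exterior_normal \<Omega> x) = 0)"

definition tangential_gradient :: "'a::euclidean_space set \<Rightarrow> ('a \<Rightarrow> real) \<Rightarrow> 'a \<Rightarrow> 'a"
  where "tangential_gradient \<Omega> f x = (\<Sum>b\<in>Basis. tangential_derivative \<Omega> f x b *\<^sub>R b)"

definition second_fundamental_form :: "'a::euclidean_space set \<Rightarrow> 'a \<Rightarrow> 'a \<Rightarrow> 'a \<Rightarrow> real"
  where "second_fundamental_form \<Omega> x v w =
    tangential_derivative \<Omega> (exterior_normal \<Omega>) x v \<bullet> w"

text \<open>The space of C^k functions on the boundary of a C^k domain, with its usual norm. Functions
  are total on the ambient space, but only their values on the boundary matter. For \<open>k \<ge> 2\<close> the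
  iterated tangential derivatives involve derivatives of the normal up to order \<open>k - 1\<close>.\<close>

primrec Ck_boundary ::
    "nat \<Rightarrow> 'a::euclidean_space set \<Rightarrow> ('a \<Rightarrow> 'b::real_normed_vector) \<Rightarrow> bool"
where
  "Ck_boundary 0 \<Omega> f \<longleftrightarrow> continuous_on (frontier \<Omega>) f"
| "Ck_boundary (Suc k) \<Omega> f \<longleftrightarrow>
     (\<forall>x\<in>frontier \<Omega>. f differentiable (at x within frontier \<Omega>)) \<and>
     (\<forall>v. Ck_boundary k \<Omega> (\<lambda>x. tangential_derivative \<Omega> f x v))"

primrec Ck_boundary_norm ::
    "nat \<Rightarrow> 'a::euclidean_space set \<Rightarrow> ('a \<Rightarrow> 'b::real_normed_vector) \<Rightarrow> real"
where
  "Ck_boundary_norm 0 \<Omega> f = (SUP x\<in>frontier \<Omega>. norm (f x))"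
| "Ck_boundary_norm (Suc k) \<Omega> f = (SUP x\<in>frontier \<Omega>. norm (f x)) +
     (\<Sum>b\<in>Basis. Ck_boundary_norm k \<Omega> (\<lambda>x. tangential_derivative \<Omega> f x b))"

text \<open>Continuity is expressed by boundedness. By linearity it makes the forms independent of the
  values of their arguments away from the boundary.\<close>

definition continuous_linear_form ::
    "nat \<Rightarrow> 'a::euclidean_space set \<Rightarrow> (('a \<Rightarrow> real) \<Rightarrow> real) \<Rightarrow> bool"
  where "continuous_linear_form k \<Omega> l \<longleftrightarrow>
    (\<forall>f g. Ck_boundary k \<Omega> f \<longrightarrow> Ck_boundary k \<Omega> g \<longrightarrow> l (\<lambda>x. f x + g x) = l f + l g) \<and>
    (\<forall>c f. Ck_boundary k \<Omega> f \<longrightarrow> l (\<lambda>x. c * f x) = c * l f) \<and>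
    (\<exists>K. \<forall>f. Ck_boundary k \<Omega> f \<longrightarrow> \<bar>l f\<bar> \<le> K * Ck_boundary_norm k \<Omega> f)"

definition continuous_symmetric_bilinear_form ::
    "nat \<Rightarrow> 'a::euclidean_space set \<Rightarrow> (('a \<Rightarrow> real) \<Rightarrow> ('a \<Rightarrow> real) \<Rightarrow> real) \<Rightarrow> bool"
  where "continuous_symmetric_bilinear_form k \<Omega> l \<longleftrightarrow>
    (\<forall>f g h. Ck_boundary k \<Omega> f \<longrightarrow> Ck_boundary k \<Omega> g \<longrightarrow> Ck_boundary k \<Omega> h \<longrightarrow>
       l (\<lambda>x. f x + g x) h = l f h + l g h) \<and>
    (\<forall>c f g. Ck_boundary k \<Omega> f \<longrightarrow> Ck_boundary k \<Omega> g \<longrightarrow> l (\<lambda>x. c * f x) g = c * l f g) \<and>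
    (\<forall>f g. Ck_boundary k \<Omega> f \<longrightarrow> Ck_boundary k \<Omega> g \<longrightarrow> l f g = l g f) \<and>
    (\<exists>K. \<forall>f g. Ck_boundary k \<Omega> f \<longrightarrow> Ck_boundary k \<Omega> g \<longrightarrow>
       \<bar>l f g\<bar> \<le> K * Ck_boundary_norm k \<Omega> f * Ck_boundary_norm k \<Omega> g)"

section \<open>Shape functionals\<close>

text \<open>\<open>J\<close> is a total function on sets, but only its values at \<open>(Id + \<theta>)(\<Omega>)\<close> with
  \<open>norm \<theta> < 1\<close> can influence derivatives at 0.\<close>

definition shape_functional ::
    "('a::euclidean_space set \<Rightarrow> real) \<Rightarrow> 'a set \<Rightarrow> ('a, 'a) W1inf \<Rightarrow> real"
  where "shape_functional J \<Omega> \<theta> = J ((\<lambda>x. x + apply_W1inf \<theta> x) ` \<Omega>)"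

end

theory Submission
  imports Defs
begin

text \<open>If two small perturbations agree on \<open>\<partial>\<Omega>\<close>, they map \<open>\<Omega>\<close> to the same set, so the derivatives of
  \<open>\<J>\<close> at 0 see their arguments only through the boundary values. If \<open>V\<close> is tangential to \<open>\<partial>\<Omega>\<close>, there
  are diffeomorphisms \<open>\<phi>\<^sub>t = Id + t V + o(t)\<close> that preserve \<open>\<Omega>\<close>; no flow is needed, because in a
  chart they can be written down explicitly. Differentiating \<open>\<J>(\<phi>\<^sub>t - Id) = \<J>(0)\<close> gives \<open>\<J>'(0) V = 0\<close>,
  and differentiating \<open>\<J>(\<phi>\<^sub>t - Id + s \<zeta> \<circ> \<phi>\<^sub>t) = \<J>(s \<zeta>)\<close> in \<open>s\<close> and then in \<open>t\<close> gives
  \<open>\<J>''(0)(V, \<zeta>) = - \<J>'(0)(D\<zeta> V)\<close>. The forms are \<open>l\<^sub>1(f) = \<J>'(0)(f n)\<close> and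
  \<open>l\<^sub>2(f, g) = \<J>''(0)(f n, g n)\<close> for a bounded linear extension of boundary functions, and the formulas
  follow by splitting \<open>\<xi>\<close> and \<open>\<zeta>\<close> into normal and tangential parts.\<close>

section \<open>Calculus of C^k functions\<close>

text \<open>Composition costs one derivative: \<zeta> \<circ> \<phi>_t is differentiable in t for
  the W^{1,infinity} norm when \<zeta> is C^2. The argument is also applied to normal parts (\<zeta>
  . n) n, so the normal must extend to a C^2 field, and this is where C^3 domains enter; for the
  first derivative a C^1 normal is enough. A smooth element of \<Theta> may have unbounded second
  derivatives, so fields are first truncated away from the boundary, which the trace property
  permits.

  A tangential field is not deformed globally. A partition of unity splits it on the boundary into
  fields living in one chart each, and linearity of the derivatives adds the contributions, so no
  two chart deformations are ever composed.

  The rule for J''(0)(V, \<zeta>) wants the tangential field first. By symmetry the mixed terms can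
  be grouped as (\<xi>_\<tau>, normal part of \<zeta>) and (\<zeta>_\<tau>, all of \<xi>). The
  normal part contributes just a tangential gradient, since Dn is tangential; the full field \<xi>
  contributes a gradient and, from differentiating \<xi>_\<tau> . n = 0, the form B. This grouping
  is why B occurs once.\<close>

abbreviation Df where "Df f x \<equiv> frechet_derivative f (at x)"
abbreviation D2f where "D2f \<equiv> second_frechet_derivative"

lemma frechet_derivative_eq: "(f has_derivative f') (at x) \<Longrightarrow> Df f x = f'"
  by (rule frechet_derivative_at[symmetric])

lemma linear_basis_expansion:
  fixes L :: "'a::euclidean_space \<Rightarrow> 'b::real_normed_vector"
  assumes "linear L"
  shows "L v = (\<Sum>b\<in>Basis. (v \<bullet> b) *\<^sub>R L b)"
proof -
  have "L v = L (\<Sum>b\<in>Basis. (v \<bullet> b) *\<^sub>R b)" by (simp add: euclidean_representation)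
  also have "\<dots> = (\<Sum>b\<in>Basis. (v \<bullet> b) *\<^sub>R L b)"
    by (simp add: linear_sum[OF assms] linear_cmul[OF assms])
  finally show ?thesis .
qed

lemma frechet_derivative_cong_open:
  assumes "open U" "x \<in> U" "\<And>y. y \<in> U \<Longrightarrow> f y = g y" "f differentiable (at x)"
  shows "g differentiable (at x)" "Df g x = Df f x"
proof -
  have "(f has_derivative Df f x) (at x)"
    using assms(4) by (simp add: frechet_derivative_works)
  then have g: "(g has_derivative Df f x) (at x)"
    by (rule has_derivative_transform_within_open[of _ _ _ UNIV U]) (use assms in auto)
  then show "g differentiable (at x)" by (auto simp: differentiable_def)
  show "Df g x = Df f x"
    by (rule frechet_derivative_eq[OF g])
qed

lemma Ck_on_cong:
  assumes "open U" "\<And>x. x \<in> U \<Longrightarrow> f x = g x" "Ck_on U k f"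
  shows "Ck_on U k g"
  using assms(2,3)
proof (induction k arbitrary: f g)
  case 0
  then show ?case by (simp cong: continuous_on_cong)
next
  case (Suc k)
  have d: "f differentiable (at x)" if "x \<in> U" for x using Suc.prems(2) that by simp
  have "Ck_on U k (\<lambda>x. Df g x v)" for v
  proof (rule Suc.IH)
    show "Ck_on U k (\<lambda>x. Df f x v)" using Suc.prems(2) by simp
    show "Df f x v = Df g x v" if "x \<in> U" for x
      using frechet_derivative_cong_open(2)[OF assms(1) that Suc.prems(1) d[OF that]] by simp
  qed
  then show ?case
    using frechet_derivative_cong_open(1)[OF assms(1) _ Suc.prems(1) d] by simp
qed

text \<open>\<open>Ck_on\<close> refers to the canonical \<open>frechet_derivative\<close>; on an
  open set derivatives are unique, so any explicit formula for the derivative may be supplied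
  instead.\<close>

lemma Ck_on_SucI:
  assumes "open U" "\<And>x. x \<in> U \<Longrightarrow> (f has_derivative f' x) (at x)" "\<And>v. Ck_on U k (\<lambda>x. f' x v)"
  shows "Ck_on U (Suc k) f"
proof -
  have "Ck_on U k (\<lambda>x. Df f x v)" for v
    by (rule Ck_on_cong[OF assms(1) _ assms(3)[of v]])
       (simp add: frechet_derivative_eq[OF assms(2)])
  then show ?thesis using assms(2) by (auto simp: differentiable_def)
qed

lemma Ck_on_SucD:
  assumes "Ck_on U (Suc k) f"
  shows "x \<in> U \<Longrightarrow> (f has_derivative Df f x) (at x)"
    and "Ck_on U k (\<lambda>x. Df f x v)"
  using assms by (simp_all add: frechet_derivative_works)

lemma Ck_on_Suc_imp: "Ck_on U (Suc k) f \<Longrightarrow> Ck_on U k f"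
proof (induction k arbitrary: f)
  case 0
  then show ?case
    by (auto intro!: continuous_at_imp_continuous_on differentiable_imp_continuous_within)
next
  case (Suc k)
  show ?case
    using Suc.prems Suc.IH[of "\<lambda>x. Df f x v" for v] Ck_on_SucD(2)[OF Suc.prems]
    by (metis Ck_on.simps(2))
qed

lemma Ck_on_mono: "Ck_on U k f \<Longrightarrow> j \<le> k \<Longrightarrow> Ck_on U j f"
  by (induction k) (use Ck_on_Suc_imp le_Suc_eq in \<open>auto simp del: Ck_on.simps(2)\<close>)

lemma Ck_on_continuous: "Ck_on U k f \<Longrightarrow> continuous_on U f"
  using Ck_on_mono[of U k f 0] by simp

lemma Ck_on_const [simp, intro]: "Ck_on U k (\<lambda>_. c)"
  by (induction k arbitrary: c) auto

lemma Ck_on_bounded_linear: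
  assumes "open U" "bounded_linear f" shows "Ck_on U k f"
proof (cases k)
  case 0
  then show ?thesis by (simp add: assms linear_continuous_on)
next
  case (Suc j)
  show ?thesis unfolding Suc
    by (rule Ck_on_SucI[OF assms(1) bounded_linear.has_derivative[OF assms(2) has_derivative_ident]]) auto
qed

lemma Ck_on_add:
  assumes "open U" "Ck_on U k f" "Ck_on U k g"
  shows "Ck_on U k (\<lambda>x. f x + g x)"
  using assms(2,3)
proof (induction k arbitrary: f g)
  case 0
  then show ?case by (simp add: continuous_on_add)
next
  case (Suc k)
  show ?case
    by (rule Ck_on_SucI[OF assms(1) has_derivative_add[OF Ck_on_SucD(1) Ck_on_SucD(1)]])
      (use Suc Ck_on_SucD(2) in blast)+
qed

lemma Ck_on_sum:
  assumes "open U" "\<And>i. i \<in> I \<Longrightarrow> Ck_on U k (f i)"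
  shows "Ck_on U k (\<lambda>x. \<Sum>i\<in>I. f i x)"
  using assms(2) by (induction I rule: infinite_finite_induct) (auto intro: Ck_on_add[OF assms(1)])

lemma Ck_on_bilinear:
  assumes bl: "bounded_bilinear pr" and "open U" "Ck_on U k f" "Ck_on U k g"
  shows "Ck_on U k (\<lambda>x. pr (f x) (g x))"
  using assms(3,4)
proof (induction k arbitrary: f g)
  case 0
  then show ?case by (simp add: bounded_bilinear.continuous_on[OF bl])
next
  case (Suc k)
  show ?case
  proof (rule Ck_on_SucI[OF assms(2)])
    fix x assume "x \<in> U"
    then show "((\<lambda>x. pr (f x) (g x)) has_derivative
      (\<lambda>v. pr (f x) (Df g x v) + pr (Df f x v) (g x))) (at x)"
      using bounded_bilinear.FDERIV[OF bl Ck_on_SucD(1)[OF Suc.prems(1)] Ck_on_SucD(1)[OF Suc.prems(2)]]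
      by blast
  next
    fix v
    show "Ck_on U k (\<lambda>x. pr (f x) (Df g x v) + pr (Df f x v) (g x))"
      by (intro Ck_on_add[OF assms(2)] Suc.IH Ck_on_SucD(2)[OF Suc.prems(1)] Ck_on_SucD(2)[OF Suc.prems(2)]
            Ck_on_Suc_imp[OF Suc.prems(1)] Ck_on_Suc_imp[OF Suc.prems(2)])
  qed
qed

lemmas Ck_on_scaleR = Ck_on_bilinear[OF bounded_bilinear_scaleR]
  and Ck_on_mult = Ck_on_bilinear[OF bounded_bilinear_mult]
  and Ck_on_inner = Ck_on_bilinear[OF bounded_bilinear_inner]

lemma Ck_on_minus: "open U \<Longrightarrow> Ck_on U k f \<Longrightarrow> Ck_on U k (\<lambda>x. - f x)"
  using Ck_on_scaleR[of U k "\<lambda>_. -1" f] by simp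

lemma Ck_on_diff: "open U \<Longrightarrow> Ck_on U k f \<Longrightarrow> Ck_on U k g \<Longrightarrow> Ck_on U k (\<lambda>x. f x - g x)"
  using Ck_on_add[of U k f "\<lambda>x. - g x"] Ck_on_minus[of U k g] by simp

text \<open>The chain rule is expanded in a basis: \<open>Ck_on\<close> differentiates along fixed
  directions, while in Dg(f x)(Df x v) the direction moves with x. Each factor of the expansion is
  of class C^k by induction.\<close>

lemma Ck_on_compose:
  fixes f :: "'a::real_normed_vector \<Rightarrow> 'b::euclidean_space"
  assumes "open U" "open V" "f ` U \<subseteq> V" "Ck_on U k f" "Ck_on V k g"
  shows "Ck_on U k (\<lambda>x. g (f x))"
  using assms(4,5)
proof (induction k arbitrary: g)
  case 0
  then show ?case using assms(3) by (auto intro: continuous_on_compose2)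
next
  case (Suc k)
  have fV: "f x \<in> V" if "x \<in> U" for x using that assms(3) by blast
  have lin: "linear (Df g (f x))" if "x \<in> U" for x
    using Ck_on_SucD(1)[OF Suc.prems(2) fV[OF that]] has_derivative_linear by blast
  show ?case
  proof (rule Ck_on_SucI[OF assms(1)])
    fix x assume x: "x \<in> U"
    have "((\<lambda>x. g (f x)) has_derivative (\<lambda>v. Df g (f x) (Df f x v))) (at x)"
      by (rule has_derivative_compose[OF Ck_on_SucD(1)[OF Suc.prems(1) x] Ck_on_SucD(1)[OF Suc.prems(2) fV[OF x]]])
    then show "((\<lambda>x. g (f x)) has_derivative (\<lambda>v. \<Sum>b\<in>Basis. (Df f x v \<bullet> b) *\<^sub>R Df g (f x) b)) (at x)"
      by (simp add: linear_basis_expansion[OF lin[OF x], symmetric])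
  next
    fix v
    show "Ck_on U k (\<lambda>x. \<Sum>b\<in>Basis. (Df f x v \<bullet> b) *\<^sub>R Df g (f x) b)"
      by (intro Ck_on_sum Ck_on_scaleR Ck_on_inner assms(1) Ck_on_const Ck_on_SucD(2)[OF Suc.prems(1)]
            Suc.IH Ck_on_Suc_imp[OF Suc.prems(1)] Ck_on_SucD(2)[OF Suc.prems(2)])
  qed
qed

lemma Ck_on_powr: "Ck_on {0<..} k (\<lambda>t::real. t powr a)"
proof (induction k arbitrary: a)
  case 0
  then show ?case by (auto intro!: continuous_intros)
next
  case (Suc k)
  show ?case
  proof (rule Ck_on_SucI)
    show "((\<lambda>t. t powr a) has_derivative (\<lambda>v. a * x powr (a - 1) * v)) (at x)"
      if "x \<in> {0<..}" for x :: real
      using that has_real_derivative_powr[of x a]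
      by (simp add: has_field_derivative_def)
    show "Ck_on {0<..} k (\<lambda>x. a * x powr (a - 1) * v)" for v
      by (intro Ck_on_mult Ck_on_const Suc.IH) auto
  qed simp
qed

lemma Ck_on_powr_compose:
  fixes f :: "'a::real_normed_vector \<Rightarrow> real"
  assumes "open U" "Ck_on U k f" "\<And>x. x \<in> U \<Longrightarrow> 0 < f x"
  shows "Ck_on U k (\<lambda>x. f x powr a)"
  by (rule Ck_on_compose[OF assms(1) _ _ assms(2) Ck_on_powr]) (use assms(3) in auto)

text \<open>A C^2 cutoff profile. Two derivatives are all that is ever asked of a cutoff, so a cube
  replaces the usual smooth bump.\<close>

definition pos_cube :: "real \<Rightarrow> real" where "pos_cube t = (max 0 t) ^ 3"

text \<open>At the kink the difference quotient is at most |h|^(n+1), which tends to 0.\<close>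

lemma has_derivative_max_power:
  "((\<lambda>t::real. (max 0 t) ^ Suc (Suc n)) has_derivative (\<lambda>v. real (Suc (Suc n)) * (max 0 x) ^ Suc n * v)) (at x)"
proof -
  consider "x > 0" | "x < 0" | "x = 0" by linarith
  then show ?thesis
  proof cases
    case 1
    have "((\<lambda>t::real. t ^ Suc (Suc n)) has_derivative (\<lambda>v. real (Suc (Suc n)) * (max 0 x) ^ Suc n * v)) (at x)"
      using 1 DERIV_pow[of "Suc (Suc n)" x] by (simp add: has_field_derivative_def max_def)
    then show ?thesis
      by (rule has_derivative_transform_within_open[of _ _ _ UNIV "{0<..}"]) (use 1 in auto)
  next
    case 2
    have "((\<lambda>t::real. 0::real) has_derivative (\<lambda>v. real (Suc (Suc n)) * (max 0 x) ^ Suc n * v)) (at x)"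
      using 2 by simp
    then show ?thesis
      by (rule has_derivative_transform_within_open[of _ _ _ UNIV "{..<0}"]) (use 2 in \<open>auto simp: max_def\<close>)
  next
    case 3
    have "((\<lambda>t::real. (max 0 t) ^ Suc (Suc n)) has_real_derivative 0) (at 0)"
      unfolding DERIV_def
    proof (rule tendsto_rabs_zero_cancel, rule tendsto_sandwich[of "\<lambda>_. 0"])
      show "\<forall>\<^sub>F h in at 0. \<bar>(max 0 (0 + h) ^ Suc (Suc n) - max 0 0 ^ Suc (Suc n)) / h\<bar> \<le> \<bar>h::real\<bar> ^ Suc n"
        by (rule always_eventually) (auto simp: max_def abs_mult power_abs field_simps mult_le_0_iff)
      show "((\<lambda>h::real. \<bar>h\<bar> ^ Suc n) \<longlongrightarrow> 0) (at 0)"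
        by (rule tendsto_eq_intros | simp)+
    qed auto
    then show ?thesis using 3 by (simp add: has_field_derivative_def lambda_zero)
  qed
qed

lemma Ck_on_pos_cube: "Ck_on UNIV 2 pos_cube"
  unfolding numeral_2_eq_2
proof (rule Ck_on_SucI)
  show "(pos_cube has_derivative (\<lambda>v. 3 * (max 0 x) ^ 2 * v)) (at x)" for x
    using has_derivative_max_power[of 1 x] unfolding pos_cube_def by (simp add: numeral_eq_Suc)
  show "Ck_on UNIV (Suc 0) (\<lambda>x. 3 * (max 0 x)\<^sup>2 * v)" for v :: real
  proof (rule Ck_on_SucI)
    show "((\<lambda>x. 3 * (max 0 x)\<^sup>2 * v) has_derivative (\<lambda>w. 3 * (2 * max 0 x * w) * v)) (at x)" for x
      using has_derivative_mult_left[OF has_derivative_mult_right[OF has_derivative_max_power[of 0 x], of 3], of v]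
      by (simp add: numeral_2_eq_2 algebra_simps)
    show "Ck_on UNIV 0 (\<lambda>x. 3 * (2 * max 0 x * va) * v)" for va :: real
      by (auto intro!: continuous_intros)
  qed simp
qed simp

lemma pos_cube_nonneg [simp]: "0 \<le> pos_cube t"
  and pos_cube_pos_iff: "0 < pos_cube t \<longleftrightarrow> 0 < t"
  and pos_cube_eq_0_iff: "pos_cube t = 0 \<longleftrightarrow> t \<le> 0"
  by (auto simp: pos_cube_def max_def)

text \<open>\<open>Ck_on\<close> gives continuity of the derivative along fixed directions only; a
  basis expansion makes it joint in point and direction.\<close>

lemma C1_blinfun_continuous:
  fixes f :: "'a::euclidean_space \<Rightarrow> 'b::real_normed_vector"
  assumes "Ck_on U 1 f" "continuous_on T p" "p ` T \<subseteq> U" "continuous_on T w"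
  shows "continuous_on T (\<lambda>z. Df f (p z) (w z))"
proof -
  have f: "Ck_on U (Suc 0) f" using assms(1) by simp
  have "linear (Df f (p z))" if "z \<in> T" for z
    using Ck_on_SucD(1)[OF f] has_derivative_linear assms(3) that by blast
  then have e: "Df f (p z) (w z) =
     (\<Sum>b\<in>Basis. (w z \<bullet> b) *\<^sub>R Df f (p z) b)" if "z \<in> T" for z
    using that linear_basis_expansion by blast
  have c: "continuous_on U (\<lambda>y. Df f y b)" for b
    using Ck_on_SucD(2)[OF f, of b] by simp
  have "continuous_on T (\<lambda>z. (\<Sum>b\<in>Basis. (w z \<bullet> b) *\<^sub>R Df f (p z) b))"
    using c by (intro continuous_intros assms(4) continuous_on_compose2[OF c assms(2,3)])
  then show ?thesis by (simp add: e cong: continuous_on_cong)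
qed

section \<open>C^1 elements of W^{1,infinity}\<close>

lemma C1D:
  assumes "Ck_on U 1 f"
  shows "x \<in> U \<Longrightarrow> (f has_derivative Df f x) (at x)"
    and "x \<in> U \<Longrightarrow> linear (Df f x)"
    and "continuous_on U (\<lambda>x. Df f x v)"
    and "continuous_on U f"
proof -
  have f: "Ck_on U (Suc 0) f" using assms by simp
  show "(f has_derivative Df f x) (at x)" if "x \<in> U"
    using Ck_on_SucD(1)[OF f that] .
  then show "linear (Df f x)" if "x \<in> U"
    by (rule has_derivative_linear) (rule that)
  show "continuous_on U (\<lambda>x. Df f x v)" using Ck_on_SucD(2)[OF f] by simp
  show "continuous_on U f" by (rule Ck_on_continuous[OF f])
qed

lemma linear_norm_le_basis:
  fixes L :: "'a::euclidean_space \<Rightarrow> 'b::real_normed_vector"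
  assumes "linear L" "\<And>b. b \<in> Basis \<Longrightarrow> norm (L b) \<le> B"
  shows "norm (L v) \<le> real DIM('a) * B * norm v"
proof -
  have "norm (L v) \<le> (\<Sum>b\<in>Basis. norm ((v \<bullet> b) *\<^sub>R L b))"
    unfolding linear_basis_expansion[OF assms(1), of v] by (rule norm_sum)
  also have "\<dots> \<le> (\<Sum>b\<in>(Basis :: 'a set). norm v * B)"
    by (intro sum_mono) (simp add: mult_mono assms(2) Basis_le_norm)
  finally show ?thesis by (simp add: algebra_simps)
qed

lemma C1_lipschitz_convex:
  fixes f :: "'a::euclidean_space \<Rightarrow> 'b::real_normed_vector"
  assumes "Ck_on U 1 f" "convex S" "S \<subseteq> U" "\<And>x b. x \<in> S \<Longrightarrow> b \<in> Basis \<Longrightarrow> norm (Df f x b) \<le> B"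
    and "x \<in> S" "y \<in> S"
  shows "norm (f x - f y) \<le> real DIM('a) * B * norm (x - y)"
proof (rule differentiable_bound[OF assms(2) _ _ assms(5,6)])
  fix z assume z: "z \<in> S"
  then have U: "z \<in> U" using assms(3) by blast
  show "(f has_derivative Df f z) (at z within S)"
    by (rule has_derivative_at_withinI[OF C1D(1)[OF assms(1) U]])
  show "onorm (Df f z) \<le> real DIM('a) * B"
    by (rule onorm_le) (rule linear_norm_le_basis[OF C1D(2)[OF assms(1) U] assms(4)[OF z]])
qed

lemma continuous_norm_bound_compact:
  assumes "continuous_on UNIV g" "compact K"
  shows "\<exists>C. \<forall>x\<in>K. norm (g x) \<le> C"
proof -
  have "bounded (g ` K)"
    by (rule compact_imp_bounded[OF compact_continuous_image[OF continuous_on_subset[OF assms(1) subset_UNIV] assms(2)]])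
  then show ?thesis unfolding bounded_iff by blast
qed

lemma C1_bounded_on_compact:
  fixes f :: "'a::euclidean_space \<Rightarrow> 'b::real_normed_vector"
  assumes "Ck_on UNIV 1 f" "compact K"
  obtains B where "0 < B" "\<And>x. x \<in> K \<Longrightarrow> norm (f x) \<le> B"
    "\<And>x b. x \<in> K \<Longrightarrow> b \<in> Basis \<Longrightarrow> norm (Df f x b) \<le> B"
proof -
  note bd = continuous_norm_bound_compact[OF _ assms(2)]
  obtain A where A: "\<forall>x\<in>K. norm (f x) \<le> A" using bd[OF C1D(4)[OF assms(1)]] ..
  define C where "C b = (SOME C. \<forall>x\<in>K. norm (Df f x b) \<le> C)" for b
  have C: "\<forall>x\<in>K. norm (Df f x b) \<le> C b" for b
    unfolding C_def by (rule someI_ex) (rule bd[OF C1D(3)[OF assms(1)]])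
  show ?thesis
  proof
    have s: "C b \<le> (\<Sum>b\<in>Basis. \<bar>C b\<bar>)" if "b \<in> Basis" for b
      using member_le_sum[of b Basis "\<lambda>b. \<bar>C b\<bar>"] that by auto
    have s0: "0 \<le> (\<Sum>b\<in>Basis. \<bar>C b\<bar>)" by (intro sum_nonneg) simp
    then show "0 < 1 + \<bar>A\<bar> + (\<Sum>b\<in>Basis. \<bar>C b\<bar>)" by linarith
    show "norm (f x) \<le> 1 + \<bar>A\<bar> + (\<Sum>b\<in>Basis. \<bar>C b\<bar>)" if "x \<in> K" for x
      using bspec[OF A that] s0 by linarith
    show "norm (Df f x b) \<le> 1 + \<bar>A\<bar> + (\<Sum>b\<in>Basis. \<bar>C b\<bar>)" if "x \<in> K" "b \<in> Basis" for x b
      using bspec[OF C[of b] that(1)] s[OF that(2)] by linarith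
  qed
qed

lemma frechet_derivative_zero_off:
  assumes "closed K" "\<And>x. x \<notin> K \<Longrightarrow> f x = 0" "x \<notin> K"
  shows "Df f x v = 0"
proof -
  have "Df f x = Df (\<lambda>_. 0) x"
    by (rule frechet_derivative_cong_open(2)[of "- K"]) (use assms in \<open>auto simp: open_Compl\<close>)
  then show ?thesis by (simp add: frechet_derivative_const)
qed

lemma vector_derivative_quotient_tendsto:
  fixes h :: "'a::real_normed_vector \<Rightarrow> 'b::real_normed_vector"
  assumes "((\<lambda>t. h (x + t *\<^sub>R v)) has_vector_derivative d) (at 0)"
  shows "((\<lambda>t. (1 / t) *\<^sub>R (h (x + t *\<^sub>R v) - h x)) \<longlongrightarrow> d) (at 0)"
proof -
  have "((\<lambda>t. norm (h (x + (0 + t) *\<^sub>R v) - h (x + 0 *\<^sub>R v) - t *\<^sub>R d) / norm t) \<longlongrightarrow> 0) (at 0)"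
    using assms unfolding has_vector_derivative_def has_derivative_at by blast
  then have "((\<lambda>t. norm (h (x + t *\<^sub>R v) - h x - t *\<^sub>R d) / \<bar>t\<bar>) \<longlongrightarrow> 0) (at 0)"
    by simp
  note lim = this
  have eq: "norm (h (x + t *\<^sub>R v) - h x - t *\<^sub>R d) / \<bar>t\<bar> =
      norm ((1 / t) *\<^sub>R (h (x + t *\<^sub>R v) - h x) - d)" if "t \<noteq> 0" for t
  proof -
    have "(1 / t) *\<^sub>R (h (x + t *\<^sub>R v) - h x) - d = (1 / t) *\<^sub>R (h (x + t *\<^sub>R v) - h x - t *\<^sub>R d)"
      using that by (simp add: scaleR_diff_right)
    then show ?thesis by simp
  qed
  have "((\<lambda>t. norm ((1 / t) *\<^sub>R (h (x + t *\<^sub>R v) - h x) - d)) \<longlongrightarrow> 0) (at 0)"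
    by (rule Lim_transform_eventually[OF lim]) (simp add: eventually_at_filter eq)
  then show ?thesis by (simp add: tendsto_norm_zero_iff Lim_null[of "\<lambda>t. (1 / t) *\<^sub>R (h (x + t *\<^sub>R v) - h x)"])
qed

text \<open>Translation invariance makes the integral of every difference quotient vanish.\<close>

lemma integral_derivative_eq_0:
  fixes h :: "'a::euclidean_space \<Rightarrow> 'b::euclidean_space"
  assumes h: "Ck_on UNIV 1 h" and K: "compact K" "\<And>x. x \<notin> K \<Longrightarrow> h x = 0"
  shows "(LINT x|lborel. Df h x v) = 0"
proof -
  obtain B where B: "0 < B" "\<And>x. x \<in> K \<Longrightarrow> norm (h x) \<le> B"
    "\<And>x b. x \<in> K \<Longrightarrow> b \<in> Basis \<Longrightarrow> norm (Df h x b) \<le> B"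
    using C1_bounded_on_compact[OF h K(1)] by blast
  have B': "norm (Df h x b) \<le> B" if "b \<in> Basis" for x b
    using B(1) B(3)[of x b] that frechet_derivative_zero_off[OF compact_imp_closed[OF K(1)] K(2)]
    by (cases "x \<in> K") auto
  define L where "L = real DIM('a) * B * norm v"
  obtain R where R: "\<And>x. x \<in> K \<Longrightarrow> norm x \<le> R"
    using compact_imp_bounded[OF K(1)] unfolding bounded_iff by blast
  define c where "c n = inverse (real (Suc n))" for n
  have c: "0 < c n" "c n \<le> 1" for n by (auto simp: c_def field_simps)
  have hb[measurable]: "h \<in> borel_measurable borel"
    using C1D(4)[OF h] by (rule borel_measurable_continuous_onI)
  define q where "q n x = (1 / c n) *\<^sub>R (h (c n *\<^sub>R v + x) - h x)" for n x
  \<comment> \<open>The dominating function: with steps \<open>c n\<close> of size at most 1 the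
    quotients vanish outside this ball, and \<open>L\<close> is the Lipschitz bound for
    \<open>h\<close> along \<open>v\<close>.\<close>
  define w where "w x = indicator (cball 0 (R + norm v)) x *\<^sub>R L" for x :: 'a
  have wi: "integrable lborel w"
    unfolding w_def by (intro integrable_scaleR_left integrable_real_indicator)
      (use emeasure_bounded_finite[OF bounded_cball] in auto)
  have qw: "norm (q n x) \<le> w x" for n x
  proof (cases "norm x \<le> R + norm v")
    case True
    have "norm (h (c n *\<^sub>R v + x) - h x) \<le> real DIM('a) * B * norm ((c n *\<^sub>R v + x) - x)"
      by (rule C1_lipschitz_convex[OF h convex_UNIV]) (use B' in auto)
    also have "\<dots> = c n * L" using c(1)[of n] by (simp add: L_def)
    finally show ?thesis using True c(1)[of n]
      by (simp add: q_def w_def divide_simps mult.commute)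
  next
    case False
    have "x \<notin> K" using False R[of x] norm_ge_zero[of v] by linarith
    moreover have "c n *\<^sub>R v + x \<notin> K"
    proof
      assume "c n *\<^sub>R v + x \<in> K"
      then have "norm (c n *\<^sub>R v + x) \<le> R" using R by blast
      moreover have "norm x - norm (c n *\<^sub>R v) \<le> norm (c n *\<^sub>R v + x)"
        by (metis add.commute norm_diff_ineq)
      moreover have "norm (c n *\<^sub>R v) \<le> norm v"
        using c[of n] mult_right_mono[of "c n" 1 "norm v"] by simp
      ultimately show False using False by linarith
    qed
    ultimately show ?thesis using False by (simp add: q_def w_def K(2))
  qed
  have "(\<lambda>n. LINT x|lborel. q n x) \<longlonglongrightarrow> (LINT x|lborel. Df h x v)"
  proof (rule integral_dominated_convergence[OF _ _ wi])
    show "(\<lambda>x. Df h x v) \<in> borel_measurable lborel"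
      using C1D(3)[OF h] by (auto intro: borel_measurable_continuous_onI)
    show "q n \<in> borel_measurable lborel" for n unfolding q_def by measurable
    show "AE x in lborel. (\<lambda>n. q n x) \<longlonglongrightarrow> Df h x v"
    proof (rule AE_I2)
      fix x
      have d: "((\<lambda>t. x + t *\<^sub>R v) has_vector_derivative v) (at 0)"
        by (auto intro!: derivative_eq_intros)
      have "((\<lambda>t. h (x + t *\<^sub>R v)) has_derivative (\<lambda>t. Df h x (t *\<^sub>R v))) (at 0)"
        using has_derivative_compose[OF d[unfolded has_vector_derivative_def], of h] C1D(1)[OF h, of x] by simp
      then have "((\<lambda>t. h (x + t *\<^sub>R v)) has_vector_derivative Df h x v) (at 0)"
        by (simp add: has_vector_derivative_def linear_cmul[OF C1D(2)[OF h UNIV_I]])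
      then have "((\<lambda>t. (1 / t) *\<^sub>R (h (x + t *\<^sub>R v) - h x)) \<longlongrightarrow> Df h x v) (at 0)"
        by (rule vector_derivative_quotient_tendsto)
      moreover have "filterlim c (at 0) sequentially"
        unfolding filterlim_at using c(1) LIMSEQ_inverse_real_of_nat
        by (auto simp: c_def[abs_def] intro!: always_eventually)
      ultimately show "(\<lambda>n. q n x) \<longlonglongrightarrow> Df h x v"
        unfolding q_def by (auto dest: filterlim_compose simp: add.commute)
    qed
    show "AE x in lborel. norm (q n x) \<le> w x" for n using qw by simp
  qed
  moreover have "(LINT x|lborel. q n x) = 0" for n
  proof -
    have i: "integrable lborel h"
    proof -
      have "integrable lborel (\<lambda>x. indicator K x *\<^sub>R h x)"
        by (rule borel_integrable_compact[OF K(1) continuous_on_subset[OF C1D(4)[OF h]]]) simp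
      moreover have "(\<lambda>x. indicator K x *\<^sub>R h x) = h" using K(2) by (fastforce simp: indicator_def)
      ultimately show ?thesis by simp
    qed
    have i2: "integrable lborel (\<lambda>x. h (c n *\<^sub>R v + x))"
      using i integrable_distr_eq[of "(+) (c n *\<^sub>R v)" lborel borel h]
      by (simp add: lborel_distr_plus)
    have "(LINT x|lborel. h (c n *\<^sub>R v + x)) = (LINT x|lborel. h x)"
      using integral_distr[of "(+) (c n *\<^sub>R v)" lborel borel h]
      by (simp add: lborel_distr_plus)
    then show ?thesis unfolding q_def using i i2 by simp
  qed
  ultimately show ?thesis by (simp add: LIMSEQ_const_iff)
qed

text \<open>A classical stand-in for the W^{1,infinity} norm of C^1 maps: pointwise bounds on values
  and partial derivatives, which behave well under sums and products and control the norm up to a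
  dimensional factor.\<close>

definition C1_bdd :: "('a::euclidean_space \<Rightarrow> 'b::euclidean_space) \<Rightarrow> real \<Rightarrow> bool"
  where "C1_bdd f B \<longleftrightarrow> Ck_on UNIV 1 f \<and> (\<forall>x. norm (f x) \<le> B) \<and>
    (\<forall>x. \<forall>b\<in>Basis. norm (Df f x b) \<le> B)"

lemma C1_bdd_compact_support:
  assumes "Ck_on UNIV 1 f" "compact K" "\<And>x. x \<notin> K \<Longrightarrow> f x = 0"
  obtains B where "C1_bdd f B"
proof -
  obtain B where B: "0 < B" "\<And>x. x \<in> K \<Longrightarrow> norm (f x) \<le> B"
    "\<And>x b. x \<in> K \<Longrightarrow> b \<in> Basis \<Longrightarrow> norm (Df f x b) \<le> B"
    using C1_bounded_on_compact[OF assms(1,2)] by blast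
  have "norm (f x) \<le> B" for x using B(1) B(2)[of x] assms(3)[of x] by (cases "x \<in> K") auto
  moreover have "norm (Df f x b) \<le> B" if "b \<in> Basis" for x b
    using B(1) B(3)[of x b] that frechet_derivative_zero_off[OF compact_imp_closed[OF assms(2)] assms(3)]
    by (cases "x \<in> K") auto
  ultimately have "norm (f x) \<le> B" "b \<in> Basis \<Longrightarrow> norm (Df f x b) \<le> B" for x b
    by blast+
  then show ?thesis using that assms(1) unfolding C1_bdd_def by blast
qed

text \<open>Integration by parts is \<open>integral_derivative_eq_0\<close> for the product \<phi>
  f, whose support is compact because that of the test function is; the Leibniz rule splits the
  integral.\<close>

lemma C1_bdd_weak_derivative:
  fixes f :: "'a::euclidean_space \<Rightarrow> 'b::euclidean_space"
  assumes f: "C1_bdd f B"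
  shows "ess_norm f \<le> B" "ess_bounded f"
    "weak_derivative f (\<lambda>x. Blinfun (Df f x))"
    "ess_norm (\<lambda>x. Blinfun (Df f x)) \<le> real DIM('a) * B"
proof -
  have c: "Ck_on UNIV 1 f" and A: "norm (f x) \<le> B"
    and B: "\<And>b. b \<in> Basis \<Longrightarrow> norm (Df f x b) \<le> B" for x
    using f by (auto simp: C1_bdd_def)
  have bl: "bounded_linear (Df f x)" for x
    using C1D(1)[OF c, of x] has_derivative_bounded_linear by auto
  have ap: "blinfun_apply (Blinfun (Df f x)) = Df f x" for x
    by (rule bounded_linear_Blinfun_apply[OF bl])
  have B0: "0 \<le> B" using A norm_ge_zero order_trans by blast
  show "ess_norm f \<le> B" by (rule ess_norm_le) (simp add: A)
  show eb: "ess_bounded f" unfolding ess_bounded_def using A by auto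
  have n: "AE x in lborel. norm (Blinfun (Df f x)) \<le> real DIM('a) * B"
    by (intro AE_I2 norm_blinfun_bound)
      (auto simp: ap B0 intro!: linear_norm_le_basis[OF C1D(2)[OF c] B])
  then show "ess_norm (\<lambda>x. Blinfun (Df f x)) \<le> real DIM('a) * B"
    by (rule ess_norm_le)
  have m: "f \<in> borel_measurable borel"
    using C1D(4)[OF c] by (rule borel_measurable_continuous_onI)
  have m': "(\<lambda>x. Df f x v) \<in> borel_measurable borel" for v
    using C1D(3)[OF c] by (rule borel_measurable_continuous_onI)
  have eb': "ess_bounded (\<lambda>x. Df f x v)" for v
    unfolding ess_bounded_def using linear_norm_le_basis[OF C1D(2)[OF c] B, of _ v] by blast
  show "weak_derivative f (\<lambda>x. Blinfun (Df f x))"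
    unfolding weak_derivative_def ap
  proof (intro conjI allI impI)
    show "ess_bounded (\<lambda>x. Blinfun (Df f x))"
      unfolding ess_bounded_def using n by blast
    fix v show "(\<lambda>x. Df f x v) \<in> borel_measurable borel" by (rule m')
    fix \<phi> :: "'a \<Rightarrow> real" assume t: "test_function \<phi>"
    have p: "Ck_on UNIV 1 \<phi>" using t unfolding test_function_def smooth_def by blast
    have "(LINT x|lborel. Df (\<lambda>x. \<phi> x *\<^sub>R f x) x v) = 0"
    proof (rule integral_derivative_eq_0)
      show "Ck_on UNIV 1 (\<lambda>x. \<phi> x *\<^sub>R f x)" by (rule Ck_on_scaleR[OF open_UNIV p c])
      show "compact (closure {x. \<phi> x \<noteq> 0})" using t by (simp add: test_function_def)
      show "\<phi> x *\<^sub>R f x = 0" if "x \<notin> closure {x. \<phi> x \<noteq> 0}" for x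
        using that closure_subset[of "{x. \<phi> x \<noteq> 0}"] by auto
    qed
    moreover have "Df (\<lambda>x. \<phi> x *\<^sub>R f x) x v =
      \<phi> x *\<^sub>R Df f x v + Df \<phi> x v *\<^sub>R f x" for x
      using frechet_derivative_eq[OF bounded_bilinear.FDERIV[OF bounded_bilinear_scaleR C1D(1)[OF p UNIV_I] C1D(1)[OF c UNIV_I]]] by simp
    ultimately show "(LINT x|lborel. \<phi> x *\<^sub>R Df f x v) =
      - (LINT x|lborel. Df \<phi> x v *\<^sub>R f x)"
      by (simp only: eq_neg_iff_add_eq_0
            Bochner_Integration.integral_add[OF test_integrable(1)[OF t m' eb', of v] test_integrable(2)[OF t m eb, of v]])
  qed
qed

text \<open>The factor counts 1 for the values and \<open>DIM('a)\<close> for passing from partial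
  derivatives to the operator norm.\<close>

lemma C1_bdd_W1inf:
  fixes f :: "'a::euclidean_space \<Rightarrow> 'b::euclidean_space"
  assumes "C1_bdd f B"
  shows "apply_W1inf (W1inf f) = f" "norm (W1inf f) \<le> (real DIM('a) + 1) * B"
proof -
  have "Ck_on UNIV 1 f" using assms by (simp add: C1_bdd_def)
  then show a: "apply_W1inf (W1inf f) = f"
    by (intro W1inf_inverse CollectI conjI exI)
      (rule C1D(4) C1_bdd_weak_derivative(2,3)[OF assms], assumption?)+
  have "weak_derivative_norm f \<le> real DIM('a) * B"
    by (rule order_trans[OF weak_derivative_norm_le C1_bdd_weak_derivative(4)[OF assms]])
      (rule C1_bdd_weak_derivative(3)[OF assms])
  then show "norm (W1inf f) \<le> (real DIM('a) + 1) * B"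
    using C1_bdd_weak_derivative(1)[OF assms] by (simp add: norm_W1inf_def a algebra_simps)
qed

lemma W1inf_eqI: "(\<And>x. apply_W1inf \<theta> x = apply_W1inf \<eta> x) \<Longrightarrow> \<theta> = \<eta>"
  by (simp add: apply_W1inf_inject[symmetric] fun_eq_iff)

section \<open>Derivatives in normed spaces\<close>

lemma frechet_blinfun_apply:
  "f differentiable (at y) \<Longrightarrow> blinfun_apply (frechet_blinfun f y) = Df f y"
  unfolding frechet_blinfun_def
  by (rule bounded_linear_Blinfun_apply)
    (metis frechet_derivative_works has_derivative_bounded_linear)

lemma directional_derivative:
  assumes "(f has_derivative f') (at a)"
  shows "((\<lambda>s. f (a + s *\<^sub>R h)) has_vector_derivative f' h) (at 0)"
proof -
  have "((\<lambda>s. a + s *\<^sub>R h) has_derivative (\<lambda>s. s *\<^sub>R h)) (at 0)"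
    by (auto intro!: derivative_eq_intros)
  then have "((\<lambda>s. f (a + s *\<^sub>R h)) has_derivative (\<lambda>s. f' (s *\<^sub>R h))) (at 0)"
    by (rule has_derivative_compose) (use assms in simp)
  then show ?thesis
    by (simp add: has_vector_derivative_def linear_cmul[OF has_derivative_linear[OF assms]])
qed

lemma vector_derivative_unique_local:
  assumes "(f has_vector_derivative a) (at (0::real))" "(g has_vector_derivative b) (at 0)"
    and "0 < \<delta>" "\<And>s. \<bar>s\<bar> < \<delta> \<Longrightarrow> f s = g s"
  shows "a = b"
proof -
  have "(g has_vector_derivative a) (at 0)"
    by (rule has_vector_derivative_transform_within_open[OF assms(1), of "ball 0 \<delta>"])
      (use assms(3,4) in \<open>auto simp: dist_norm\<close>)
  then show ?thesis using assms(2) by (rule vector_derivative_unique_at)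
qed

lemma frechet_derivative_local_eq:
  assumes "f differentiable (at a)" "0 < \<delta>" "\<And>s. \<bar>s\<bar> < \<delta> \<Longrightarrow> f (a + s *\<^sub>R h) = f (a + s *\<^sub>R k)"
  shows "Df f a h = Df f a k"
  using assms(1) unfolding frechet_derivative_works
  by (intro vector_derivative_unique_local[where f="\<lambda>s. f (a + s *\<^sub>R h)" and g="\<lambda>s. f (a + s *\<^sub>R k)", OF _ _ assms(2,3)]
      directional_derivative)

lemma twice_differentiableD:
  assumes "twice_differentiable_at f a"
  shows "f differentiable (at a)"
    and "(frechet_blinfun f has_derivative Df (frechet_blinfun f) a) (at a)"
    and "((\<lambda>y. blinfun_apply (frechet_blinfun f y) k) has_derivative (\<lambda>h. D2f f a h k)) (at a)"
    and "\<exists>\<delta>>0. \<forall>y. dist y a < \<delta> \<longrightarrow> f differentiable (at y)"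
proof -
  show d: "(frechet_blinfun f has_derivative Df (frechet_blinfun f) a) (at a)"
    using assms by (simp add: twice_differentiable_at_def frechet_derivative_works)
  show "((\<lambda>y. blinfun_apply (frechet_blinfun f y) k) has_derivative (\<lambda>h. D2f f a h k)) (at a)"
    unfolding second_frechet_derivative_def
    by (rule bounded_linear.has_derivative[OF bounded_bilinear.bounded_linear_left[OF bounded_bilinear_blinfun_apply] d])
  show "\<exists>\<delta>>0. \<forall>y. dist y a < \<delta> \<longrightarrow> f differentiable (at y)"
    using assms by (simp add: twice_differentiable_at_def eventually_nhds_metric)
  then show "f differentiable (at a)" by force
qed

lemma second_frechet_derivative_linear:
  assumes "twice_differentiable_at f a"
  shows "D2f f a (h + h') k = D2f f a h k + D2f f a h' k"
    "D2f f a (c *\<^sub>R h) k = c *\<^sub>R D2f f a h k"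
    "D2f f a h (k + k') = D2f f a h k + D2f f a h k'"
    "D2f f a h (c *\<^sub>R k) = c *\<^sub>R D2f f a h k"
    "\<exists>K\<ge>0. \<forall>h k. norm (D2f f a h k) \<le> K * norm h * norm k"
proof -
  have l: "linear (\<lambda>h. D2f f a h k)" for k
    using twice_differentiableD(3)[OF assms] by (rule has_derivative_linear)
  show "D2f f a (h + h') k = D2f f a h k + D2f f a h' k"
    "D2f f a (c *\<^sub>R h) k = c *\<^sub>R D2f f a h k"
    using linear_add[OF l] linear_cmul[OF l] by auto
  show "D2f f a h (k + k') = D2f f a h k + D2f f a h k'"
    "D2f f a h (c *\<^sub>R k) = c *\<^sub>R D2f f a h k"
    by (simp_all add: second_frechet_derivative_def blinfun.add_right blinfun.scaleR_right)
  obtain K where K: "\<And>h. norm (Df (frechet_blinfun f) a h) \<le> norm h * K" "0 \<le> K"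
    using bounded_linear.nonneg_bounded[OF has_derivative_bounded_linear[OF twice_differentiableD(2)[OF assms]]]
    by blast
  have "norm (D2f f a h k) \<le> K * norm h * norm k" for h k
  proof -
    have "norm (D2f f a h k) \<le> norm (Df (frechet_blinfun f) a h) * norm k"
      unfolding second_frechet_derivative_def by (rule norm_blinfun)
    also have "\<dots> \<le> (norm h * K) * norm k" by (rule mult_right_mono[OF K(1)]) simp
    finally show ?thesis by (simp add: mult.commute)
  qed
  then show "\<exists>K\<ge>0. \<forall>h k. norm (D2f f a h k) \<le> K * norm h * norm k"
    using K(2) by blast
qed

text \<open>Differentiating in \<open>s\<close> at 0 for each small \<open>t\<close> turns the
  identity into one between first derivatives at \<open>t *\<^sub>R h1\<close> and
  \<open>t *\<^sub>R h2\<close>; differentiating that in \<open>t\<close> gives the claim.\<close>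

lemma second_frechet_derivative_local_eq:
  assumes f: "twice_differentiable_at f 0" and \<delta>: "0 < \<delta>"
    and eq: "\<And>s t. \<bar>s\<bar> < \<delta> \<Longrightarrow> \<bar>t\<bar> < \<delta> \<Longrightarrow> f (t *\<^sub>R h1 + s *\<^sub>R k1) = f (t *\<^sub>R h2 + s *\<^sub>R k2)"
  shows "D2f f 0 h1 k1 = D2f f 0 h2 k2"
proof -
  obtain e where e: "0 < e" "\<And>y. dist y 0 < e \<Longrightarrow> f differentiable (at y)"
    using twice_differentiableD(4)[OF f] by blast
  \<comment> \<open>The second bound keeps \<open>t *\<^sub>R h1\<close> and
    \<open>t *\<^sub>R h2\<close> in the ball where \<open>f\<close> is differentiable; the 1 avoids
    a zero denominator.\<close>
  define d where "d = min \<delta> (e / (norm h1 + norm h2 + 1))"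
  have d: "0 < d" using \<delta> e(1) by (simp add: d_def add_nonneg_pos)
  have diff: "f differentiable (at (t *\<^sub>R h1))" "f differentiable (at (t *\<^sub>R h2))" if "\<bar>t\<bar> < d" for t
  proof -
    have "\<bar>t\<bar> * (norm h1 + norm h2 + 1) < e"
      using that unfolding d_def by (simp add: pos_less_divide_eq[symmetric] add_nonneg_pos)
    moreover have "\<bar>t\<bar> * norm h1 \<le> \<bar>t\<bar> * (norm h1 + norm h2 + 1)" "\<bar>t\<bar> * norm h2 \<le> \<bar>t\<bar> * (norm h1 + norm h2 + 1)"
      by (intro mult_left_mono; simp)+
    ultimately show "f differentiable (at (t *\<^sub>R h1))" "f differentiable (at (t *\<^sub>R h2))"
      by (auto intro!: e(2))
  qed
  show ?thesis
  proof (rule vector_derivative_unique_local[OF directional_derivative[OF twice_differentiableD(3)[OF f]]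
        directional_derivative[OF twice_differentiableD(3)[OF f]] d])
    fix t assume t: "\<bar>t\<bar> < d"
    have "Df f (t *\<^sub>R h1) k1 = Df f (t *\<^sub>R h2) k2"
    proof (rule vector_derivative_unique_local[OF directional_derivative[of f _ "t *\<^sub>R h1" k1] directional_derivative[of f _ "t *\<^sub>R h2" k2] d])
      show "(f has_derivative Df f (t *\<^sub>R h1)) (at (t *\<^sub>R h1))"
        "(f has_derivative Df f (t *\<^sub>R h2)) (at (t *\<^sub>R h2))"
        using diff[OF t] by (simp_all add: frechet_derivative_works)
      show "f (t *\<^sub>R h1 + s *\<^sub>R k1) = f (t *\<^sub>R h2 + s *\<^sub>R k2)" if "\<bar>s\<bar> < d" for s
        using that t eq unfolding d_def by simp
    qed
    then show "blinfun_apply (frechet_blinfun f (0 + t *\<^sub>R h1)) k1 = blinfun_apply (frechet_blinfun f (0 + t *\<^sub>R h2)) k2"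
      by (simp add: frechet_blinfun_apply diff[OF t])
  qed
qed

text \<open>The mean value theorem in the direction \<open>h\<close> reduces the second difference
  to an increment of the first derivative, which is then expanded to first order about
  \<open>a\<close>. Differentiability of the derivative at this single point is all that
  \<open>twice_differentiable_at\<close> offers.\<close>

lemma second_difference_estimate:
  fixes f :: "'v::real_normed_vector \<Rightarrow> real"
  assumes f: "\<forall>\<^sub>F y in nhds a. (f has_derivative f' y) (at y)"
    and D: "((\<lambda>y. f' y h) has_derivative (\<lambda>w. D w)) (at a)" and \<epsilon>: "0 < \<epsilon>"
  shows "\<exists>\<delta>>0. \<forall>t. 0 < t \<and> t < \<delta> \<longrightarrow>
    \<bar>f (a + t *\<^sub>R h + t *\<^sub>R k) - f (a + t *\<^sub>R h) - f (a + t *\<^sub>R k) + f a - t\<^sup>2 * D k\<bar> \<le> \<epsilon> * t\<^sup>2"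
proof -
  define M where "M = norm h + norm k + 1"
  have M: "0 < M" by (simp add: M_def add_nonneg_pos)
  \<comment> \<open>Two expansions are compared, each with a displacement of norm at most
    \<open>t * M\<close>, so the total error is
    \<open>2 * (e * (t * M)) = \<epsilon> * t\<close>.\<close>
  define e where "e = \<epsilon> / (2 * M)"
  have e: "0 < e" using \<epsilon> M by (simp add: e_def)
  obtain d1 where d1: "0 < d1" "\<And>y. dist y a < d1 \<Longrightarrow> (f has_derivative f' y) (at y)"
    using f unfolding eventually_nhds_metric by blast
  obtain d2 where d2: "0 < d2" "\<And>y. norm (y - a) < d2 \<Longrightarrow> norm (f' y h - f' a h - D (y - a)) \<le> e * norm (y - a)"
    using D e unfolding has_derivative_at_alt by blast
  have lD: "linear D" using D by (rule has_derivative_linear)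
  show ?thesis
  proof (intro exI[of _ "min d1 d2 / M"] conjI allI impI)
    show "0 < min d1 d2 / M" using d1(1) d2(1) M by simp
    fix t assume t: "0 < t \<and> t < min d1 d2 / M"
    then have tM: "t * M < d1" "t * M < d2" using M by (auto simp: pos_less_divide_eq)
    have nm: "norm (s *\<^sub>R h + u *\<^sub>R k) \<le> t * M" if "0 \<le> s" "s \<le> t" "0 \<le> u" "u \<le> t" for s u
    proof -
      have "norm (s *\<^sub>R h + u *\<^sub>R k) \<le> s * norm h + u * norm k"
        using norm_triangle_ineq[of "s *\<^sub>R h" "u *\<^sub>R k"] that by simp
      also have "\<dots> \<le> t * norm h + t * norm k" using that by (intro add_mono mult_right_mono) auto
      also have "\<dots> \<le> t * M" using t by (simp add: M_def algebra_simps)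
      finally show ?thesis .
    qed
    have der: "((\<lambda>s. f (a + s *\<^sub>R h + u *\<^sub>R k)) has_real_derivative f' (a + s *\<^sub>R h + u *\<^sub>R k) h) (at s)"
      if "0 \<le> s" "s \<le> t" "0 \<le> u" "u \<le> t" for s u
    proof -
      have F: "(f has_derivative f' (a + s *\<^sub>R h + u *\<^sub>R k)) (at (a + s *\<^sub>R h + u *\<^sub>R k))"
        using nm[OF that] tM by (intro d1(2)) (simp add: dist_norm add.assoc)
      have "((\<lambda>s. a + s *\<^sub>R h + u *\<^sub>R k) has_derivative (\<lambda>r. r *\<^sub>R h)) (at s)"
        by (auto intro!: derivative_eq_intros)
      from has_derivative_compose[OF this F]
      have "((\<lambda>s. f (a + s *\<^sub>R h + u *\<^sub>R k)) has_derivative (\<lambda>r. f' (a + s *\<^sub>R h + u *\<^sub>R k) (r *\<^sub>R h))) (at s)" .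
      then show ?thesis
        by (simp add: has_field_derivative_def linear_cmul[OF has_derivative_linear[OF F]] mult_commute_abs)
    qed
    \<comment> \<open>\<open>0 *\<^sub>R k\<close> is kept so that \<open>der\<close> and
      \<open>est\<close> apply to both terms, with u = t and u = 0.\<close>
    define g where "g s = f (a + s *\<^sub>R h + t *\<^sub>R k) - f (a + s *\<^sub>R h + 0 *\<^sub>R k)" for s
    have "\<exists>z. 0 < z \<and> z < t \<and> g t - g 0 = (t - 0) * (f' (a + z *\<^sub>R h + t *\<^sub>R k) h - f' (a + z *\<^sub>R h + 0 *\<^sub>R k) h)"
      unfolding g_def by (rule MVT2) (use t in \<open>auto simp del: scaleR_zero_left intro!: DERIV_diff der\<close>)
    then obtain z where z: "0 < z" "z < t"
      "g t - g 0 = t * (f' (a + z *\<^sub>R h + t *\<^sub>R k) h - f' (a + z *\<^sub>R h + 0 *\<^sub>R k) h)" by auto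
    have est: "\<bar>f' (a + (z *\<^sub>R h + u *\<^sub>R k)) h - f' a h - D (z *\<^sub>R h + u *\<^sub>R k)\<bar> \<le> e * (t * M)" if "0 \<le> u" "u \<le> t" for u
    proof -
      have n: "norm (z *\<^sub>R h + u *\<^sub>R k) \<le> t * M" using nm[of z u] z that by auto
      then have "\<bar>f' (a + (z *\<^sub>R h + u *\<^sub>R k)) h - f' a h - D (z *\<^sub>R h + u *\<^sub>R k)\<bar> \<le> e * norm (z *\<^sub>R h + u *\<^sub>R k)"
        using d2(2)[of "a + (z *\<^sub>R h + u *\<^sub>R k)"] tM by simp
      also have "\<dots> \<le> e * (t * M)" using n e by simp
      finally show ?thesis .
    qed
    have D1: "D (z *\<^sub>R h + t *\<^sub>R k) = D (z *\<^sub>R h + 0 *\<^sub>R k) + t * D k"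
      by (simp add: linear_add[OF lD] linear_cmul[OF lD])
    have "\<bar>f' (a + (z *\<^sub>R h + t *\<^sub>R k)) h - f' (a + (z *\<^sub>R h + 0 *\<^sub>R k)) h - t * D k\<bar> \<le> 2 * (e * (t * M))"
      using est[of t] est[of 0] t unfolding D1 by (simp only: abs_le_iff) linarith
    also have "2 * (e * (t * M)) = \<epsilon> * t" using M by (simp add: e_def)
    finally have "t * \<bar>f' (a + (z *\<^sub>R h + t *\<^sub>R k)) h - f' (a + (z *\<^sub>R h + 0 *\<^sub>R k)) h - t * D k\<bar> \<le> t * (\<epsilon> * t)"
      using t by (intro mult_left_mono) auto
    moreover have "t * \<bar>f' (a + (z *\<^sub>R h + t *\<^sub>R k)) h - f' (a + (z *\<^sub>R h + 0 *\<^sub>R k)) h - t * D k\<bar> = \<bar>g t - g 0 - t\<^sup>2 * D k\<bar>"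
    proof -
      have "g t - g 0 - t\<^sup>2 * D k = t * (f' (a + (z *\<^sub>R h + t *\<^sub>R k)) h - f' (a + (z *\<^sub>R h + 0 *\<^sub>R k)) h - t * D k)"
        unfolding z(3) by (simp add: power2_eq_square algebra_simps)
      then show ?thesis using t by (simp add: abs_mult)
    qed
    ultimately show "\<bar>f (a + t *\<^sub>R h + t *\<^sub>R k) - f (a + t *\<^sub>R h) - f (a + t *\<^sub>R k) + f a - t\<^sup>2 * D k\<bar> \<le> \<epsilon> * t\<^sup>2"
      by (simp add: g_def power2_eq_square algebra_simps)
  qed
qed

text \<open>The second difference is symmetric in \<open>h\<close> and \<open>k\<close>, so
  \<open>t\<^sup>2 * D h k\<close> and \<open>t\<^sup>2 * D k h\<close> approximate the same
  number.\<close>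

lemma second_derivative_symmetric:
  fixes f :: "'v::real_normed_vector \<Rightarrow> real"
  assumes f: "\<forall>\<^sub>F y in nhds a. (f has_derivative f' y) (at y)"
    and D: "\<And>u. ((\<lambda>y. f' y u) has_derivative (\<lambda>w. D w u)) (at a)"
  shows "D h k = D k h"
proof (rule ccontr)
  assume ne: "D h k \<noteq> D k h"
  \<comment> \<open>A quarter of the gap: the two estimates together bound the gap by 2 \<epsilon>,
    half of itself.\<close>
  define \<epsilon> where "\<epsilon> = \<bar>D h k - D k h\<bar> / 4"
  have \<epsilon>: "0 < \<epsilon>" using ne by (simp add: \<epsilon>_def)
  obtain d1 where d1: "0 < d1" "\<And>t. 0 < t \<and> t < d1 \<Longrightarrow>
    \<bar>f (a + t *\<^sub>R h + t *\<^sub>R k) - f (a + t *\<^sub>R h) - f (a + t *\<^sub>R k) + f a - t\<^sup>2 * D k h\<bar> \<le> \<epsilon> * t\<^sup>2"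
    using second_difference_estimate[OF f D[of h] \<epsilon>, of k] by blast
  obtain d2 where d2: "0 < d2" "\<And>t. 0 < t \<and> t < d2 \<Longrightarrow>
    \<bar>f (a + t *\<^sub>R k + t *\<^sub>R h) - f (a + t *\<^sub>R k) - f (a + t *\<^sub>R h) + f a - t\<^sup>2 * D h k\<bar> \<le> \<epsilon> * t\<^sup>2"
    using second_difference_estimate[OF f D[of k] \<epsilon>, of h] by blast
  define t where "t = min d1 d2 / 2"
  have t: "0 < t" "t < d1" "t < d2" using d1(1) d2(1) by (auto simp: t_def)
  have c: "a + t *\<^sub>R k + t *\<^sub>R h = a + t *\<^sub>R h + t *\<^sub>R k" by (simp add: algebra_simps)
  have "\<bar>t\<^sup>2 * D h k - t\<^sup>2 * D k h\<bar> \<le> 2 * (\<epsilon> * t\<^sup>2)"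
    using d1(2)[of t] d2(2)[of t] t unfolding c by linarith
  moreover have "t\<^sup>2 * \<bar>D h k - D k h\<bar> = \<bar>t\<^sup>2 * D h k - t\<^sup>2 * D k h\<bar>"
    unfolding right_diff_distrib[symmetric] abs_mult by simp
  ultimately have "t\<^sup>2 * \<bar>D h k - D k h\<bar> \<le> t\<^sup>2 * (2 * \<epsilon>)" by (simp add: mult.commute)
  then have "\<bar>D h k - D k h\<bar> \<le> 2 * \<epsilon>" using t(1) by simp
  then show False using \<epsilon> by (simp add: \<epsilon>_def)
qed

lemma second_frechet_derivative_symmetric:
  fixes f :: "'v::real_normed_vector \<Rightarrow> real"
  assumes "twice_differentiable_at f a"
  shows "D2f f a h k = D2f f a k h"
proof (rule second_derivative_symmetric[where f=f and f'="\<lambda>y. blinfun_apply (frechet_blinfun f y)"])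
  have "\<forall>\<^sub>F y in nhds a. f differentiable (at y)" using assms by (simp add: twice_differentiable_at_def)
  then show "\<forall>\<^sub>F y in nhds a. (f has_derivative blinfun_apply (frechet_blinfun f y)) (at y)"
    by eventually_elim (simp add: frechet_blinfun_apply frechet_derivative_works[symmetric])
  show "((\<lambda>y. blinfun_apply (frechet_blinfun f y) u) has_derivative (\<lambda>w. D2f f a w u)) (at a)" for u
    by (rule twice_differentiableD(3)[OF assms])
qed

lemma C2_derivative:
  assumes "Ck_on UNIV 2 f"
  shows "Ck_on UNIV 1 (\<lambda>x. Df f x u)" "Ck_on UNIV 1 f"
proof -
  have f: "Ck_on UNIV (Suc 1) f" using assms by (simp add: numeral_2_eq_2 del: Ck_on.simps)
  show "Ck_on UNIV 1 (\<lambda>x. Df f x u)" by (rule Ck_on_SucD(2)[OF f])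
  show "Ck_on UNIV 1 f" by (rule Ck_on_Suc_imp[OF f])
qed

lemma C2_symmetric_real:
  fixes f :: "'a::euclidean_space \<Rightarrow> real"
  assumes "Ck_on UNIV 2 f"
  shows "Df (\<lambda>x. Df f x u) y v =
    Df (\<lambda>x. Df f x v) y u"
  by (rule second_derivative_symmetric[where f=f and f'="\<lambda>y. Df f y" and
       D="\<lambda>w u. Df (\<lambda>x. Df f x u) y w" and a=y])
   (use C1D(1)[OF C2_derivative(2)[OF assms]] C1D(1)[OF C2_derivative(1)[OF assms]] in auto)

lemma C2_symmetric:
  fixes f :: "'a::euclidean_space \<Rightarrow> 'b::euclidean_space"
  assumes f: "Ck_on UNIV 2 f"
  shows "Df (\<lambda>x. Df f x u) y v =
    Df (\<lambda>x. Df f x v) y u"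
proof (rule euclidean_eqI)
  fix b :: 'b assume "b \<in> Basis"
  have fb: "Ck_on UNIV 2 (\<lambda>x. f x \<bullet> b)" by (intro Ck_on_inner open_UNIV f Ck_on_const)
  have e1: "Df (\<lambda>x. f x \<bullet> b) x u = Df f x u \<bullet> b" for x u
    using frechet_derivative_eq[OF has_derivative_inner_left[OF C1D(1)[OF C2_derivative(2)[OF f] UNIV_I]]] by simp
  have e2: "Df (\<lambda>x. Df f x u \<bullet> b) x v =
      Df (\<lambda>x. Df f x u) x v \<bullet> b" for x u v
    using frechet_derivative_eq[OF has_derivative_inner_left[OF C1D(1)[OF C2_derivative(1)[OF f] UNIV_I]]] by simp
  show "Df (\<lambda>x. Df f x u) y v \<bullet> b =
      Df (\<lambda>x. Df f x v) y u \<bullet> b"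
    using C2_symmetric_real[OF fb, of u y v] unfolding e1 e2 .
qed

section \<open>Dependence on the boundary values\<close>

text \<open>If \<open>x + \<theta>\<^sub>1 x = y + \<theta>\<^sub>2 y\<close> with \<open>x\<close> inside and \<open>y\<close> outside, the segment from \<open>x\<close> to \<open>y\<close>
  meets the boundary, where the two perturbations agree; the contraction property then forces \<open>x = y\<close>.\<close>

lemma perturbation_image_subset:
  fixes \<Omega> :: "'a::euclidean_space set"
  assumes R: "\<Omega> \<subseteq> cball 0 R" and B: "B = cball 0 (R + 2)"
    and b: "\<And>x. x \<in> B \<Longrightarrow> norm (\<theta>1 x) \<le> 1" "\<And>x. x \<in> B \<Longrightarrow> norm (\<theta>2 x) \<le> 1"
    and l1: "\<And>x y. x \<in> B \<Longrightarrow> y \<in> B \<Longrightarrow> norm (\<theta>1 x - \<theta>1 y) \<le> 1/4 * norm (x - y)"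
    and l2: "\<And>x y. x \<in> B \<Longrightarrow> y \<in> B \<Longrightarrow> norm (\<theta>2 x - \<theta>2 y) \<le> 1/4 * norm (x - y)"
    and eq: "\<And>p. p \<in> frontier \<Omega> \<Longrightarrow> \<theta>1 p = \<theta>2 p"
  shows "(\<lambda>x. x + \<theta>1 x) ` \<Omega> \<subseteq> (\<lambda>x. x + \<theta>2 x) ` \<Omega>"
proof
  fix z assume "z \<in> (\<lambda>x. x + \<theta>1 x) ` \<Omega>"
  then obtain x where x: "x \<in> \<Omega>" "z = x + \<theta>1 x" by blast
  have nx: "norm x \<le> R" using x(1) R by auto
  then have xB: "x \<in> B" by (simp add: B)
  have nz: "norm z \<le> R + 1" using norm_triangle_ineq[of x "\<theta>1 x"] nx b(1)[OF xB] x(2) by simp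
  \<comment> \<open>A fixed point is a preimage of \<open>z\<close> under Id + \<theta>2. The radius
    R + 2 makes \<open>B\<close> invariant: \<open>norm z\<close> is at most R + 1, and \<theta>2 is
    bounded by 1 on \<open>B\<close>.\<close>
  have "\<exists>!y\<in>B. z - \<theta>2 y = y"
  proof (rule Banach_fix[of _ "1/4"])
    show "complete B" by (simp add: B complete_eq_closed)
    show "B \<noteq> {}" using xB by blast
    show "(\<lambda>y. z - \<theta>2 y) ` B \<subseteq> B"
    proof
      fix w assume "w \<in> (\<lambda>y. z - \<theta>2 y) ` B"
      then obtain y where y: "y \<in> B" "w = z - \<theta>2 y" by blast
      have "norm w \<le> norm z + norm (\<theta>2 y)" unfolding y(2) by (rule norm_triangle_ineq4)
      then show "w \<in> B" using nz b(2)[OF y(1)] by (simp add: B)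
    qed
    show "dist (z - \<theta>2 v) (z - \<theta>2 w) \<le> 1/4 * dist v w" if "v \<in> B" "w \<in> B" for v w
      using l2[OF that(2,1)] by (simp add: dist_norm norm_minus_commute)
  qed auto
  then obtain y where y: "y \<in> B" "z - \<theta>2 y = y" by blast
  have "y \<in> \<Omega>"
  proof (rule ccontr)
    assume ny: "y \<notin> \<Omega>"
    have "closed_segment x y \<inter> frontier \<Omega> \<noteq> {}"
      by (rule connected_Int_frontier) (use x(1) ny in auto)
    then obtain p where p: "p \<in> closed_segment x y" "p \<in> frontier \<Omega>" by blast
    have pB: "p \<in> B"
      using closed_segment_subset[of x B y] xB y(1) p(1) by (auto simp: B)
    have "x - y = (\<theta>2 y - \<theta>2 p) + (\<theta>1 p - \<theta>1 x)"
      using x(2) y(2) eq[OF p(2)] by (simp add: algebra_simps)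
    then have "norm (x - y) \<le> norm (\<theta>2 y - \<theta>2 p) + norm (\<theta>1 p - \<theta>1 x)"
      by (simp only: norm_triangle_ineq)
    also have "\<dots> \<le> 1/4 * norm (y - p) + 1/4 * norm (p - x)"
      by (intro add_mono l1 l2 pB xB y(1))
    also have "norm (y - p) + norm (p - x) = norm (x - y)"
      using p(1) by (simp add: between_mem_segment[symmetric] between dist_norm norm_minus_commute)
    then have "1/4 * norm (y - p) + 1/4 * norm (p - x) = 1/4 * norm (x - y)" by simp
    finally have "norm (x - y) = 0" by simp
    then show False using x(1) ny by simp
  qed
  moreover have "z = y + \<theta>2 y" using y(2) by (simp add: algebra_simps)
  ultimately show "z \<in> (\<lambda>x. x + \<theta>2 x) ` \<Omega>" by blast
qed

abbreviation C1W :: "('a::euclidean_space, 'b::euclidean_space) W1inf \<Rightarrow> bool"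
  where "C1W \<theta> \<equiv> Ck_on UNIV 1 (apply_W1inf \<theta>)"

text \<open>For small \<open>s\<close> and \<open>t\<close> both perturbations are small and
  contractive on a ball around \<Omega>, so \<open>perturbation_image_subset\<close> applies in both
  directions. Two parameters are carried for the sake of the second derivative.\<close>

lemma shape_functional_trace:
  fixes \<Omega> :: "'a::euclidean_space set"
  assumes "bounded \<Omega>" and c: "C1W \<theta>1" "C1W \<theta>2" "C1W \<zeta>1" "C1W \<zeta>2"
    and eq: "\<And>x. x \<in> frontier \<Omega> \<Longrightarrow> apply_W1inf \<theta>1 x = apply_W1inf \<theta>2 x"
      "\<And>x. x \<in> frontier \<Omega> \<Longrightarrow> apply_W1inf \<zeta>1 x = apply_W1inf \<zeta>2 x"
  shows "\<exists>\<delta>>0. \<forall>s t. \<bar>s\<bar> < \<delta> \<longrightarrow> \<bar>t\<bar> < \<delta> \<longrightarrow>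
    shape_functional J \<Omega> (t *\<^sub>R \<theta>1 + s *\<^sub>R \<zeta>1) = shape_functional J \<Omega> (t *\<^sub>R \<theta>2 + s *\<^sub>R \<zeta>2)"
proof -
  obtain R where R: "\<Omega> \<subseteq> cball 0 R" using assms(1) unfolding bounded_iff by (auto simp: subset_iff)
  define B where "B = cball (0::'a) (R + 2)"
  have K: "compact B" "convex B" by (auto simp: B_def)
  have "\<exists>M>0. (\<forall>x\<in>B. norm (f x) \<le> M) \<and> (\<forall>x\<in>B. \<forall>y\<in>B. norm (f x - f y) \<le> M * norm (x - y))"
    if f: "Ck_on UNIV 1 f" for f :: "'a \<Rightarrow> 'a"
  proof -
    obtain M where M: "0 < M" "\<And>x. x \<in> B \<Longrightarrow> norm (f x) \<le> M"
      "\<And>x b. x \<in> B \<Longrightarrow> b \<in> Basis \<Longrightarrow> norm (Df f x b) \<le> M"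
      using C1_bounded_on_compact[OF f K(1)] by blast
    have M1: "1 * M \<le> real DIM('a) * M" by (intro mult_right_mono) (use M(1) in \<open>auto simp: Suc_leI\<close>)
    show ?thesis
      by (rule exI[of _ "real DIM('a) * M"])
        (use M(1) M1 order_trans[OF M(2)] C1_lipschitz_convex[OF f K(2) subset_UNIV M(3)] in auto)
  qed
  note bd = this
  obtain M1 where M1: "0 < M1" "\<forall>x\<in>B. norm (apply_W1inf \<theta>1 x) \<le> M1"
    "\<forall>x\<in>B. \<forall>y\<in>B. norm (apply_W1inf \<theta>1 x - apply_W1inf \<theta>1 y) \<le> M1 * norm (x - y)" using bd[OF c(1)] by blast
  obtain M2 where M2: "0 < M2" "\<forall>x\<in>B. norm (apply_W1inf \<theta>2 x) \<le> M2"
    "\<forall>x\<in>B. \<forall>y\<in>B. norm (apply_W1inf \<theta>2 x - apply_W1inf \<theta>2 y) \<le> M2 * norm (x - y)" using bd[OF c(2)] by blast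
  obtain M3 where M3: "0 < M3" "\<forall>x\<in>B. norm (apply_W1inf \<zeta>1 x) \<le> M3"
    "\<forall>x\<in>B. \<forall>y\<in>B. norm (apply_W1inf \<zeta>1 x - apply_W1inf \<zeta>1 y) \<le> M3 * norm (x - y)" using bd[OF c(3)] by blast
  obtain M4 where M4: "0 < M4" "\<forall>x\<in>B. norm (apply_W1inf \<zeta>2 x) \<le> M4"
    "\<forall>x\<in>B. \<forall>y\<in>B. norm (apply_W1inf \<zeta>2 x - apply_W1inf \<zeta>2 y) \<le> M4 * norm (x - y)" using bd[OF c(4)] by blast
  define M where "M = M1 + M2 + M3 + M4"
  have M0: "0 < M" "M1 \<le> M" "M2 \<le> M" "M3 \<le> M" "M4 \<le> M"
    using M1(1) M2(1) M3(1) M4(1) by (auto simp: M_def)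
  \<comment> \<open>Below 1/(8 M) each summand has Lipschitz constant at most 1/8, which adds up to
    the 1/4 of \<open>perturbation_image_subset\<close>.\<close>
  have comb: "(\<forall>x\<in>B. norm (t *\<^sub>R f x + s *\<^sub>R g x) \<le> 1) \<and>
      (\<forall>x\<in>B. \<forall>y\<in>B. norm ((t *\<^sub>R f x + s *\<^sub>R g x) - (t *\<^sub>R f y + s *\<^sub>R g y)) \<le> 1/4 * norm (x - y))"
    if st: "\<bar>s\<bar> < 1 / (8 * M)" "\<bar>t\<bar> < 1 / (8 * M)" and N: "N1 \<le> M" "N2 \<le> M" and
      f: "\<forall>x\<in>B. norm (f x) \<le> N1" "\<forall>x\<in>B. \<forall>y\<in>B. norm (f x - f y) \<le> N1 * norm (x - y)" and
      g: "\<forall>x\<in>B. norm (g x) \<le> N2" "\<forall>x\<in>B. \<forall>y\<in>B. norm (g x - g y) \<le> N2 * norm (x - y)"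
    for s t N1 N2 and f g :: "'a \<Rightarrow> 'a"
  proof -
    have sM: "\<bar>s\<bar> * M \<le> 1/8" "\<bar>t\<bar> * M \<le> 1/8" using st M0(1) by (auto simp: pos_less_divide_eq)
    have key: "norm (t *\<^sub>R u + s *\<^sub>R v) \<le> 1/4 * r" if "norm u \<le> M * r" "norm v \<le> M * r" "0 \<le> r" for u v :: 'a and r
    proof -
      have "norm (t *\<^sub>R u + s *\<^sub>R v) \<le> \<bar>t\<bar> * norm u + \<bar>s\<bar> * norm v"
        using norm_triangle_ineq[of "t *\<^sub>R u" "s *\<^sub>R v"] by simp
      also have "\<dots> \<le> \<bar>t\<bar> * (M * r) + \<bar>s\<bar> * (M * r)" using that by (intro add_mono mult_left_mono) auto
      also have "\<dots> = (\<bar>t\<bar> * M) * r + (\<bar>s\<bar> * M) * r" by simp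
      also have "\<dots> \<le> 1/8 * r + 1/8 * r" using sM that(3) by (intro add_mono mult_right_mono) auto
      finally show ?thesis by simp
    qed
    have "norm (t *\<^sub>R f x + s *\<^sub>R g x) \<le> 1" if "x \<in> B" for x
    proof -
      have "norm (f x) \<le> M * 1" "norm (g x) \<le> M * 1" using bspec[OF f(1) that] bspec[OF g(1) that] N by auto
      then have "norm (t *\<^sub>R f x + s *\<^sub>R g x) \<le> 1/4 * 1" by (rule key) simp
      then show ?thesis by simp
    qed
    moreover have "norm ((t *\<^sub>R f x + s *\<^sub>R g x) - (t *\<^sub>R f y + s *\<^sub>R g y)) \<le> 1/4 * norm (x - y)" if xy: "x \<in> B" "y \<in> B" for x y
    proof -
      have "N1 * norm (x - y) \<le> M * norm (x - y)" "N2 * norm (x - y) \<le> M * norm (x - y)"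
        using N by (auto intro!: mult_right_mono)
      then have "norm (t *\<^sub>R (f x - f y) + s *\<^sub>R (g x - g y)) \<le> 1/4 * norm (x - y)"
        using f(2)[rule_format, OF xy] g(2)[rule_format, OF xy] by (intro key) auto
      then show ?thesis by (simp add: algebra_simps)
    qed
    ultimately show ?thesis by blast
  qed
  show ?thesis
  proof (intro exI[of _ "1 / (8 * M)"] conjI allI impI)
    show "0 < 1 / (8 * M)" using M0(1) by simp
    fix s t assume st: "\<bar>s\<bar> < 1 / (8 * M)" "\<bar>t\<bar> < 1 / (8 * M)"
    define f1 where "f1 x = t *\<^sub>R apply_W1inf \<theta>1 x + s *\<^sub>R apply_W1inf \<zeta>1 x" for x
    define f2 where "f2 x = t *\<^sub>R apply_W1inf \<theta>2 x + s *\<^sub>R apply_W1inf \<zeta>2 x" for x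
    note 1 = comb[OF st M0(2,4) M1(2,3) M3(2,3), folded f1_def]
      and 2 = comb[OF st M0(3,5) M2(2,3) M4(2,3), folded f2_def]
    have e: "f1 p = f2 p" if "p \<in> frontier \<Omega>" for p using eq that by (simp add: f1_def f2_def)
    have "(\<lambda>x. x + f1 x) ` \<Omega> = (\<lambda>x. x + f2 x) ` \<Omega>"
    proof
      show "(\<lambda>x. x + f1 x) ` \<Omega> \<subseteq> (\<lambda>x. x + f2 x) ` \<Omega>"
        by (rule perturbation_image_subset[OF R B_def]) (use 1 2 e in auto)
      show "(\<lambda>x. x + f2 x) ` \<Omega> \<subseteq> (\<lambda>x. x + f1 x) ` \<Omega>"
        by (rule perturbation_image_subset[OF R B_def]) (use 1 2 e in auto)
    qed
    then show "shape_functional J \<Omega> (t *\<^sub>R \<theta>1 + s *\<^sub>R \<zeta>1) = shape_functional J \<Omega> (t *\<^sub>R \<theta>2 + s *\<^sub>R \<zeta>2)"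
      unfolding shape_functional_def plus_W1inf.rep_eq scaleR_W1inf.rep_eq f1_def f2_def by simp
  qed
qed

lemma shape_derivative_trace:
  fixes \<Omega> :: "'a::euclidean_space set"
  assumes "bounded \<Omega>" "shape_functional J \<Omega> differentiable (at 0)" "C1W \<theta>1" "C1W \<theta>2"
    and "\<And>x. x \<in> frontier \<Omega> \<Longrightarrow> apply_W1inf \<theta>1 x = apply_W1inf \<theta>2 x"
  shows "Df (shape_functional J \<Omega>) 0 \<theta>1 = Df (shape_functional J \<Omega>) 0 \<theta>2"
proof -
  obtain \<delta> where \<delta>: "0 < \<delta>" "\<And>s t. \<bar>s\<bar> < \<delta> \<Longrightarrow> \<bar>t\<bar> < \<delta> \<Longrightarrow>
      shape_functional J \<Omega> (t *\<^sub>R \<theta>1 + s *\<^sub>R \<theta>1) = shape_functional J \<Omega> (t *\<^sub>R \<theta>2 + s *\<^sub>R \<theta>2)"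
    using shape_functional_trace[OF assms(1,3,4,3,4,5,5), of J] by blast
  show ?thesis
    by (rule frechet_derivative_local_eq[OF assms(2) \<delta>(1)]) (use \<delta>(2)[of _ 0] \<delta>(1) in simp)
qed

lemma shape_second_derivative_trace:
  fixes \<Omega> :: "'a::euclidean_space set"
  assumes "bounded \<Omega>" "twice_differentiable_at (shape_functional J \<Omega>) 0" "C1W \<theta>1" "C1W \<theta>2" "C1W \<zeta>1" "C1W \<zeta>2"
    and "\<And>x. x \<in> frontier \<Omega> \<Longrightarrow> apply_W1inf \<theta>1 x = apply_W1inf \<theta>2 x"
    and "\<And>x. x \<in> frontier \<Omega> \<Longrightarrow> apply_W1inf \<zeta>1 x = apply_W1inf \<zeta>2 x"
  shows "D2f (shape_functional J \<Omega>) 0 \<theta>1 \<zeta>1 = D2f (shape_functional J \<Omega>) 0 \<theta>2 \<zeta>2"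
proof -
  obtain \<delta> where \<delta>: "0 < \<delta>" "\<And>s t. \<bar>s\<bar> < \<delta> \<Longrightarrow> \<bar>t\<bar> < \<delta> \<Longrightarrow>
      shape_functional J \<Omega> (t *\<^sub>R \<theta>1 + s *\<^sub>R \<zeta>1) = shape_functional J \<Omega> (t *\<^sub>R \<theta>2 + s *\<^sub>R \<zeta>2)"
    using shape_functional_trace[OF assms(1,3-8), of J] by blast
  then show ?thesis using second_frechet_derivative_local_eq[OF assms(2)] by blast
qed

section \<open>Differentiable paths in W^{1,infinity}\<close>

text \<open>Tailored to differentiability in the W^{1,infinity} norm: space derivatives are
  differentiable in \<open>t\<close> too, time and space derivatives commute, and everything is
  jointly continuous, so that compactness gives uniformity in \<open>x\<close>.\<close>

definition C1_path ::
    "(real \<Rightarrow> 'a::euclidean_space \<Rightarrow> 'b::euclidean_space) \<Rightarrow> (real \<Rightarrow> 'a \<Rightarrow> 'b) \<Rightarrow> bool"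
  where "C1_path F F' \<longleftrightarrow>
    (\<forall>t x. ((\<lambda>t. F t x) has_vector_derivative F' t x) (at t)) \<and>
    (\<forall>t x. F t differentiable (at x)) \<and> (\<forall>t x. F' t differentiable (at x)) \<and>
    (\<forall>t x b. ((\<lambda>t. Df (F t) x b) has_vector_derivative
      Df (F' t) x b) (at t)) \<and>
    continuous_on UNIV (\<lambda>p. F (fst p) (snd p)) \<and> continuous_on UNIV (\<lambda>p. F' (fst p) (snd p)) \<and>
    (\<forall>b. continuous_on UNIV (\<lambda>p. Df (F (fst p)) (snd p) b)) \<and>
    (\<forall>b. continuous_on UNIV (\<lambda>p. Df (F' (fst p)) (snd p) b))"

lemma C1_pathD:
  assumes "C1_path F F'"
  shows "((\<lambda>t. F t x) has_vector_derivative F' t x) (at t)"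
    "(F t has_derivative Df (F t) x) (at x)"
    "(F' t has_derivative Df (F' t) x) (at x)"
    "((\<lambda>t. Df (F t) x b) has_vector_derivative Df (F' t) x b) (at t)"
    "continuous_on UNIV (\<lambda>p. F (fst p) (snd p))" "continuous_on UNIV (\<lambda>p. F' (fst p) (snd p))"
    "continuous_on UNIV (\<lambda>p. Df (F (fst p)) (snd p) b)"
    "continuous_on UNIV (\<lambda>p. Df (F' (fst p)) (snd p) b)"
  using assms unfolding C1_path_def by (simp_all add: frechet_derivative_works)

lemma C1_pathI:
  assumes "\<And>t x. ((\<lambda>t. F t x) has_vector_derivative F' t x) (at t)"
    "\<And>t x. (F t has_derivative G t x) (at x)" "\<And>t x. (F' t has_derivative G' t x) (at x)"
    "\<And>t x b. ((\<lambda>t. G t x b) has_vector_derivative G' t x b) (at t)"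
    "continuous_on UNIV (\<lambda>p. F (fst p) (snd p))" "continuous_on UNIV (\<lambda>p. F' (fst p) (snd p))"
    "\<And>b. continuous_on UNIV (\<lambda>p. G (fst p) (snd p) b)" "\<And>b. continuous_on UNIV (\<lambda>p. G' (fst p) (snd p) b)"
  shows "C1_path F F'"
proof -
  have "Df (F t) x = G t x" "Df (F' t) x = G' t x" for t x
    using frechet_derivative_eq[OF assms(2)] frechet_derivative_eq[OF assms(3)] by auto
  then show ?thesis using assms differentiableI by (simp add: C1_path_def) blast
qed

lemma continuous_slice:
  "continuous_on UNIV (\<lambda>p. f (fst p) (snd p)) \<Longrightarrow> continuous_on UNIV (f (t::'a::topological_space))"
  by (rule continuous_on_compose2[of UNIV "\<lambda>p. f (fst p) (snd p)" UNIV "\<lambda>x. (t, x)", simplified])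
    (auto intro!: continuous_intros)

lemma C1_path_C1:
  assumes "C1_path F F'" shows "Ck_on UNIV 1 (F t)" "Ck_on UNIV 1 (F' t)"
proof -
  have "Ck_on UNIV (Suc 0) (F t)"
    by (rule Ck_on_SucI[OF open_UNIV C1_pathD(2)[OF assms]])
      (simp add: continuous_slice[OF C1_pathD(7)[OF assms]])
  moreover have "Ck_on UNIV (Suc 0) (F' t)"
    by (rule Ck_on_SucI[OF open_UNIV C1_pathD(3)[OF assms]])
      (simp add: continuous_slice[OF C1_pathD(8)[OF assms]])
  ultimately show "Ck_on UNIV 1 (F t)" "Ck_on UNIV 1 (F' t)" by (simp_all del: Ck_on.simps)
qed

lemma C1_continuous_snd:
  assumes "Ck_on UNIV 1 f"
  shows "continuous_on UNIV (\<lambda>p::'c::topological_space \<times> _. f (snd p))"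
    "continuous_on UNIV (\<lambda>p::'c \<times> _. Df f (snd p) b)"
  by (rule continuous_on_compose2[OF C1D(4)[OF assms]] continuous_on_compose2[OF C1D(3)[OF assms]];
      auto intro!: continuous_intros)+

lemma C1_path_const: "Ck_on UNIV 1 f \<Longrightarrow> C1_path (\<lambda>t. f) (\<lambda>t x. 0)"
  by (rule C1_pathI[where G="\<lambda>t x. Df f x" and G'="\<lambda>t x b. 0"])
    (simp_all add: C1D(1)[OF _ UNIV_I] C1_continuous_snd del: One_nat_def)

lemma C1_path_linear: "Ck_on UNIV 1 f \<Longrightarrow> C1_path (\<lambda>t x. t *\<^sub>R f x) (\<lambda>t. f)"
  by (rule C1_pathI[where G="\<lambda>t x b. t *\<^sub>R Df f x b" and G'="\<lambda>t x. Df f x"])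
    (auto simp del: One_nat_def intro!: continuous_intros C1_continuous_snd has_derivative_scaleR_right C1D(1) derivative_eq_intros)

lemma C1_path_add:
  assumes "C1_path F F'" "C1_path H H'"
  shows "C1_path (\<lambda>t x. F t x + H t x) (\<lambda>t x. F' t x + H' t x)"
  by (rule C1_pathI[where G="\<lambda>t x b. Df (F t) x b + Df (H t) x b"
        and G'="\<lambda>t x b. Df (F' t) x b + Df (H' t) x b"])
    (rule has_vector_derivative_add has_derivative_add continuous_on_add C1_pathD[OF assms(1)] C1_pathD[OF assms(2)])+

lemma C1_path_scaleR_const:
  fixes F :: "real \<Rightarrow> 'a::euclidean_space \<Rightarrow> real" and c :: "'b::euclidean_space"
  assumes "C1_path F F'"
  shows "C1_path (\<lambda>t x. F t x *\<^sub>R c) (\<lambda>t x. F' t x *\<^sub>R c)"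
proof -
  have bl: "bounded_linear (\<lambda>r. r *\<^sub>R c)" by (rule bounded_linear_scaleR_left)
  show ?thesis
    by (rule C1_pathI[where G="\<lambda>t x b. Df (F t) x b *\<^sub>R c"
          and G'="\<lambda>t x b. Df (F' t) x b *\<^sub>R c"])
      (rule bounded_linear.has_vector_derivative[OF bl] bounded_linear.has_derivative[OF bl]
        bounded_linear.continuous_on[OF bl] C1_pathD[OF assms])+
qed

text \<open>The space derivative of \<open>g (F t x)\<close> contains Dg, and differentiating it in
  \<open>t\<close> produces D2g, hence C^2 for \<open>g\<close>. Symmetry of the second derivative
  identifies the two mixed derivatives.\<close>

lemma C1_path_compose:
  fixes F :: "real \<Rightarrow> 'a::euclidean_space \<Rightarrow> 'b::euclidean_space" and g :: "'b \<Rightarrow> 'c::euclidean_space"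
  assumes F: "C1_path F F'" and g: "Ck_on UNIV 2 g"
  shows "C1_path (\<lambda>t x. g (F t x)) (\<lambda>t x. Df g (F t x) (F' t x))"
proof -
  let ?D = "\<lambda>y v. Df g y v"
  let ?H = "\<lambda>y v w. Df (\<lambda>y. ?D y v) y w"
  note g1 = C2_derivative(2)[OF g] and g2 = C2_derivative(1)[OF g]
  have Dg: "(g has_derivative ?D y) (at y)" for y by (rule C1D(1)[OF g1 UNIV_I])
  have lD: "linear (?D y)" for y by (rule C1D(2)[OF g1 UNIV_I])
  have DD: "((\<lambda>y. ?D y v) has_derivative ?H y v) (at y)" for y v by (rule C1D(1)[OF g2 UNIV_I])
  have Hs: "?H y v w = ?H y w v" for y v w by (rule C2_symmetric[OF g])
  \<comment> \<open>Product rule for \<open>?D (p z) (q z)\<close>, where point and vector both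
    move.\<close>
  have Dprod: "((\<lambda>z. ?D (p z) (q z)) has_derivative (\<lambda>h. ?H (p z) (q z) (p' h) + ?D (p z) (q' h))) (at z)"
    if "(p has_derivative p') (at z)" "(q has_derivative q') (at z)"
    for p q :: "'z::real_normed_vector \<Rightarrow> 'b" and p' q' z
  proof -
    have e: "?D (p z) (q z) = (\<Sum>b\<in>Basis. (q z \<bullet> b) *\<^sub>R ?D (p z) b)" for z
      by (rule linear_basis_expansion[OF lD])
    have "((\<lambda>z. \<Sum>b\<in>Basis. (q z \<bullet> b) *\<^sub>R ?D (p z) b) has_derivative
        (\<lambda>h. \<Sum>b\<in>Basis. (q z \<bullet> b) *\<^sub>R ?H (p z) b (p' h) + (q' h \<bullet> b) *\<^sub>R ?D (p z) b)) (at z)"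
      by (intro has_derivative_sum bounded_bilinear.FDERIV[OF bounded_bilinear_scaleR]
          has_derivative_inner_left that(2) has_derivative_compose[OF that(1) DD])
    moreover have "(\<Sum>b\<in>Basis. (q z \<bullet> b) *\<^sub>R ?H (p z) b (p' h) + (q' h \<bullet> b) *\<^sub>R ?D (p z) b) =
        ?H (p z) (q z) (p' h) + ?D (p z) (q' h)" for h
    proof -
      \<comment> \<open>As a derivative \<open>?H\<close> is linear in its last argument; symmetry
        moves \<open>q z\<close> there and back.\<close>
      have "(\<Sum>b\<in>Basis. (q z \<bullet> b) *\<^sub>R ?H (p z) b (p' h)) = (\<Sum>b\<in>Basis. (q z \<bullet> b) *\<^sub>R ?H (p z) (p' h) b)"
        by (intro sum.cong refl arg_cong2[where f=scaleR] Hs)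
      also have "\<dots> = ?H (p z) (p' h) (q z)"
        by (rule linear_basis_expansion[OF C1D(2)[OF g2 UNIV_I], symmetric])
      also have "\<dots> = ?H (p z) (q z) (p' h)" by (rule Hs)
      finally show ?thesis by (simp add: sum.distrib linear_basis_expansion[OF lD, of "p z" "q' h"])
    qed
    ultimately show ?thesis by (simp add: e)
  qed
  have Dc: "continuous_on UNIV (\<lambda>p. ?D (P p) (Q p))" if "continuous_on UNIV P" "continuous_on UNIV Q"
    for P Q :: "real \<times> 'a \<Rightarrow> 'b"
    by (rule C1_blinfun_continuous[OF g1 that(1) subset_UNIV that(2)])
  have Hc: "continuous_on UNIV (\<lambda>p. ?H (P p) (Q p) (R p))"
    if "continuous_on UNIV P" "continuous_on UNIV Q" "continuous_on UNIV R" for P Q R :: "real \<times> 'a \<Rightarrow> 'b"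
  proof -
    have "?H (P p) (Q p) (R p) = (\<Sum>b\<in>Basis. (Q p \<bullet> b) *\<^sub>R ?H (P p) b (R p))" for p
    proof -
      have "?H (P p) (Q p) (R p) = ?H (P p) (R p) (Q p)" by (rule Hs)
      also have "\<dots> = (\<Sum>b\<in>Basis. (Q p \<bullet> b) *\<^sub>R ?H (P p) (R p) b)"
        by (rule linear_basis_expansion[OF C1D(2)[OF g2 UNIV_I]])
      also have "\<dots> = (\<Sum>b\<in>Basis. (Q p \<bullet> b) *\<^sub>R ?H (P p) b (R p))"
        by (intro sum.cong refl arg_cong2[where f=scaleR] Hs)
      finally show ?thesis .
    qed
    then show ?thesis
      by (simp only:) (intro continuous_intros that C1_blinfun_continuous[OF g2 that(1) subset_UNIV that(3)])
  qed
  let ?F1 = "\<lambda>t x b. Df (F t) x b" and ?F2 = "\<lambda>t x b. Df (F' t) x b"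
  note P = C1_pathD[OF F]
  show ?thesis
  proof (rule C1_pathI[where G="\<lambda>t x b. ?D (F t x) (?F1 t x b)"
        and G'="\<lambda>t x b. ?H (F t x) (F' t x) (?F1 t x b) + ?D (F t x) (?F2 t x b)"])
    fix t x b
    have tr: "(\<lambda>r::real. ?D (F t x) (r *\<^sub>R v)) = (\<lambda>r. r *\<^sub>R ?D (F t x) v)" for v
      by (simp add: linear_cmul[OF lD])
    show "((\<lambda>t. g (F t x)) has_vector_derivative ?D (F t x) (F' t x)) (at t)"
      using has_derivative_compose[OF P(1)[of x t, unfolded has_vector_derivative_def] Dg[of "F t x"]]
      unfolding has_vector_derivative_def tr .
    show "((\<lambda>x. g (F t x)) has_derivative (\<lambda>b. ?D (F t x) (?F1 t x b))) (at x)"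
      by (rule has_derivative_compose[OF P(2) Dg])
    show "((\<lambda>x. ?D (F t x) (F' t x)) has_derivative (\<lambda>b. ?H (F t x) (F' t x) (?F1 t x b) + ?D (F t x) (?F2 t x b))) (at x)"
      by (rule Dprod[OF P(2) P(3)])
    have "((\<lambda>t. ?D (F t x) (?F1 t x b)) has_derivative
       (\<lambda>r. ?H (F t x) (?F1 t x b) (r *\<^sub>R F' t x) + ?D (F t x) (r *\<^sub>R ?F2 t x b))) (at t)"
      by (rule Dprod[OF P(1)[unfolded has_vector_derivative_def] P(4)[unfolded has_vector_derivative_def]])
    then show "((\<lambda>t. ?D (F t x) (?F1 t x b)) has_vector_derivative
       ?H (F t x) (F' t x) (?F1 t x b) + ?D (F t x) (?F2 t x b)) (at t)"
      by (subst Hs) (simp add: has_vector_derivative_def linear_cmul[OF lD] linear_cmul[OF C1D(2)[OF g2 UNIV_I]] scaleR_add_right)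
  next
    show "continuous_on UNIV (\<lambda>p. g (F (fst p) (snd p)))"
      by (rule continuous_on_compose2[OF C1D(4)[OF g1] P(5)]) simp
  qed (intro continuous_on_add Dc Hc P)+
qed

text \<open>On [-1,1] x K the time derivative is uniformly continuous, so the mean value inequality
  bounds the remainder uniformly in \<open>x\<close>. Off \<open>K\<close> nothing moves and the
  derivative is 0.\<close>

lemma uniform_first_order:
  fixes f :: "real \<Rightarrow> 'a::euclidean_space \<Rightarrow> 'b::euclidean_space"
  assumes d: "\<And>t x. ((\<lambda>t. f t x) has_vector_derivative f' t x) (at t)"
    and c: "continuous_on UNIV (\<lambda>p. f' (fst p) (snd p))"
    and K: "compact K" "\<And>t x. x \<notin> K \<Longrightarrow> f t x = f 0 x" and e: "0 < \<epsilon>"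
  shows "\<exists>\<delta>>0. \<forall>t x. \<bar>t\<bar> < \<delta> \<longrightarrow> norm (f t x - f 0 x - t *\<^sub>R f' 0 x) \<le> \<epsilon> * \<bar>t\<bar>"
proof -
  have "uniformly_continuous_on ({-1..1} \<times> K) (\<lambda>p. f' (fst p) (snd p))"
    by (rule compact_uniformly_continuous[OF continuous_on_subset[OF c subset_UNIV] compact_Times[OF compact_Icc K(1)]])
  then obtain d1 where d1: "0 < d1" "\<And>p q. p \<in> {-1..1} \<times> K \<Longrightarrow> q \<in> {-1..1} \<times> K \<Longrightarrow> dist q p < d1 \<Longrightarrow>
      dist (f' (fst q) (snd q)) (f' (fst p) (snd p)) < \<epsilon>"
    using e unfolding uniformly_continuous_on_def by blast
  show ?thesis
  proof (intro exI[of _ "min 1 d1"] conjI allI impI)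
    show "0 < min 1 d1" using d1(1) by simp
    fix t x assume t: "\<bar>t\<bar> < min 1 d1"
    show "norm (f t x - f 0 x - t *\<^sub>R f' 0 x) \<le> \<epsilon> * \<bar>t\<bar>"
    proof (cases "x \<in> K")
      case True
      have "norm ((f t x - t *\<^sub>R f' 0 x) - (f 0 x - 0 *\<^sub>R f' 0 x)) \<le> \<epsilon> * norm (t - 0)"
      proof (rule differentiable_bound[of "{-\<bar>t\<bar>..\<bar>t\<bar>}" _ "\<lambda>s r. r *\<^sub>R f' s x - r *\<^sub>R f' 0 x"])
        fix s assume s: "s \<in> {-\<bar>t\<bar>..\<bar>t\<bar>}"
        show "((\<lambda>s. f s x - s *\<^sub>R f' 0 x) has_derivative (\<lambda>r. r *\<^sub>R f' s x - r *\<^sub>R f' 0 x)) (at s within {-\<bar>t\<bar>..\<bar>t\<bar>})"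
          by (intro has_derivative_diff has_derivative_at_withinI[OF d[unfolded has_vector_derivative_def]]
              has_derivative_scaleR_left has_derivative_ident)
        have "norm (f' s x - f' 0 x) < \<epsilon>"
          using d1(2)[of "(0, x)" "(s, x)"] True s t by (auto simp: dist_norm)
        then show "onorm (\<lambda>r. r *\<^sub>R f' s x - r *\<^sub>R f' 0 x) \<le> \<epsilon>"
          by (intro onorm_le)
            (simp add: scaleR_diff_right[symmetric] mult.commute[of \<epsilon>] mult_left_mono)
      qed auto
      then show ?thesis by (simp add: algebra_simps)
    next
      case False
      have "((\<lambda>t. f 0 x) has_vector_derivative f' 0 x) (at 0)"
        using d[of x 0] by (subst (asm) K(2)[OF False])
      then have "f' 0 x = 0" using vector_derivative_unique_at has_vector_derivative_const by blast
      then show ?thesis using K(2)[OF False, of t] e by simp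
    qed
  qed
qed

text \<open>\<open>uniform_first_order\<close> is applied to \<open>F\<close> and to its partial
  derivatives along the finitely many basis vectors; together they bound the remainder in
  \<open>C1_bdd\<close>, hence in norm. The bound linear in \<open>t\<close> later provides
  contractions.\<close>

lemma C1_path_W1inf:
  fixes F :: "real \<Rightarrow> 'a::euclidean_space \<Rightarrow> 'b::euclidean_space"
  assumes F: "C1_path F F'" and K: "compact K" "\<And>t x. x \<notin> K \<Longrightarrow> F t x = F 0 x"
  shows "\<exists>B. C1_bdd (F' 0) B"
    and "\<exists>B. C1_bdd (\<lambda>x. F t x - F 0 x) B"
    and "\<exists>\<delta>>0. \<exists>C>0. \<forall>t. \<bar>t\<bar> < \<delta> \<longrightarrow> C1_bdd (\<lambda>x. F t x - F 0 x) (C * \<bar>t\<bar>)"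
    and "((\<lambda>t. W1inf (\<lambda>x. F t x - F 0 x)) has_vector_derivative W1inf (F' 0)) (at 0)"
proof -
  note P = C1_pathD[OF F]
  have F'0: "F' 0 x = 0" if "x \<notin> K" for x
  proof -
    have "((\<lambda>t. F 0 x) has_vector_derivative F' 0 x) (at 0)"
      using P(1)[of x 0] by (subst (asm) K(2)[OF that])
    then show ?thesis using vector_derivative_unique_at has_vector_derivative_const by blast
  qed
  have cd: "Ck_on UNIV 1 (\<lambda>x. F t x - F 0 x)" for t
    by (intro Ck_on_diff open_UNIV C1_path_C1[OF F])
  show bF': "\<exists>B. C1_bdd (F' 0) B"
    by (rule C1_bdd_compact_support[OF C1_path_C1(2)[OF F, of 0] K(1) F'0]) blast+
  show bF: "\<exists>B. C1_bdd (\<lambda>x. F t x - F 0 x) B" for t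
    by (rule C1_bdd_compact_support[OF cd[of t] K(1)]) (simp, rule K(2), blast+)
  have fe: "Df (F t) x b = Df (F 0) x b" if "x \<notin> K" for t x b
    using frechet_derivative_cong_open(2)[of "- K" x "F 0" "F t"] that K(2)[of _ t] compact_imp_closed[OF K(1)]
      differentiableI[OF P(2)[of 0 x]]
    by (auto simp: open_Compl)
  have fd: "Df (\<lambda>x. F t x - F 0 x) x b = Df (F t) x b - Df (F 0) x b" for t x b
    using frechet_derivative_eq[OF has_derivative_diff[OF P(2) P(2)]] by simp
  have fr: "Df (\<lambda>x. F t x - F 0 x - t *\<^sub>R F' 0 x) x b =
     Df (F t) x b - Df (F 0) x b - t *\<^sub>R Df (F' 0) x b" for t x b
    using frechet_derivative_eq[OF has_derivative_diff[OF has_derivative_diff[OF P(2) P(2)] has_derivative_scaleR_right[OF P(3)]]] by simp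
  have R: "\<exists>\<delta>>0. \<forall>t. \<bar>t\<bar> < \<delta> \<longrightarrow> C1_bdd (\<lambda>x. F t x - F 0 x - t *\<^sub>R F' 0 x) (\<epsilon> * \<bar>t\<bar>)" if e: "0 < \<epsilon>" for \<epsilon>
  proof -
    obtain d0 where d0: "0 < d0" "\<And>t x. \<bar>t\<bar> < d0 \<Longrightarrow> norm (F t x - F 0 x - t *\<^sub>R F' 0 x) \<le> \<epsilon> * \<bar>t\<bar>"
      using uniform_first_order[OF P(1) P(6) K(1) K(2) e] by blast
    have "\<forall>b. \<exists>d>0. \<forall>t x. \<bar>t\<bar> < d \<longrightarrow> norm (Df (F t) x b - Df (F 0) x b - t *\<^sub>R Df (F' 0) x b) \<le> \<epsilon> * \<bar>t\<bar>"
      by (intro allI uniform_first_order[OF P(4) P(8) K(1) fe e])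
    then obtain d where d: "\<And>b. 0 < d b" "\<And>b t x. \<bar>t\<bar> < d b \<Longrightarrow> norm (Df (F t) x b - Df (F 0) x b - t *\<^sub>R Df (F' 0) x b) \<le> \<epsilon> * \<bar>t\<bar>"
      by metis
    define m where "m = Min (insert d0 (d ` Basis))"
    have m: "0 < m" "m \<le> d0" "\<And>b. b \<in> Basis \<Longrightarrow> m \<le> d b"
      unfolding m_def using d0(1) d(1) by (auto intro: min.coboundedI2 Min_le)
    show ?thesis
    proof (intro exI[of _ m] conjI allI impI m(1))
      fix t assume t: "\<bar>t\<bar> < m"
      show "C1_bdd (\<lambda>x. F t x - F 0 x - t *\<^sub>R F' 0 x) (\<epsilon> * \<bar>t\<bar>)"
        unfolding C1_bdd_def fr
      proof (intro conjI allI ballI)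
        show "Ck_on UNIV 1 (\<lambda>x. F t x - F 0 x - t *\<^sub>R F' 0 x)"
          by (intro Ck_on_diff Ck_on_scaleR open_UNIV Ck_on_const C1_path_C1[OF F])
        show "norm (F t x - F 0 x - t *\<^sub>R F' 0 x) \<le> \<epsilon> * \<bar>t\<bar>" for x
          using d0(2)[of t x] t m(2) by simp
        show "norm (Df (F t) x b - Df (F 0) x b - t *\<^sub>R Df (F' 0) x b) \<le> \<epsilon> * \<bar>t\<bar>"
          if "b \<in> Basis" for x b using d(2)[of t b x] t m(3)[OF that] by simp
      qed
    qed
  qed
  obtain B where B: "C1_bdd (F' 0) B" using bF' by blast
  have B0: "0 \<le> B" using B unfolding C1_bdd_def using norm_ge_zero order_trans by blast
  show "\<exists>\<delta>>0. \<exists>C>0. \<forall>t. \<bar>t\<bar> < \<delta> \<longrightarrow> C1_bdd (\<lambda>x. F t x - F 0 x) (C * \<bar>t\<bar>)"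
  proof -
    obtain \<delta> where \<delta>: "0 < \<delta>" "\<And>t. \<bar>t\<bar> < \<delta> \<Longrightarrow> C1_bdd (\<lambda>x. F t x - F 0 x - t *\<^sub>R F' 0 x) (1 * \<bar>t\<bar>)"
      using R[OF zero_less_one] by blast
    have "C1_bdd (\<lambda>x. F t x - F 0 x) ((B + 1) * \<bar>t\<bar>)" if t: "\<bar>t\<bar> < \<delta>" for t
      unfolding C1_bdd_def fd
    proof (intro conjI allI ballI cd)
      have tri: "norm u \<le> (B + 1) * \<bar>t\<bar>" if "norm (u - t *\<^sub>R v) \<le> \<bar>t\<bar>" "norm v \<le> B" for u v :: 'b
      proof -
        have "norm u \<le> norm (u - t *\<^sub>R v) + norm (t *\<^sub>R v)" by (metis diff_add_cancel norm_triangle_ineq)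
        also have "\<dots> \<le> \<bar>t\<bar> + \<bar>t\<bar> * B" using that by (intro add_mono) (auto intro: mult_left_mono)
        finally show ?thesis by (simp add: algebra_simps)
      qed
      fix x
      show "norm (F t x - F 0 x) \<le> (B + 1) * \<bar>t\<bar>"
        using \<delta>(2)[OF t] B unfolding C1_bdd_def by (intro tri[of _ "F' 0 x"]) auto
      fix b :: 'a assume "b \<in> Basis"
      then show "norm (Df (F t) x b - Df (F 0) x b) \<le> (B + 1) * \<bar>t\<bar>"
        using \<delta>(2)[OF t] B unfolding C1_bdd_def fr by (intro tri[of _ "Df (F' 0) x b"]) auto
    qed
    moreover have "0 < B + 1" using B0 by simp
    ultimately show ?thesis using \<delta>(1) by blast
  qed
  show "((\<lambda>t. W1inf (\<lambda>x. F t x - F 0 x)) has_vector_derivative W1inf (F' 0)) (at 0)"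
    unfolding has_vector_derivative_def has_derivative_at_alt
  proof (intro conjI allI impI bounded_linear_scaleR_left)
    fix e :: real assume e: "0 < e"
    \<comment> \<open>Compensates the dimensional factor of \<open>C1_bdd_W1inf\<close>.\<close>
    define \<epsilon> where "\<epsilon> = e / (real DIM('a) + 1)"
    have \<epsilon>: "0 < \<epsilon>" using e by (simp add: \<epsilon>_def)
    obtain \<delta> where \<delta>: "0 < \<delta>" "\<And>t. \<bar>t\<bar> < \<delta> \<Longrightarrow> C1_bdd (\<lambda>x. F t x - F 0 x - t *\<^sub>R F' 0 x) (\<epsilon> * \<bar>t\<bar>)"
      using R[OF \<epsilon>] by blast
    show "\<exists>d>0. \<forall>y. norm (y - 0) < d \<longrightarrow> norm (W1inf (\<lambda>x. F y x - F 0 x) - W1inf (\<lambda>x. F 0 x - F 0 x) - (y - 0) *\<^sub>R W1inf (F' 0)) \<le> e * norm (y - 0)"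
    proof (intro exI[of _ \<delta>] conjI allI impI \<delta>(1))
      fix t :: real assume "norm (t - 0) < \<delta>"
      then have b: "C1_bdd (\<lambda>x. F t x - F 0 x - t *\<^sub>R F' 0 x) (\<epsilon> * \<bar>t\<bar>)" using \<delta>(2) by simp
      have ap: "apply_W1inf (W1inf (\<lambda>x. F t x - F 0 x)) = (\<lambda>x. F t x - F 0 x)" for t
        using bF[of t] C1_bdd_W1inf(1) by blast
      have "W1inf (\<lambda>x. F t x - F 0 x) - W1inf (\<lambda>x. F 0 x - F 0 x) - (t - 0) *\<^sub>R W1inf (F' 0) =
          W1inf (\<lambda>x. F t x - F 0 x - t *\<^sub>R F' 0 x)"
        by (rule W1inf_eqI) (simp add: minus_W1inf.rep_eq scaleR_W1inf.rep_eq C1_bdd_W1inf(1)[OF b] C1_bdd_W1inf(1)[OF B] ap ap[of 0, simplified])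
      moreover have "norm (W1inf (\<lambda>x. F t x - F 0 x - t *\<^sub>R F' 0 x)) \<le> (real DIM('a) + 1) * (\<epsilon> * \<bar>t\<bar>)"
        by (rule C1_bdd_W1inf(2)[OF b])
      moreover have "(real DIM('a) + 1) * (\<epsilon> * \<bar>t\<bar>) = e * \<bar>t\<bar>" by (simp add: \<epsilon>_def)
      ultimately show "norm (W1inf (\<lambda>x. F t x - F 0 x) - W1inf (\<lambda>x. F 0 x - F 0 x) - (t - 0) *\<^sub>R W1inf (F' 0)) \<le> e * norm (t - 0)"
        by simp
    qed
  qed
qed

section \<open>Domain-preserving paths of diffeomorphisms\<close>

lemma invariant_path_derivative:
  fixes \<Omega> :: "'a::euclidean_space set"
  assumes J: "shape_functional J \<Omega> differentiable (at 0)"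
    and F: "C1_path \<phi> \<phi>'" and K: "compact K" "\<And>t x. x \<notin> K \<Longrightarrow> \<phi> t x = x" and id: "\<And>x. \<phi> 0 x = x"
    and inv: "0 < \<delta>" "\<And>t. \<bar>t\<bar> < \<delta> \<Longrightarrow> \<phi> t ` \<Omega> = \<Omega>"
  shows "Df (shape_functional J \<Omega>) 0 (W1inf (\<phi>' 0)) = 0"
proof -
  let ?J = "shape_functional J \<Omega>"
  have K0: "\<phi> t x = \<phi> 0 x" if "x \<notin> K" for t x using K(2)[OF that] id by simp
  define P where "P t = W1inf (\<lambda>x. \<phi> t x - \<phi> 0 x)" for t
  have P: "(P has_vector_derivative W1inf (\<phi>' 0)) (at 0)"
    unfolding P_def by (rule C1_path_W1inf(4)[OF F K(1) K0])
  have ap: "apply_W1inf (P t) = (\<lambda>x. \<phi> t x - x)" for t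
    using C1_path_W1inf(2)[OF F K(1) K0, of t] C1_bdd_W1inf(1) by (auto simp: P_def id)
  have P0: "P 0 = 0" by (rule W1inf_eqI) (simp add: ap id zero_W1inf.rep_eq)
  have JP: "?J (P t) = J (\<phi> t ` \<Omega>)" for t by (simp add: shape_functional_def ap)
  have d: "(?J has_derivative Df ?J 0) (at (P 0))"
    using J by (simp add: P0 frechet_derivative_works)
  have "((\<lambda>t. ?J (P t)) has_derivative (\<lambda>r. Df ?J 0 (r *\<^sub>R W1inf (\<phi>' 0)))) (at 0)"
    by (rule has_derivative_compose[OF P[unfolded has_vector_derivative_def] d])
  then have "((\<lambda>t. ?J (P t)) has_vector_derivative Df ?J 0 (W1inf (\<phi>' 0))) (at 0)"
    by (simp only: has_vector_derivative_def linear_cmul[OF has_derivative_linear[OF d]])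
  then show ?thesis
    by (rule vector_derivative_unique_local[OF _ has_vector_derivative_const[of "J \<Omega>"] inv(1)])
      (simp add: JP inv(2))
qed

lemma invariant_path_second_derivative:
  fixes \<Omega> :: "'a::euclidean_space set"
  assumes J: "twice_differentiable_at (shape_functional J \<Omega>) 0"
    and F: "C1_path \<phi> \<phi>'" and K: "compact K" "\<And>t x. x \<notin> K \<Longrightarrow> \<phi> t x = x" and id: "\<And>x. \<phi> 0 x = x"
    and inv: "0 < \<delta>" "\<And>t. \<bar>t\<bar> < \<delta> \<Longrightarrow> \<phi> t ` \<Omega> = \<Omega>"
    and z: "Ck_on UNIV 2 \<zeta>" "compact L" "\<And>x. x \<notin> L \<Longrightarrow> \<zeta> x = 0"
  shows "D2f (shape_functional J \<Omega>) 0 (W1inf (\<phi>' 0)) (W1inf \<zeta>) =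
    - Df (shape_functional J \<Omega>) 0 (W1inf (\<lambda>x. Df \<zeta> x (\<phi>' 0 x)))"
proof -
  let ?J = "shape_functional J \<Omega>" and ?V = "W1inf (\<phi>' 0)"
  have K0: "\<phi> t x = \<phi> 0 x" if "x \<notin> K" for t x using K(2)[OF that] id by simp
  define P where "P t = W1inf (\<lambda>x. \<phi> t x - \<phi> 0 x)" for t
  have P: "(P has_vector_derivative ?V) (at 0)"
    unfolding P_def by (rule C1_path_W1inf(4)[OF F K(1) K0])
  have ap: "apply_W1inf (P t) = (\<lambda>x. \<phi> t x - x)" for t
    using C1_path_W1inf(2)[OF F K(1) K0, of t] C1_bdd_W1inf(1) by (auto simp: P_def id)
  have P0: "P 0 = 0" by (rule W1inf_eqI) (simp add: ap id zero_W1inf.rep_eq)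
  note G = C1_path_compose[OF F z(1)]
  have G0: "\<zeta> (\<phi> t x) = \<zeta> (\<phi> 0 x)" if "x \<notin> K" for t x using K(2)[OF that] id by simp
  obtain B where zB: "C1_bdd \<zeta> B"
    using C1_bdd_compact_support[OF C2_derivative(2)[OF z(1)] z(2,3)] by blast
  define Q where "Q t = W1inf \<zeta> + W1inf (\<lambda>x. \<zeta> (\<phi> t x) - \<zeta> (\<phi> 0 x))" for t
  let ?W = "W1inf (\<lambda>x. Df \<zeta> x (\<phi>' 0 x))"
  have Q: "(Q has_vector_derivative ?W) (at 0)"
    using has_vector_derivative_add[OF has_vector_derivative_const C1_path_W1inf(4)[OF G K(1) G0], of "W1inf \<zeta>"]
    by (simp add: Q_def[abs_def] id)
  have aq: "apply_W1inf (Q t) = (\<lambda>x. \<zeta> (\<phi> t x))" for t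
  proof -
    obtain B' where "C1_bdd (\<lambda>x. \<zeta> (\<phi> t x) - \<zeta> (\<phi> 0 x)) B'" using C1_path_W1inf(2)[OF G K(1) G0] by blast
    then show ?thesis by (simp add: Q_def plus_W1inf.rep_eq C1_bdd_W1inf(1)[OF zB] C1_bdd_W1inf(1) id)
  qed
  have Q0: "Q 0 = W1inf \<zeta>" by (rule W1inf_eqI) (simp add: aq id C1_bdd_W1inf(1)[OF zB])
  obtain e where e: "0 < e" "\<And>y. dist y 0 < e \<Longrightarrow> ?J differentiable (at y)"
    using twice_differentiableD(4)[OF J] by blast
  have "isCont P 0" using P by (rule has_vector_derivative_continuous)
  then obtain d1 where d1: "0 < d1" "\<And>t. norm (t - 0) < d1 \<Longrightarrow> norm (P t - P 0) < e"
    unfolding LIM_eq isCont_def using e(1) by (metis norm_zero right_minus_eq zero_less_norm_iff)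
  \<comment> \<open>(Id + s \<zeta>) \<circ> \<phi>_t is Id + \<open>P t\<close> + s
    \<open>Q t\<close>, and \<phi>_t maps \<Omega> onto itself.\<close>
  have comp: "?J (s *\<^sub>R Q 0) = ?J (P t + s *\<^sub>R Q t)" if t: "\<bar>t\<bar> < \<delta>" for s t
  proof -
    have "(\<lambda>x. x + s *\<^sub>R \<zeta> x) ` \<Omega> = (\<lambda>x. x + s *\<^sub>R \<zeta> x) ` (\<phi> t ` \<Omega>)" by (simp add: inv(2)[OF t])
    also have "\<dots> = (\<lambda>x. x + (\<phi> t x - x + s *\<^sub>R \<zeta> (\<phi> t x))) ` \<Omega>" by (simp add: image_image)
    finally show ?thesis
      by (simp add: shape_functional_def plus_W1inf.rep_eq scaleR_W1inf.rep_eq ap aq id)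
  qed
  \<comment> \<open>The derivative of \<open>comp\<close> in \<open>s\<close> at 0. The left side is
    a bilinear pairing of two differentiable paths, so the product rule will yield both terms of the
    claim.\<close>
  have Hc: "blinfun_apply (frechet_blinfun ?J (P t)) (Q t) = blinfun_apply (frechet_blinfun ?J (P 0)) (Q 0)"
    if t: "\<bar>t\<bar> < min \<delta> d1" for t
  proof -
    have df: "?J differentiable (at (P t))" "?J differentiable (at (P 0))"
      using t d1 by (auto intro!: e(2) simp: P0 e(1))
    have "Df ?J (P t) (Q t) = Df ?J (P 0) (Q 0)"
    proof (rule vector_derivative_unique_local[OF directional_derivative[of ?J _ "P t" "Q t"] directional_derivative[of ?J _ "P 0" "Q 0"] zero_less_one])
      show "(?J has_derivative Df ?J (P t)) (at (P t))"
        "(?J has_derivative Df ?J (P 0)) (at (P 0))"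
        using df by (simp_all add: frechet_derivative_works)
      show "?J (P t + s *\<^sub>R Q t) = ?J (P 0 + s *\<^sub>R Q 0)" for s using comp[of t s] t by (simp add: P0)
    qed
    then show ?thesis by (simp add: frechet_blinfun_apply df)
  qed
  let ?F = "frechet_blinfun ?J" and ?D = "Df (frechet_blinfun ?J) 0"
  have dF: "(?F has_derivative ?D) (at (P 0))" using twice_differentiableD(2)[OF J] by (simp add: P0)
  have "((\<lambda>t. ?F (P t)) has_derivative (\<lambda>r. ?D (r *\<^sub>R ?V))) (at 0)"
    by (rule has_derivative_compose[OF P[unfolded has_vector_derivative_def] dF])
  then have "((\<lambda>t. blinfun_apply (?F (P t)) (Q t)) has_derivative
      (\<lambda>r. blinfun_apply (?F (P 0)) (r *\<^sub>R ?W) + blinfun_apply (?D (r *\<^sub>R ?V)) (Q 0))) (at 0)"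
    by (rule bounded_bilinear.FDERIV[OF bounded_bilinear_blinfun_apply _ Q[unfolded has_vector_derivative_def]])
  then have H: "((\<lambda>t. blinfun_apply (?F (P t)) (Q t)) has_vector_derivative
      (blinfun_apply (?F 0) ?W + blinfun_apply (?D ?V) (W1inf \<zeta>))) (at 0)"
    by (simp add: has_vector_derivative_def linear_cmul[OF has_derivative_linear[OF dF]] blinfun.scaleR_right blinfun.scaleR_left distrib_left P0 Q0)
  have "blinfun_apply (?F 0) ?W + blinfun_apply (?D ?V) (W1inf \<zeta>) = 0"
  proof (rule vector_derivative_unique_local[OF H has_vector_derivative_const])
    show "0 < min \<delta> d1" using inv(1) d1(1) by simp
  qed (rule Hc)
  then have "blinfun_apply (?D ?V) (W1inf \<zeta>) = - blinfun_apply (?F 0) ?W" by linarith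
  then show ?thesis
    by (simp only: second_frechet_derivative_def frechet_blinfun_apply[OF twice_differentiableD(1)[OF J]])
qed

abbreviation invariant_path where
  "invariant_path \<Omega> K \<phi> \<phi>' \<delta> \<equiv> C1_path \<phi> \<phi>' \<and> (\<forall>t x. x \<notin> K \<longrightarrow> \<phi> t x = x) \<and> (\<forall>x. \<phi> 0 x = x) \<and>
    0 < \<delta> \<and> (\<forall>t::real. \<bar>t\<bar> < \<delta> \<longrightarrow> \<phi> t ` \<Omega> = \<Omega>)"

text \<open>In a chart, a horizontal displacement \<open>t U\<close> is corrected vertically so that the height above
  the graph of \<open>\<gamma>\<close> does not change.\<close>

lemma chart_invariant_path:
  fixes \<Omega> :: "'a::euclidean_space set" and U :: "'a \<Rightarrow> 'a"
  assumes \<nu>: "norm \<nu> = 1" and \<gamma>: "Ck_on UNIV 2 \<gamma>" and r: "0 < \<rho>" "\<rho> < r"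
    and chart: "\<Omega> \<inter> ball x0 r = {y \<in> ball x0 r. y \<bullet> \<nu> > \<gamma> (y - (y \<bullet> \<nu>) *\<^sub>R \<nu>)}"
    and U: "Ck_on UNIV 1 U" "\<And>y. U y \<bullet> \<nu> = 0" "\<And>y. y \<notin> cball x0 \<rho> \<Longrightarrow> U y = 0"
  shows "\<exists>\<phi> \<phi>' \<delta>. invariant_path \<Omega> (cball x0 \<rho>) \<phi> \<phi>' \<delta> \<and>
    (\<forall>y. \<phi>' 0 y = U y + Df \<gamma> (y - (y \<bullet> \<nu>) *\<^sub>R \<nu>) (U y) *\<^sub>R \<nu>)"
proof -
  define p where "p y = y - (y \<bullet> \<nu>) *\<^sub>R \<nu>" for y
  have pb: "bounded_linear p" unfolding p_def
    by (intro bounded_linear_sub bounded_linear_ident bounded_linear_scaleR_const bounded_linear_inner_left)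
  have pC: "Ck_on UNIV 1 p" by (rule Ck_on_bounded_linear[OF open_UNIV pb])
  have \<nu>\<nu>: "\<nu> \<bullet> \<nu> = 1" using \<nu> by (simp add: norm_eq_1)
  define \<phi> where "\<phi> t y = (y + t *\<^sub>R U y) + (\<gamma> (p y + t *\<^sub>R U y) + (- \<gamma> (p y))) *\<^sub>R \<nu>" for t y
  \<comment> \<open>The zeros are the time derivatives of the constant summands, kept so that the
    path lemmas match term by term.\<close>
  define \<phi>' where "\<phi>' t y = (0 + U y) + (Df \<gamma> (p y + t *\<^sub>R U y) (0 + U y) + 0) *\<^sub>R \<nu>" for t y
  have path: "C1_path \<phi> \<phi>'"
    unfolding \<phi>_def[abs_def] \<phi>'_def[abs_def]
    by (intro C1_path_add C1_path_scaleR_const C1_path_const C1_path_linear C1_path_compose pC U(1) \<gamma> Ck_on_minus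
        Ck_on_compose[OF open_UNIV open_UNIV subset_UNIV pC] C2_derivative(2)[OF \<gamma>] open_UNIV
        Ck_on_bounded_linear[OF open_UNIV bounded_linear_ident])
  have off: "\<phi> t y = y" if "y \<notin> cball x0 \<rho>" for t y using U(3)[OF that] by (simp add: \<phi>_def)
  have id: "\<phi> 0 y = y" for y by (simp add: \<phi>_def)
  have K0: "\<phi> t y = \<phi> 0 y" if "y \<notin> cball x0 \<rho>" for t y using off[OF that] id by simp
  obtain \<delta> C where C: "0 < \<delta>" "0 < C" "\<And>t. \<bar>t\<bar> < \<delta> \<Longrightarrow> C1_bdd (\<lambda>x. \<phi> t x - \<phi> 0 x) (C * \<bar>t\<bar>)"
    using C1_path_W1inf(3)[OF path compact_cball K0] by blast
  define N where "N = real DIM('a)"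
  have N: "0 < N" by (simp add: N_def)
  \<comment> \<open>The second entry keeps images of points of \<open>cball x0 \<rho>\<close> inside
    the chart ball; the third makes \<phi>_t - Id Lipschitz with constant 1/2.\<close>
  define d where "d = min \<delta> (min ((r - \<rho>) / C) (1 / (2 * (N * C))))"
  have d: "0 < d" using C(1,2) r N by (simp add: d_def)
  have "\<phi> t ` \<Omega> = \<Omega>" if t: "\<bar>t\<bar> < d" for t
  proof -
    have b: "C1_bdd (\<lambda>x. \<phi> t x - x) (C * \<bar>t\<bar>)" using C(3)[of t] t by (simp add: d_def id)
    have t1: "C * \<bar>t\<bar> < r - \<rho>" using t C(2) by (simp add: d_def pos_less_divide_eq mult.commute)
    have t2: "N * (C * \<bar>t\<bar>) \<le> 1/2" using t C(2) N by (simp add: d_def pos_less_divide_eq field_simps)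
    have lip: "norm ((\<phi> t x - x) - (\<phi> t y - y)) \<le> 1/2 * norm (x - y)" for x y
    proof -
      have "norm ((\<phi> t x - x) - (\<phi> t y - y)) \<le> real DIM('a) * (C * \<bar>t\<bar>) * norm (x - y)"
        by (rule C1_lipschitz_convex[OF _ convex_UNIV subset_UNIV]) (use b in \<open>auto simp: C1_bdd_def\<close>)
      also have "\<dots> \<le> 1/2 * norm (x - y)" using t2 by (intro mult_right_mono) (auto simp: N_def)
      finally show ?thesis .
    qed
    \<comment> \<open>Solved by contraction; by \<open>iff\<close> below, the solution lies in
      \<Omega> exactly when \<open>z\<close> does.\<close>
    have surj: "\<exists>y. \<phi> t y = z" for z
    proof -
      have "\<exists>!y\<in>UNIV. z - (\<phi> t y - y) = y"
      proof (rule Banach_fix[of _ "1/2"])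
        show "dist (z - (\<phi> t x - x)) (z - (\<phi> t y - y)) \<le> 1/2 * dist x y" for x y
        proof -
          have "(z - (\<phi> t x - x)) - (z - (\<phi> t y - y)) = (\<phi> t y - y) - (\<phi> t x - x)" by simp
          then show ?thesis using lip[of y x] by (simp only: dist_norm norm_minus_commute[of x y])
        qed
      qed auto
      then obtain y where "z - (\<phi> t y - y) = y" by blast
      then have "\<phi> t y = z" by (simp add: algebra_simps)
      then show ?thesis ..
    qed
    have iff: "\<phi> t y \<in> \<Omega> \<longleftrightarrow> y \<in> \<Omega>" for y
    proof (cases "y \<in> cball x0 \<rho>")
      case True
      have yb: "y \<in> ball x0 r" using True r by auto
      have "norm (\<phi> t y - y) \<le> C * \<bar>t\<bar>" using b by (simp add: C1_bdd_def)
      then have "dist (\<phi> t y) y < r - \<rho>" using t1 by (simp add: dist_norm)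
      then have fb: "\<phi> t y \<in> ball x0 r"
        using True dist_triangle[of x0 "\<phi> t y" y] by (simp add: dist_commute)
      have n: "\<phi> t y \<bullet> \<nu> = y \<bullet> \<nu> + (\<gamma> (p y + t *\<^sub>R U y) - \<gamma> (p y))"
        by (simp add: \<phi>_def inner_add_left U(2) \<nu>\<nu>)
      have h: "\<phi> t y - (\<phi> t y \<bullet> \<nu>) *\<^sub>R \<nu> = p y + t *\<^sub>R U y"
        unfolding n by (simp add: \<phi>_def p_def algebra_simps)
      have "\<phi> t y \<in> \<Omega> \<longleftrightarrow> \<phi> t y \<bullet> \<nu> > \<gamma> (\<phi> t y - (\<phi> t y \<bullet> \<nu>) *\<^sub>R \<nu>)" using chart fb by blast
      also have "\<dots> \<longleftrightarrow> y \<bullet> \<nu> > \<gamma> (p y)" unfolding h unfolding n by auto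
      also have "\<dots> \<longleftrightarrow> y \<in> \<Omega>" using chart yb unfolding p_def by blast
      finally show ?thesis .
    qed (simp add: off)
    show ?thesis using surj iff by (auto simp: image_iff) metis
  qed
  then show ?thesis using path off id d
    by (intro exI[of _ \<phi>] exI[of _ \<phi>'] exI[of _ d]) (auto simp: \<phi>'_def p_def)
qed

section \<open>Geometry of the boundary\<close>

text \<open>Chain rule relative to \<open>S\<close>: time is restricted to an open set on which the
  curve runs in \<open>S\<close>. Hence a derivative within \<open>S\<close> is determined on
  tangent vectors.\<close>

lemma has_derivative_tangent:
  assumes "(f has_derivative L) (at x within S)" "c 0 = x" "\<forall>\<^sub>F t in nhds (0::real). c t \<in> S"
    "(c has_vector_derivative v) (at 0)"
  shows "((\<lambda>t. f (c t)) has_vector_derivative L v) (at 0)"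
proof -
  obtain A where A: "open A" "0 \<in> A" "\<And>t. t \<in> A \<Longrightarrow> c t \<in> S"
    using assms(3) unfolding eventually_nhds by blast
  have "(c has_derivative (\<lambda>r. r *\<^sub>R v)) (at 0 within A)"
    using assms(4) unfolding has_vector_derivative_def by (rule has_derivative_at_withinI)
  moreover have "(f has_derivative L) (at (c 0) within c ` A)"
    using assms(1,2) A(3) by (auto intro: has_derivative_subset)
  ultimately have "((\<lambda>t. f (c t)) has_derivative (\<lambda>r. L (r *\<^sub>R v))) (at 0 within A)"
    by (rule has_derivative_in_compose)
  then show ?thesis
    by (simp add: has_vector_derivative_def at_within_open[OF A(2,1)] linear_cmul[OF has_derivative_linear[OF assms(1)]])
qed

lemma has_derivative_tangent_unique:
  assumes "v \<in> tangent_space S x" "(f has_derivative L) (at x within S)" "(f has_derivative L') (at x within S)"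
  shows "L v = L' v"
  using assms(1) vector_derivative_unique_at[OF has_derivative_tangent[OF assms(2)] has_derivative_tangent[OF assms(3)]]
  unfolding tangent_space_def by blast

text \<open>The graph is one order smoother than \<open>k\<close>, so that the normal is of class
  C^k.\<close>

locale boundary_chart =
  fixes \<Omega> :: "'a::euclidean_space set" and k :: nat and x0 \<nu> :: 'a and \<gamma> :: "'a \<Rightarrow> real" and r :: real
  assumes open_domain: "open \<Omega>" and center: "x0 \<in> frontier \<Omega>" and unit: "norm \<nu> = 1" and r_pos: "0 < r"
    and graph: "Ck_on UNIV (Suc k) \<gamma>"
    and chart: "\<Omega> \<inter> ball x0 r = {y \<in> ball x0 r. y \<bullet> \<nu> > \<gamma> (y - (y \<bullet> \<nu>) *\<^sub>R \<nu>)}"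
begin

definition base :: "'a \<Rightarrow> 'a" where "base y = y - (y \<bullet> \<nu>) *\<^sub>R \<nu>"
definition height :: "'a \<Rightarrow> real" where "height y = y \<bullet> \<nu> - \<gamma> (base y)"
text \<open>Gradient of \<open>height\<close>; the sum is the Riesz representative of the derivative
  of \<open>\<lambda>y. \<gamma> (base y)\<close>.\<close>

definition grad :: "'a \<Rightarrow> 'a"
  where "grad y = \<nu> - (\<Sum>b\<in>Basis. Df \<gamma> (base y) (base b) *\<^sub>R b)"
text \<open>The minus sign makes it point outward, since \<open>height\<close> is positive inside
  \<Omega>; writing the norm with \<open>powr\<close> gives access to
  \<open>Ck_on_powr_compose\<close>.\<close>

definition normal :: "'a \<Rightarrow> 'a" where "normal y = (- ((grad y \<bullet> grad y) powr (-1/2))) *\<^sub>R grad y"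
text \<open>Projection to the graph along \<nu>. It is as smooth as the graph, whereas the
  nearest-point projection would lose a derivative.\<close>

definition foot :: "'a \<Rightarrow> 'a" where "foot y = y - height y *\<^sub>R \<nu>"

lemma unit_inner: "\<nu> \<bullet> \<nu> = 1" using unit by (simp add: norm_eq_1)

lemma base_linear: "bounded_linear base" unfolding base_def
  by (intro bounded_linear_sub bounded_linear_ident bounded_linear_scaleR_const bounded_linear_inner_left)

lemma base_add_normal: "base (y + s *\<^sub>R \<nu>) = base y"
  by (simp add: base_def inner_add_left unit_inner algebra_simps)

lemma height_add_normal: "height (y + s *\<^sub>R \<nu>) = height y + s"
  by (simp add: height_def base_add_normal inner_add_left unit_inner)

lemma graph_C1: "Ck_on UNIV 1 \<gamma>" using Ck_on_mono[OF graph, of 1] by simp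

lemma grad_inner: "grad y \<bullet> v = v \<bullet> \<nu> - Df \<gamma> (base y) (base v)"
proof -
  let ?D = "Df \<gamma> (base y)"
  have lD: "linear (\<lambda>v. ?D (base v))"
    using linear_compose[OF bounded_linear.linear[OF base_linear] C1D(2)[OF graph_C1 UNIV_I]] by (simp add: o_def)
  show ?thesis
    using linear_basis_expansion[OF lD, of v]
    by (simp add: grad_def inner_diff_left inner_sum_left inner_diff_right inner_sum_right inner_commute mult.commute)
qed

lemma height_derivative: "(height has_derivative (\<lambda>v. grad y \<bullet> v)) (at y)"
proof -
  let ?D = "Df \<gamma> (base y)"
  have "((\<lambda>y. \<gamma> (base y)) has_derivative (\<lambda>v. ?D (base v))) (at y)"
    by (rule has_derivative_compose[OF bounded_linear.has_derivative[OF base_linear has_derivative_ident] C1D(1)[OF graph_C1 UNIV_I]])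
  then have "((\<lambda>y. y \<bullet> \<nu> - \<gamma> (base y)) has_derivative (\<lambda>v. v \<bullet> \<nu> - ?D (base v))) (at y)"
    by (intro has_derivative_diff has_derivative_inner_left has_derivative_ident)
  then show ?thesis unfolding height_def[abs_def] by (simp add: grad_inner)
qed

text \<open>Moving along \<nu> changes \<open>height\<close> at unit rate; so \<open>grad\<close>
  vanishes nowhere and can be normalised.\<close>

lemma grad_normal: "grad y \<bullet> \<nu> = 1"
proof -
  have "(\<lambda>s. height (y + s *\<^sub>R \<nu>)) = (\<lambda>s. height y + s)" by (simp add: height_add_normal)
  then have "((\<lambda>s. height (y + s *\<^sub>R \<nu>)) has_vector_derivative 1) (at 0)"
    by (auto intro!: derivative_eq_intros)
  then show ?thesis
    using vector_derivative_unique_at[OF directional_derivative[OF height_derivative[of y], of \<nu>]] by blast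
qed

lemma grad_pos: "0 < grad y \<bullet> grad y"
  using grad_normal[of y] by auto

lemma height_Ck: "Ck_on UNIV (Suc k) height"
  unfolding height_def[abs_def]
  by (intro Ck_on_diff Ck_on_inner open_UNIV Ck_on_const Ck_on_bounded_linear[OF open_UNIV bounded_linear_ident]
      Ck_on_compose[OF open_UNIV open_UNIV subset_UNIV Ck_on_bounded_linear[OF open_UNIV base_linear] graph])

lemma grad_Ck: "Ck_on UNIV k grad"
  unfolding grad_def[abs_def]
  by (intro Ck_on_diff Ck_on_sum Ck_on_scaleR open_UNIV Ck_on_const
      Ck_on_compose[OF open_UNIV open_UNIV subset_UNIV Ck_on_bounded_linear[OF open_UNIV base_linear] Ck_on_SucD(2)[OF graph]])

lemma normal_Ck: "Ck_on UNIV k normal"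
  unfolding normal_def[abs_def]
  by (intro Ck_on_scaleR Ck_on_minus Ck_on_powr_compose Ck_on_inner grad_Ck open_UNIV grad_pos)

lemma foot_Ck: "Ck_on UNIV (Suc k) foot"
  unfolding foot_def[abs_def]
  by (intro Ck_on_diff Ck_on_scaleR height_Ck open_UNIV Ck_on_const Ck_on_bounded_linear[OF open_UNIV bounded_linear_ident])

lemma height_foot: "height (foot y) = 0"
  using height_add_normal[of y "- height y"] by (simp add: foot_def)

lemma norm_grad: "norm (grad y) = (grad y \<bullet> grad y) powr (1/2)"
  by (simp add: norm_eq_sqrt_inner powr_half_sqrt)

lemma normal_eq: "normal y = - (1 / norm (grad y)) *\<^sub>R grad y"
  by (simp add: normal_def norm_grad powr_minus_divide)

lemma norm_grad_pos: "0 < norm (grad y)" using grad_pos[of y] by auto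

lemma norm_normal: "norm (normal y) = 1"
  using norm_grad_pos[of y] by (simp add: normal_eq)

lemma grad_eq: "grad y = - norm (grad y) *\<^sub>R normal y"
  using norm_grad_pos[of y] by (simp add: normal_eq)

lemma in_domain_iff: assumes "y \<in> ball x0 r" shows "y \<in> \<Omega> \<longleftrightarrow> 0 < height y"
proof -
  have "y \<in> \<Omega> \<longleftrightarrow> y \<in> \<Omega> \<inter> ball x0 r" using assms by blast
  then show ?thesis unfolding chart height_def base_def using assms by simp
qed

lemma height_continuous: "continuous_on UNIV height" using height_Ck by (rule Ck_on_continuous)

lemma not_closure: assumes "y \<in> ball x0 r" "height y < 0" shows "y \<notin> closure \<Omega>"
proof -
  have "open (ball x0 r \<inter> {y. height y < 0})"
    by (intro open_Int open_ball open_Collect_less height_continuous continuous_on_const)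
  moreover have "ball x0 r \<inter> {y. height y < 0} \<inter> \<Omega> = {}" using in_domain_iff by fastforce
  ultimately have "ball x0 r \<inter> {y. height y < 0} \<inter> closure \<Omega> = {}" using open_Int_closure_eq_empty by blast
  then show ?thesis using assms by blast
qed

text \<open>Points of negative height have a neighbourhood missing \<Omega>, and a point of height 0
  is the limit of its upward translates along \<nu>, which lie in \<Omega>.\<close>

lemma frontier_iff: assumes y: "y \<in> ball x0 r" shows "y \<in> frontier \<Omega> \<longleftrightarrow> height y = 0"
proof
  assume "y \<in> frontier \<Omega>"
  then have "y \<notin> \<Omega>" "y \<in> closure \<Omega>" using open_domain by (auto simp: frontier_def interior_open)
  then show "height y = 0" using in_domain_iff[OF y] not_closure[OF y] by force
next
  assume h: "height y = 0"
  have "y \<in> closure \<Omega>"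
    unfolding closure_approachable
  proof (intro allI impI)
    fix e :: real assume e: "0 < e"
    define s where "s = min e (r - dist x0 y) / 2"
    have s: "0 < s" "s < e" "s < r - dist x0 y" using e y by (auto simp: s_def)
    have d: "dist (y + s *\<^sub>R \<nu>) y = s" using s(1) by (simp add: dist_norm unit)
    have "y + s *\<^sub>R \<nu> \<in> ball x0 r" using s(3) d dist_triangle[of x0 "y + s *\<^sub>R \<nu>" y] by (simp add: dist_commute)
    then have "y + s *\<^sub>R \<nu> \<in> \<Omega>" using in_domain_iff s(1) h by (simp add: height_add_normal)
    then show "\<exists>z\<in>\<Omega>. dist z y < e" using d s(2) by (intro bexI[of _ "y + s *\<^sub>R \<nu>"]) simp_all
  qed
  moreover have "y \<notin> \<Omega>" using in_domain_iff[OF y] h by simp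
  ultimately show "y \<in> frontier \<Omega>" using open_domain by (simp add: frontier_def interior_open)
qed

lemma center_height: "height x0 = 0" using frontier_iff[of x0] center r_pos by simp

lemma foot_frontier: "y \<in> ball x0 r \<Longrightarrow> y \<in> frontier \<Omega> \<Longrightarrow> foot y = y"
  by (simp add: frontier_iff foot_def)

text \<open>\<open>foot\<close> is continuous and fixes the centre, so nearby feet stay in the chart
  ball, where height 0 means boundary.\<close>

lemma foot_radius:
  obtains \<rho> where "0 < \<rho>" "\<rho> \<le> r" "\<And>y. y \<in> ball x0 \<rho> \<Longrightarrow> foot y \<in> frontier \<Omega>"
proof -
  have "continuous_on UNIV foot" using foot_Ck by (rule Ck_on_continuous)
  then have "isCont foot x0" by (simp add: continuous_on_eq_continuous_at)
  moreover have "foot x0 = x0" using center_height by (simp add: foot_def)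
  ultimately obtain d where d: "0 < d" "\<And>y. dist y x0 < d \<Longrightarrow> dist (foot y) x0 < r"
    using r_pos unfolding continuous_at_eps_delta by metis
  show ?thesis
  proof
    show "0 < min d r" "min d r \<le> r" using d(1) r_pos by auto
    fix y assume "y \<in> ball x0 (min d r)"
    then have "foot y \<in> ball x0 r" using d(2)[of y] by (simp add: dist_commute)
    then show "foot y \<in> frontier \<Omega>" using frontier_iff height_foot by blast
  qed
qed

lemma eventually_in_ball:
  assumes "y \<in> ball x0 r" "isCont c (0::real)" "c 0 = y"
  shows "\<forall>\<^sub>F t in nhds 0. c t \<in> ball x0 r"
proof -
  have "(c \<longlongrightarrow> y) (nhds 0)"
    using assms(2,3) tendsto_at_iff_tendsto_nhds[of c 0] unfolding isCont_def by simp
  then show ?thesis using assms(1) topological_tendstoD open_ball by blast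
qed

lemma tangent_space_frontier:
  assumes y: "y \<in> ball x0 r" "y \<in> frontier \<Omega>"
  shows "v \<in> tangent_space (frontier \<Omega>) y \<longleftrightarrow> grad y \<bullet> v = 0"
proof
  assume "v \<in> tangent_space (frontier \<Omega>) y"
  then obtain c where c: "c 0 = y" "\<forall>\<^sub>F t in nhds (0::real). c t \<in> frontier \<Omega>" "(c has_vector_derivative v) (at 0)"
    unfolding tangent_space_def by blast
  have hc: "((\<lambda>t. height (c t)) has_vector_derivative grad y \<bullet> v) (at 0)"
    by (rule has_derivative_tangent[OF has_derivative_at_withinI[OF height_derivative] c])
  have "\<forall>\<^sub>F t in nhds 0. c t \<in> ball x0 r"
    by (rule eventually_in_ball[OF y(1) has_vector_derivative_continuous[OF c(3)] c(1)])
  with c(2) have "\<forall>\<^sub>F t in nhds 0. height (c t) = 0" by eventually_elim (simp add: frontier_iff)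
  then obtain d where d: "0 < d" "\<And>t. dist t 0 < d \<Longrightarrow> height (c t) = 0" unfolding eventually_nhds_metric by blast
  show "grad y \<bullet> v = 0"
    by (rule vector_derivative_unique_local[OF hc has_vector_derivative_const d(1)]) (simp add: d(2))
next
  assume v: "grad y \<bullet> v = 0"
  \<comment> \<open>The projected straight line; its velocity is
    \<open>v - (grad y \<bullet> v) *\<^sub>R \<nu>\<close>, which is \<open>v\<close>.\<close>
  define c where "c t = foot (y + t *\<^sub>R v)" for t
  have h0: "height y = 0" using frontier_iff y by blast
  have "(foot has_derivative (\<lambda>w. w - (grad y \<bullet> w) *\<^sub>R \<nu>)) (at y)"
    unfolding foot_def[abs_def]
    by (intro has_derivative_diff has_derivative_ident has_derivative_scaleR_left height_derivative)
  from directional_derivative[OF this, of v] have cd: "(c has_vector_derivative v) (at 0)"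
    unfolding c_def by (simp add: v)
  have c0: "c 0 = y" by (simp add: c_def foot_def h0)
  have "\<forall>\<^sub>F t in nhds 0. c t \<in> ball x0 r"
    by (rule eventually_in_ball[OF y(1) has_vector_derivative_continuous[OF cd] c0])
  then have "\<forall>\<^sub>F t in nhds 0. c t \<in> frontier \<Omega>"
    by eventually_elim (simp add: frontier_iff c_def height_foot)
  then show "v \<in> tangent_space (frontier \<Omega>) y" using c0 cd unfolding tangent_space_def by blast
qed

text \<open>\<open>height\<close> vanishes at \<open>y\<close> and has derivative -|grad y| < 0
  along \<open>normal y\<close>.\<close>

lemma normal_direction:
  assumes y: "y \<in> ball x0 r" "y \<in> frontier \<Omega>"
  shows "\<forall>\<^sub>F t in at_right 0. y + t *\<^sub>R normal y \<notin> closure \<Omega> \<and> y - t *\<^sub>R normal y \<in> \<Omega>"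
proof -
  have h0: "height y = 0" using frontier_iff y by blast
  have gn: "grad y \<bullet> normal y < 0"
    using norm_grad_pos[of y] grad_pos[of y] by (simp add: normal_eq)
  have D: "((\<lambda>t. height (y + t *\<^sub>R normal y)) has_real_derivative grad y \<bullet> normal y) (at 0)"
    using directional_derivative[OF height_derivative[of y], of "normal y"]
    by (simp add: has_real_derivative_iff_has_vector_derivative)
  obtain d1 where d1: "0 < d1" "\<And>t. 0 < t \<Longrightarrow> t < d1 \<Longrightarrow> height (y + t *\<^sub>R normal y) < 0"
    using DERIV_neg_dec_right[OF D gn] h0 by auto
  obtain d2 where d2: "0 < d2" "\<And>t. 0 < t \<Longrightarrow> t < d2 \<Longrightarrow> 0 < height (y - t *\<^sub>R normal y)"
    using DERIV_neg_dec_left[OF D gn] h0 by auto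
  define d where "d = min (min d1 d2) (r - dist x0 y)"
  have "0 < d" using d1 d2 y by (simp add: d_def)
  moreover have "y + t *\<^sub>R normal y \<notin> closure \<Omega> \<and> y - t *\<^sub>R normal y \<in> \<Omega>" if t: "0 < t" "t < d" for t
  proof -
    have "dist (y + t *\<^sub>R normal y) y = t" "dist (y - t *\<^sub>R normal y) y = t"
      using t(1) by (simp_all add: dist_norm norm_normal)
    then have "y + t *\<^sub>R normal y \<in> ball x0 r" "y - t *\<^sub>R normal y \<in> ball x0 r"
      using t(2) dist_triangle[of x0 "y + t *\<^sub>R normal y" y] dist_triangle[of x0 "y - t *\<^sub>R normal y" y]
      by (simp_all add: d_def dist_commute)
    then show ?thesis using not_closure in_domain_iff d1(2)[of t] d2(2)[of t] t by (simp add: d_def)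
  qed
  ultimately show ?thesis unfolding eventually_at_right_field by auto
qed

text \<open>A competitor is orthogonal to all tangent vectors, which fill a hyperplane, so it is
  plus or minus \<open>normal y\<close>; the opposite sign contradicts the side condition.\<close>

lemma exterior_normal_eq:
  assumes y: "y \<in> ball x0 r" "y \<in> frontier \<Omega>"
  shows "exterior_normal \<Omega> y = normal y"
  unfolding exterior_normal_def
proof (rule the_equality)
  have nt: "normal y \<bullet> v = 0" if "v \<in> tangent_space (frontier \<Omega>) y" for v
    using that unfolding tangent_space_frontier[OF y] by (simp add: normal_eq)
  show "norm (normal y) = 1 \<and> (\<forall>v\<in>tangent_space (frontier \<Omega>) y. normal y \<bullet> v = 0) \<and>
    (\<forall>\<^sub>F t in at_right 0. y + t *\<^sub>R normal y \<notin> closure \<Omega> \<and> y - t *\<^sub>R normal y \<in> \<Omega>)"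
    using norm_normal nt normal_direction[OF y] by blast
  fix \<mu> assume \<mu>: "norm \<mu> = 1 \<and> (\<forall>v\<in>tangent_space (frontier \<Omega>) y. \<mu> \<bullet> v = 0) \<and>
    (\<forall>\<^sub>F t in at_right 0. y + t *\<^sub>R \<mu> \<notin> closure \<Omega> \<and> y - t *\<^sub>R \<mu> \<in> \<Omega>)"
  have nn: "normal y \<bullet> normal y = 1" using norm_normal by (simp add: norm_eq_1)
  define v where "v = \<mu> - (\<mu> \<bullet> normal y) *\<^sub>R normal y"
  have nv: "normal y \<bullet> v = 0" by (simp add: v_def inner_diff_right nn inner_commute)
  then have "grad y \<bullet> v = 0" by (subst grad_eq) simp
  then have "\<mu> \<bullet> v = 0" using \<mu> tangent_space_frontier[OF y] by blast
  then have "v \<bullet> v = 0" using nv by (simp add: v_def inner_diff_left)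
  then have m: "\<mu> = (\<mu> \<bullet> normal y) *\<^sub>R normal y" by (simp add: v_def)
  have "\<bar>\<mu> \<bullet> normal y\<bar> = 1" using \<mu> arg_cong[OF m, of norm] by (simp add: norm_normal)
  then consider "\<mu> \<bullet> normal y = 1" | "\<mu> \<bullet> normal y = -1" by linarith
  then show "\<mu> = normal y"
  proof cases
    case 1 then show ?thesis using m by simp
  next
    case 2
    then have m': "\<mu> = - normal y" using m by simp
    have "\<forall>\<^sub>F t in at_right (0::real). y + t *\<^sub>R \<mu> \<notin> closure \<Omega> \<and> y - t *\<^sub>R \<mu> \<in> \<Omega>" using \<mu> by blast
    with normal_direction[OF y] have "\<forall>\<^sub>F t in at_right (0::real). False"
      by eventually_elim (use closure_subset in \<open>auto simp: m'\<close>)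
    then show ?thesis by simp
  qed
qed

text \<open>\<open>height\<close> vanishes on the boundary, so a multiple of it can be added to
  \<open>f\<close> without changing anything there. The multiple \<open>q\<close> is chosen to
  cancel the normal part of \<open>L\<close>.\<close>

lemma has_derivative_tangential:
  assumes y: "y \<in> ball x0 r" "y \<in> frontier \<Omega>"
    and f: "(f has_derivative L) (at y within frontier \<Omega>)"
  shows "(f has_derivative (\<lambda>v. L (v - (v \<bullet> normal y) *\<^sub>R normal y))) (at y within frontier \<Omega>)"
proof -
  note lL = has_derivative_linear[OF f]
  have h0: "height y = 0" using frontier_iff y by blast
  define q where "q z = (height z * (1 / norm (grad y))) *\<^sub>R L (normal y)" for z
  have "(q has_derivative (\<lambda>v. ((grad y \<bullet> v) * (1 / norm (grad y))) *\<^sub>R L (normal y))) (at y)"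
    unfolding q_def[abs_def]
    by (intro has_derivative_scaleR_left has_derivative_mult_left height_derivative)
  then have q: "(q has_derivative (\<lambda>v. (- (v \<bullet> normal y)) *\<^sub>R L (normal y))) (at y within frontier \<Omega>)"
  proof -
    assume d: "(q has_derivative (\<lambda>v. ((grad y \<bullet> v) * (1 / norm (grad y))) *\<^sub>R L (normal y))) (at y)"
    have "(grad y \<bullet> v) * (1 / norm (grad y)) = - (v \<bullet> normal y)" for v
      using norm_grad_pos[of y] by (simp add: normal_eq inner_commute)
    with d have "(q has_derivative (\<lambda>v. (- (v \<bullet> normal y)) *\<^sub>R L (normal y))) (at y)" by simp
    then show ?thesis by (rule has_derivative_at_withinI)
  qed
  have "((\<lambda>z. f z + q z) has_derivative (\<lambda>v. L (v - (v \<bullet> normal y) *\<^sub>R normal y))) (at y within frontier \<Omega>)"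
    using has_derivative_add[OF f q] by (simp add: linear_diff[OF lL] linear_cmul[OF lL])
  then show ?thesis
  proof (rule has_derivative_transform_within[where d="r - dist x0 y"])
    fix z assume "z \<in> frontier \<Omega>" "dist z y < r - dist x0 y"
    then have "height z = 0" using frontier_iff[of z] dist_triangle[of x0 z y] by (simp add: dist_commute)
    then show "f z + q z = f z" by (simp add: q_def)
  qed (use y in auto)
qed

text \<open>Competing derivatives agree on tangent vectors and vanish on the normal, which settles
  the definite description.\<close>

lemma tangential_derivative_eq:
  assumes y: "y \<in> ball x0 r" "y \<in> frontier \<Omega>"
    and f: "(f has_derivative L) (at y within frontier \<Omega>)"
  shows "tangential_derivative \<Omega> f y = (\<lambda>v. L (v - (v \<bullet> normal y) *\<^sub>R normal y))"
  unfolding tangential_derivative_def exterior_normal_eq[OF y]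
proof (rule the_equality)
  have nn: "normal y \<bullet> normal y = 1" using norm_normal by (simp add: norm_eq_1)
  show "(f has_derivative (\<lambda>v. L (v - (v \<bullet> normal y) *\<^sub>R normal y))) (at y within frontier \<Omega>) \<and>
    L (normal y - (normal y \<bullet> normal y) *\<^sub>R normal y) = 0"
    using has_derivative_tangential[OF y f] linear_0[OF has_derivative_linear[OF f]] by (simp add: nn)
  fix L' assume L': "(f has_derivative L') (at y within frontier \<Omega>) \<and> L' (normal y) = 0"
  note lL' = has_derivative_linear[OF conjunct1[OF L']]
  show "L' = (\<lambda>v. L (v - (v \<bullet> normal y) *\<^sub>R normal y))"
  proof
    fix v
    let ?w = "v - (v \<bullet> normal y) *\<^sub>R normal y"
    have "normal y \<bullet> ?w = 0" by (simp add: inner_diff_right nn inner_commute)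
    then have "grad y \<bullet> ?w = 0" by (subst grad_eq) simp
    then have "?w \<in> tangent_space (frontier \<Omega>) y" using tangent_space_frontier[OF y] by blast
    then have "L' ?w = L ?w" using has_derivative_tangent_unique[OF _ conjunct1[OF L'] f] by blast
    then show "L' v = L ?w" using L' by (simp add: linear_diff[OF lL'] linear_cmul[OF lL'])
  qed
qed

end

section \<open>Boundary calculus without a chosen chart\<close>

lemma boundary_chart_exists:
  assumes "Ck_domain (Suc k) \<Omega>" "x \<in> frontier \<Omega>"
  obtains \<nu> \<gamma> r where "boundary_chart \<Omega> k x \<nu> \<gamma> r"
proof -
  obtain \<nu> \<gamma> r where "norm \<nu> = 1 \<and> r > 0 \<and> Ck_on UNIV (Suc k) \<gamma> \<and>
      \<Omega> \<inter> ball x r = {y \<in> ball x r. y \<bullet> \<nu> > \<gamma> (y - (y \<bullet> \<nu>) *\<^sub>R \<nu>)}"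
    using assms unfolding Ck_domain_def by blast
  then have "boundary_chart \<Omega> k x \<nu> \<gamma> r"
    using assms by (simp add: boundary_chart_def Ck_domain_def del: Ck_on.simps)
  then show ?thesis by (rule that)
qed

lemma exterior_normal_unit:
  assumes "Ck_domain (Suc k) \<Omega>" "x \<in> frontier \<Omega>"
  shows "norm (exterior_normal \<Omega> x) = 1" "exterior_normal \<Omega> x \<bullet> exterior_normal \<Omega> x = 1"
proof -
  obtain \<nu> \<gamma> r where "boundary_chart \<Omega> k x \<nu> \<gamma> r" using boundary_chart_exists[OF assms] .
  then interpret boundary_chart \<Omega> k x \<nu> \<gamma> r .
  show "norm (exterior_normal \<Omega> x) = 1"
    using exterior_normal_eq[of x] assms(2) r_pos norm_normal by simp
  then show "exterior_normal \<Omega> x \<bullet> exterior_normal \<Omega> x = 1" by (simp add: norm_eq_1)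
qed

lemma tangential_derivative_within:
  assumes "Ck_domain (Suc k) \<Omega>" "x \<in> frontier \<Omega>" "(f has_derivative L) (at x within frontier \<Omega>)"
  shows "tangential_derivative \<Omega> f x v = L (v - (v \<bullet> exterior_normal \<Omega> x) *\<^sub>R exterior_normal \<Omega> x)"
    and "(f has_derivative tangential_derivative \<Omega> f x) (at x within frontier \<Omega>)"
proof -
  obtain \<nu> \<gamma> r where "boundary_chart \<Omega> k x \<nu> \<gamma> r" using boundary_chart_exists[OF assms(1,2)] .
  then interpret boundary_chart \<Omega> k x \<nu> \<gamma> r .
  have x: "x \<in> ball x r" using r_pos by simp
  show "tangential_derivative \<Omega> f x v = L (v - (v \<bullet> exterior_normal \<Omega> x) *\<^sub>R exterior_normal \<Omega> x)"
    by (simp add: tangential_derivative_eq[OF x assms(2,3)] exterior_normal_eq[OF x assms(2)])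
  show "(f has_derivative tangential_derivative \<Omega> f x) (at x within frontier \<Omega>)"
    using has_derivative_tangential[OF x assms(2,3)] by (simp add: tangential_derivative_eq[OF x assms(2,3)])
qed

section \<open>Functions on the boundary\<close>

lemma Ck_boundary_1:
  "Ck_boundary 1 \<Omega> f \<longleftrightarrow> (\<forall>x\<in>frontier \<Omega>. f differentiable (at x within frontier \<Omega>)) \<and>
    (\<forall>v. continuous_on (frontier \<Omega>) (\<lambda>x. tangential_derivative \<Omega> f x v))"
  by (simp add: One_nat_def)

lemma Ck_boundary_1_continuous: "Ck_boundary 1 \<Omega> f \<Longrightarrow> continuous_on (frontier \<Omega>) f"
  unfolding Ck_boundary_1 by (auto intro: differentiable_imp_continuous_on simp: differentiable_on_def)

lemma Ck_boundary_2_imp_1: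
  assumes "Ck_boundary 2 \<Omega> f" shows "Ck_boundary 1 \<Omega> f" "Ck_boundary 1 \<Omega> (\<lambda>x. tangential_derivative \<Omega> f x v)"
proof -
  have f: "\<forall>x\<in>frontier \<Omega>. f differentiable (at x within frontier \<Omega>)"
    "\<And>v. Ck_boundary 1 \<Omega> (\<lambda>x. tangential_derivative \<Omega> f x v)"
    using assms by (simp_all add: numeral_2_eq_2)
  then show "Ck_boundary 1 \<Omega> f" using Ck_boundary_1_continuous unfolding Ck_boundary_1[of _ f] by blast
  show "Ck_boundary 1 \<Omega> (\<lambda>x. tangential_derivative \<Omega> f x v)" by (rule f(2))
qed

lemma norm_le_boundary_SUP:
  fixes \<Omega> :: "'a::euclidean_space set"
  assumes "bounded \<Omega>" "continuous_on (frontier \<Omega>) f" "x \<in> frontier \<Omega>"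
  shows "norm (f x) \<le> (SUP x\<in>frontier \<Omega>. norm (f x))" "0 \<le> (SUP x\<in>frontier \<Omega>. norm (f x))"
proof -
  have "compact ((\<lambda>x. norm (f x)) ` frontier \<Omega>)"
    by (intro compact_continuous_image continuous_on_norm assms(2) compact_frontier_bounded[OF assms(1)])
  then have "bdd_above ((\<lambda>x. norm (f x)) ` frontier \<Omega>)" by (intro bounded_imp_bdd_above compact_imp_bounded)
  then show le: "norm (f x) \<le> (SUP x\<in>frontier \<Omega>. norm (f x))" by (rule cSUP_upper[OF assms(3)])
  show "0 \<le> (SUP x\<in>frontier \<Omega>. norm (f x))" by (rule order_trans[OF norm_ge_zero le])
qed

lemma Ck_boundary_norm_1:
  "Ck_boundary_norm 1 \<Omega> f = (SUP x\<in>frontier \<Omega>. norm (f x)) +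
    (\<Sum>b\<in>Basis. (SUP x\<in>frontier \<Omega>. norm (tangential_derivative \<Omega> f x b)))"
  by (simp add: One_nat_def)

lemma Ck_boundary_norm_1_ge:
  assumes "bounded \<Omega>" "Ck_boundary 1 \<Omega> f" "x \<in> frontier \<Omega>"
  shows "norm (f x) \<le> Ck_boundary_norm 1 \<Omega> f"
    "b \<in> Basis \<Longrightarrow> norm (tangential_derivative \<Omega> f x b) \<le> Ck_boundary_norm 1 \<Omega> f"
    "(SUP x\<in>frontier \<Omega>. norm (f x)) \<le> Ck_boundary_norm 1 \<Omega> f"
    "0 \<le> Ck_boundary_norm 1 \<Omega> f"
proof -
  note S = norm_le_boundary_SUP[OF assms(1) Ck_boundary_1_continuous[OF assms(2)] assms(3)]
  have ct: "continuous_on (frontier \<Omega>) (\<lambda>x. tangential_derivative \<Omega> f x b)" for b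
    using assms(2) unfolding Ck_boundary_1 by blast
  note T = norm_le_boundary_SUP[OF assms(1) ct assms(3)]
  have T0: "0 \<le> (\<Sum>b\<in>Basis. (SUP x\<in>frontier \<Omega>. norm (tangential_derivative \<Omega> f x b)))"
    by (intro sum_nonneg T)
  show "norm (f x) \<le> Ck_boundary_norm 1 \<Omega> f" "(SUP x\<in>frontier \<Omega>. norm (f x)) \<le> Ck_boundary_norm 1 \<Omega> f"
    "0 \<le> Ck_boundary_norm 1 \<Omega> f"
    unfolding Ck_boundary_norm_1 using S T0 by linarith+
  show "norm (tangential_derivative \<Omega> f x b) \<le> Ck_boundary_norm 1 \<Omega> f" if "b \<in> Basis"
  proof -
    have "(SUP x\<in>frontier \<Omega>. norm (tangential_derivative \<Omega> f x b)) \<le>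
        (\<Sum>b\<in>Basis. (SUP x\<in>frontier \<Omega>. norm (tangential_derivative \<Omega> f x b)))"
      by (rule member_le_sum[OF that]) (auto intro: T)
    then show ?thesis unfolding Ck_boundary_norm_1 using S T(1)[of b] by linarith
  qed
qed

lemma Ck_boundary_norm_1_le_2:
  assumes "bounded \<Omega>" "Ck_boundary 2 \<Omega> f" "x \<in> frontier \<Omega>"
  shows "Ck_boundary_norm 1 \<Omega> f \<le> Ck_boundary_norm 2 \<Omega> f"
proof -
  have "Ck_boundary_norm 2 \<Omega> f = (SUP x\<in>frontier \<Omega>. norm (f x)) +
      (\<Sum>b\<in>Basis. Ck_boundary_norm 1 \<Omega> (\<lambda>x. tangential_derivative \<Omega> f x b))"
    by (simp add: numeral_2_eq_2)
  then show ?thesis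
    by (simp only: Ck_boundary_norm_1[of _ f]) (intro add_left_mono sum_mono Ck_boundary_norm_1_ge(3)[OF assms(1) Ck_boundary_2_imp_1(2)[OF assms(2)] assms(3)])
qed

section \<open>Sums and products under \<open>C1_bdd\<close> bounds\<close>

lemma C1_bdd_nonneg: "C1_bdd f B \<Longrightarrow> 0 \<le> B"
  unfolding C1_bdd_def using norm_ge_zero order_trans by blast

lemma C1_bdd_scaleR:
  fixes f :: "'a::euclidean_space \<Rightarrow> real" and g :: "'a \<Rightarrow> 'c::euclidean_space"
  assumes f: "C1_bdd f A" and g: "C1_bdd g B"
  shows "C1_bdd (\<lambda>x. f x *\<^sub>R g x) (2 * A * B)"
proof -
  have c: "Ck_on UNIV 1 f" "Ck_on UNIV 1 g" using f g by (auto simp: C1_bdd_def)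
  have d: "Df (\<lambda>x. f x *\<^sub>R g x) x b =
      f x *\<^sub>R Df g x b + Df f x b *\<^sub>R g x" for x b
    using frechet_derivative_eq[OF bounded_bilinear.FDERIV[OF bounded_bilinear_scaleR C1D(1)[OF c(1) UNIV_I] C1D(1)[OF c(2) UNIV_I]]] by simp
  have le: "norm (a *\<^sub>R v) \<le> A * B" if "norm a \<le> A" "norm v \<le> B" for a and v :: 'c
    using mult_mono[OF that] C1_bdd_nonneg[OF f] by simp
  have AB: "0 \<le> A * B" using C1_bdd_nonneg[OF f] C1_bdd_nonneg[OF g] by simp
  show ?thesis unfolding C1_bdd_def d
  proof (intro conjI allI ballI)
    show "Ck_on UNIV 1 (\<lambda>x. f x *\<^sub>R g x)" by (rule Ck_on_scaleR[OF open_UNIV c])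
    fix x
    have "norm (f x *\<^sub>R g x) \<le> A * B" using f g by (intro le) (auto simp: C1_bdd_def)
    then show "norm (f x *\<^sub>R g x) \<le> 2 * A * B" using AB by simp
    fix b :: 'a assume "b \<in> Basis"
    then have "norm (f x *\<^sub>R Df g x b) \<le> A * B" "norm (Df f x b *\<^sub>R g x) \<le> A * B"
      using f g by (auto simp: C1_bdd_def intro!: le simp del: norm_scaleR)
    then show "norm (f x *\<^sub>R Df g x b + Df f x b *\<^sub>R g x) \<le> 2 * A * B"
      using norm_triangle_ineq[of "f x *\<^sub>R Df g x b" "Df f x b *\<^sub>R g x"] by linarith
  qed
qed

lemma C1_bdd_add:
  assumes f: "C1_bdd f A" and g: "C1_bdd g B"
  shows "C1_bdd (\<lambda>x. f x + g x) (A + B)"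
proof -
  have c: "Ck_on UNIV 1 f" "Ck_on UNIV 1 g" using f g by (auto simp: C1_bdd_def)
  have d: "Df (\<lambda>x. f x + g x) x b = Df f x b + Df g x b" for x b
    using frechet_derivative_eq[OF has_derivative_add[OF C1D(1)[OF c(1) UNIV_I] C1D(1)[OF c(2) UNIV_I]]] by simp
  show ?thesis unfolding C1_bdd_def d
  proof (intro conjI allI ballI)
    show "Ck_on UNIV 1 (\<lambda>x. f x + g x)" by (rule Ck_on_add[OF open_UNIV c])
    show "norm (f x + g x) \<le> A + B" for x
      using f g unfolding C1_bdd_def by (blast intro: norm_triangle_mono)
    show "norm (Df f x b + Df g x b) \<le> A + B" if "b \<in> Basis" for x b
      using f g that unfolding C1_bdd_def by (blast intro: norm_triangle_mono)
  qed
qed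

lemma C1_bdd_zero: "C1_bdd (\<lambda>x. 0) 0"
  by (simp add: C1_bdd_def frechet_derivative_const)

lemma C1_bdd_sum:
  assumes "\<And>i. i \<in> I \<Longrightarrow> C1_bdd (f i) (B i)"
  shows "C1_bdd (\<lambda>x. \<Sum>i\<in>I. f i x) (\<Sum>i\<in>I. B i)"
  using assms by (induction I rule: infinite_finite_induct) (auto intro: C1_bdd_zero C1_bdd_add)

lemma C1_bdd_mono: "C1_bdd f A \<Longrightarrow> A \<le> B \<Longrightarrow> C1_bdd f B"
  unfolding C1_bdd_def using order_trans by blast

context boundary_chart
begin

text \<open>\<open>f\<close> is differentiable only within the boundary, but \<open>foot\<close>
  takes values there, so the composition is differentiable in the open ball of radius 2 \<rho>, and
  the cutoff extends it by 0. In the constant, M belongs to the term with D\<psi> and the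
  dimensional summand to the term with the derivative of \<open>foot\<close>.\<close>

lemma vertical_extension:
  fixes f :: "'a \<Rightarrow> real"
  assumes \<rho>: "0 < \<rho>" and ft: "\<And>y. y \<in> ball x0 (2 * \<rho>) \<Longrightarrow> foot y \<in> frontier \<Omega>"
    and \<psi>: "Ck_on UNIV 1 \<psi>" "\<And>y. y \<notin> cball x0 \<rho> \<Longrightarrow> \<psi> y = 0"
    and dom: "Ck_domain (Suc j) \<Omega>"
    and M: "0 < M" "\<And>y. y \<in> cball x0 \<rho> \<Longrightarrow> \<bar>\<psi> y\<bar> \<le> M"
      "\<And>y b. y \<in> cball x0 \<rho> \<Longrightarrow> b \<in> Basis \<Longrightarrow> \<bar>Df \<psi> y b\<bar> \<le> M"
      "\<And>y b. y \<in> cball x0 \<rho> \<Longrightarrow> b \<in> Basis \<Longrightarrow> norm (Df foot y b) \<le> M"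
    and f: "Ck_boundary 1 \<Omega> f" and A: "0 \<le> A" "\<And>x. x \<in> frontier \<Omega> \<Longrightarrow> \<bar>f x\<bar> \<le> A"
      "\<And>x b. x \<in> frontier \<Omega> \<Longrightarrow> b \<in> Basis \<Longrightarrow> \<bar>tangential_derivative \<Omega> f x b\<bar> \<le> A"
  shows "C1_bdd (\<lambda>y. \<psi> y *\<^sub>R f (foot y)) ((M + real DIM('a) * M * M) * A)"
proof -
  \<comment> \<open>The candidate derivative, with the chain rule expanded in a basis to make
    continuity in \<open>y\<close> visible.\<close>
  define G where "G y v = \<psi> y * (\<Sum>b\<in>Basis. (Df foot y v \<bullet> b) * tangential_derivative \<Omega> f (foot y) b)
      + Df \<psi> y v * f (foot y)" for y v
  have fC: "Ck_on UNIV 1 foot" using Ck_on_mono[OF foot_Ck, of 1] by simp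
  have \<psi>0: "\<psi> y = 0" "Df \<psi> y v = 0" if "y \<notin> cball x0 \<rho>" for y v
    using \<psi>(2) frechet_derivative_zero_off[OF closed_cball \<psi>(2)] that by auto
  have G0: "G y v = 0" if "y \<notin> cball x0 \<rho>" for y v using \<psi>0[OF that] by (simp add: G_def)
  have Tf: "(f has_derivative tangential_derivative \<Omega> f x) (at x within frontier \<Omega>)" if "x \<in> frontier \<Omega>" for x
  proof -
    have "f differentiable (at x within frontier \<Omega>)"
      using f that by (simp add: Ck_boundary_1)
    then obtain L where "(f has_derivative L) (at x within frontier \<Omega>)"
      unfolding differentiable_def ..
    then show ?thesis by (rule tangential_derivative_within(2)[OF dom that])
  qed
  have cT: "continuous_on (frontier \<Omega>) (\<lambda>x. tangential_derivative \<Omega> f x b)" for b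
    using f unfolding Ck_boundary_1 by blast
  have inb: "(\<lambda>y. f (foot y)) differentiable (at y) \<and>
      Df (\<lambda>y. f (foot y)) y v = (\<Sum>b\<in>Basis. (Df foot y v \<bullet> b) * tangential_derivative \<Omega> f (foot y) b)"
    if y: "y \<in> ball x0 (2 * \<rho>)" for y v
  proof -
    have "(foot has_derivative Df foot y) (at y within ball x0 (2 * \<rho>))"
      by (rule has_derivative_at_withinI[OF C1D(1)[OF fC UNIV_I]])
    moreover have "(f has_derivative tangential_derivative \<Omega> f (foot y)) (at (foot y) within foot ` ball x0 (2 * \<rho>))"
      by (rule has_derivative_subset[OF Tf[OF ft[OF y]]]) (use ft in auto)
    ultimately have "((\<lambda>y. f (foot y)) has_derivative (\<lambda>v. tangential_derivative \<Omega> f (foot y) (Df foot y v))) (at y within ball x0 (2 * \<rho>))"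
      by (rule has_derivative_in_compose)
    then have d: "((\<lambda>y. f (foot y)) has_derivative (\<lambda>v. tangential_derivative \<Omega> f (foot y) (Df foot y v))) (at y)"
      by (simp only: at_within_open[OF y open_ball])
    show ?thesis
      using frechet_derivative_eq[OF d] differentiableI[OF d]
        linear_basis_expansion[OF has_derivative_linear[OF Tf[OF ft[OF y]]], of "Df foot y v"]
      by simp
  qed
  have der: "((\<lambda>y. \<psi> y *\<^sub>R f (foot y)) has_derivative G y) (at y)" for y
  proof (cases "y \<in> cball x0 \<rho>")
    case True
    then have y: "y \<in> ball x0 (2 * \<rho>)" using \<rho> by auto
    have "((\<lambda>y. f (foot y)) has_derivative Df (\<lambda>y. f (foot y)) y) (at y)"
      using inb[OF y] by (simp add: frechet_derivative_works)
    from bounded_bilinear.FDERIV[OF bounded_bilinear_scaleR C1D(1)[OF \<psi>(1) UNIV_I] this]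
    show ?thesis using inb[OF y] by (simp add: G_def[abs_def])
  next
    case False
    have "((\<lambda>y. 0::real) has_derivative (\<lambda>v. 0)) (at y)" by simp
    then have "((\<lambda>y. \<psi> y *\<^sub>R f (foot y)) has_derivative (\<lambda>v. 0)) (at y)"
      by (rule has_derivative_transform_within_open[of _ _ _ UNIV "- cball x0 \<rho>"]) (use False \<psi>(2) in \<open>auto simp: open_Compl\<close>)
    moreover have "G y = (\<lambda>v. 0)" using G0[OF False] by blast
    ultimately show ?thesis by simp
  qed
  have cfoot: "continuous_on (ball x0 (2 * \<rho>)) foot"
    by (rule continuous_on_subset[OF C1D(4)[OF fC] subset_UNIV])
  have img: "foot ` ball x0 (2 * \<rho>) \<subseteq> frontier \<Omega>" using ft by blast
  \<comment> \<open>Continuity is checked on two open sets that overlap in the shell between \<rho>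
    and 2 \<rho> and cover the space.\<close>
  have "continuous_on (ball x0 (2 * \<rho>) \<union> - cball x0 \<rho>) (\<lambda>y. G y v)" for v
  proof (rule continuous_on_open_Un)
    show "continuous_on (ball x0 (2 * \<rho>)) (\<lambda>y. G y v)"
      unfolding G_def
      by (intro continuous_intros continuous_on_compose2[OF cT cfoot img]
          continuous_on_compose2[OF Ck_boundary_1_continuous[OF f] cfoot img]
          continuous_on_subset[OF C1D(3)[OF fC] subset_UNIV] continuous_on_subset[OF C1D(3)[OF \<psi>(1)] subset_UNIV]
          continuous_on_subset[OF C1D(4)[OF \<psi>(1)] subset_UNIV])
    show "continuous_on (- cball x0 \<rho>) (\<lambda>y. G y v)"
      by (rule continuous_on_eq[OF continuous_on_const[of _ 0]]) (use G0 in auto)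
  qed (auto simp: open_Compl)
  moreover have "ball x0 (2 * \<rho>) \<union> - cball x0 \<rho> = UNIV" using \<rho> by auto
  ultimately have cG: "continuous_on UNIV (\<lambda>y. G y v)" for v by simp
  have C1: "Ck_on UNIV 1 (\<lambda>y. \<psi> y *\<^sub>R f (foot y))"
    unfolding One_nat_def by (rule Ck_on_SucI[OF open_UNIV der]) (simp add: cG)
  have fA: "\<bar>f (foot y)\<bar> \<le> A" if "y \<in> cball x0 \<rho>" for y
    using that \<rho> by (intro A(2) ft) auto
  have tA: "\<bar>tangential_derivative \<Omega> f (foot y) b\<bar> \<le> A" if "y \<in> cball x0 \<rho>" "b \<in> Basis" for y b
    using that \<rho> by (intro A(3) ft) auto
  have DM: "0 \<le> real DIM('a) * M * M * A" using M(1) A(1) by simp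
  have b1: "norm (\<psi> y *\<^sub>R f (foot y)) \<le> (M + real DIM('a) * M * M) * A" for y
  proof (cases "y \<in> cball x0 \<rho>")
    case True
    have "\<bar>\<psi> y\<bar> * \<bar>f (foot y)\<bar> \<le> M * A" using M(1,2) fA True by (intro mult_mono) auto
    then show ?thesis using DM by (simp add: abs_mult distrib_right)
  next
    case False
    then show ?thesis using \<psi>0 DM M(1) A(1) by (simp add: distrib_right)
  qed
  have b2: "norm (G y c) \<le> (M + real DIM('a) * M * M) * A" if c: "c \<in> Basis" for y c
  proof (cases "y \<in> cball x0 \<rho>")
    case True
    have "\<bar>\<Sum>b\<in>Basis. (Df foot y c \<bullet> b) * tangential_derivative \<Omega> f (foot y) b\<bar>
        \<le> (\<Sum>b\<in>(Basis::'a set). M * A)"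
    proof (rule order_trans[OF sum_abs sum_mono])
      fix b :: 'a assume b: "b \<in> Basis"
      have "\<bar>Df foot y c \<bullet> b\<bar> \<le> M"
        using Basis_le_norm[OF b] M(4)[OF True c] by (rule order_trans)
      then show "\<bar>(Df foot y c \<bullet> b) * tangential_derivative \<Omega> f (foot y) b\<bar> \<le> M * A"
        unfolding abs_mult using tA[OF True b] M(1) by (intro mult_mono) auto
    qed
    then have "\<bar>\<psi> y\<bar> * \<bar>\<Sum>b\<in>Basis. (Df foot y c \<bullet> b) * tangential_derivative \<Omega> f (foot y) b\<bar>
        \<le> M * (real DIM('a) * (M * A))"
      using M(1) M(2)[OF True] by (intro mult_mono) auto
    moreover have "\<bar>Df \<psi> y c\<bar> * \<bar>f (foot y)\<bar> \<le> M * A"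
      using M(1) M(3)[OF True c] fA[OF True] by (intro mult_mono) auto
    ultimately have "\<bar>G y c\<bar> \<le> M * (real DIM('a) * (M * A)) + M * A"
      unfolding G_def by (intro order_trans[OF abs_triangle_ineq] add_mono) (simp_all only: abs_mult)
    then show ?thesis by (simp add: algebra_simps)
  next
    case False
    then show ?thesis using G0 DM M(1) A(1) by (simp add: distrib_right)
  qed
  show ?thesis unfolding C1_bdd_def frechet_derivative_eq[OF der] using C1 b1 b2 by blast
qed

end

section \<open>Finite atlases of the boundary\<close>

text \<open>Charts are indexed by their centres. Cutoffs live within radius \<rho>, while projection
  to the boundary works up to 2 \<rho>; the gap leaves room for gluing. The cutoffs sum to 1 on the
  boundary, not in a neighbourhood of it.\<close>

locale boundary_atlas =
  fixes \<Omega> :: "'a::euclidean_space set" and k :: nat and I :: "'a set" and \<nu> :: "'a \<Rightarrow> 'a"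
    and \<gamma> :: "'a \<Rightarrow> 'a \<Rightarrow> real" and r \<rho> :: "'a \<Rightarrow> real" and \<psi> :: "'a \<Rightarrow> 'a \<Rightarrow> real"
  assumes domain: "Ck_domain (Suc k) \<Omega>" and order: "1 \<le> k" and bounded_domain: "bounded \<Omega>"
    and finite_index: "finite I"
    and charts: "i \<in> I \<Longrightarrow> boundary_chart \<Omega> k i (\<nu> i) (\<gamma> i) (r i)"
    and radius: "i \<in> I \<Longrightarrow> 0 < \<rho> i" "i \<in> I \<Longrightarrow> 2 * \<rho> i \<le> r i"
    and foot_in: "i \<in> I \<Longrightarrow> y \<in> ball i (2 * \<rho> i) \<Longrightarrow> boundary_chart.foot (\<nu> i) (\<gamma> i) y \<in> frontier \<Omega>"
    and cutoff: "i \<in> I \<Longrightarrow> Ck_on UNIV 2 (\<psi> i)" "i \<in> I \<Longrightarrow> y \<notin> cball i (\<rho> i) \<Longrightarrow> \<psi> i y = 0"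
    and partition: "y \<in> frontier \<Omega> \<Longrightarrow> (\<Sum>i\<in>I. \<psi> i y) = 1"

text \<open>Adding \<open>pos_cube (c - S)\<close> to the sum \<open>S\<close> of the bumps keeps the denominator positive everywhere
  and does not change it on the boundary, where \<open>S \<ge> c\<close>.\<close>

lemma boundary_atlas_exists:
  fixes \<Omega> :: "'a::euclidean_space set"
  assumes dom: "Ck_domain (Suc k) \<Omega>" and k: "1 \<le> k" and bd: "bounded \<Omega>"
  obtains I \<nu> \<gamma> r \<rho> \<psi> where "boundary_atlas \<Omega> k I \<nu> \<gamma> r \<rho> \<psi>"
proof -
  \<comment> \<open>Bundles all data of a chart at \<open>x\<close>, so that one choice produces
    them together.\<close>
  define P where "P x q \<longleftrightarrow> (case q of (\<nu>, \<gamma>, r, \<rho>) \<Rightarrow> boundary_chart \<Omega> k x \<nu> \<gamma> r \<and> 0 < \<rho> \<and> 2 * \<rho> \<le> r \<and>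
      (\<forall>y\<in>ball x (2 * \<rho>). boundary_chart.foot \<nu> \<gamma> y \<in> frontier \<Omega>))" for x q
  have "\<forall>x\<in>frontier \<Omega>. \<exists>q. P x q"
  proof
    fix x assume x: "x \<in> frontier \<Omega>"
    obtain \<nu> \<gamma> r where c: "boundary_chart \<Omega> k x \<nu> \<gamma> r" using boundary_chart_exists[OF dom x] .
    obtain d where "0 < d" "d \<le> r" "\<And>y. y \<in> ball x d \<Longrightarrow> boundary_chart.foot \<nu> \<gamma> y \<in> frontier \<Omega>"
      using boundary_chart.foot_radius[OF c] by blast
    then have "P x (\<nu>, \<gamma>, r, d / 2)" using c by (simp add: P_def)
    then show "\<exists>q. P x q" ..
  qed
  then obtain Q where Q: "\<And>x. x \<in> frontier \<Omega> \<Longrightarrow> P x (Q x)" by metis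
  define \<nu> where "\<nu> x = fst (Q x)" for x
  define \<gamma> where "\<gamma> x = fst (snd (Q x))" for x
  define r where "r x = fst (snd (snd (Q x)))" for x
  define \<rho> where "\<rho> x = snd (snd (snd (Q x)))" for x
  have q: "boundary_chart \<Omega> k x (\<nu> x) (\<gamma> x) (r x)" "0 < \<rho> x" "2 * \<rho> x \<le> r x"
    "\<And>y. y \<in> ball x (2 * \<rho> x) \<Longrightarrow> boundary_chart.foot (\<nu> x) (\<gamma> x) y \<in> frontier \<Omega>" if "x \<in> frontier \<Omega>" for x
    using Q[OF that] by (auto simp: P_def \<nu>_def \<gamma>_def r_def \<rho>_def split: prod.splits)
  have cf: "compact (frontier \<Omega>)" by (rule compact_frontier_bounded[OF bd])
  have "frontier \<Omega> \<subseteq> (\<Union>x\<in>frontier \<Omega>. ball x (\<rho> x))" using q(2) by force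
  then obtain I where I: "I \<subseteq> frontier \<Omega>" "finite I" "frontier \<Omega> \<subseteq> (\<Union>x\<in>I. ball x (\<rho> x))"
    by (rule compactE_image[OF cf open_ball])
  \<comment> \<open>Positive exactly in \<open>ball i (\<rho> i)\<close> for i in \<open>I\<close>;
    the squared distance keeps it C^2 at the centre.\<close>
  define b where "b i y = pos_cube ((\<rho> i)\<^sup>2 - (y - i) \<bullet> (y - i))" for i y :: 'a
  have bC: "Ck_on UNIV 2 (b i)" for i unfolding b_def[abs_def]
    by (intro Ck_on_compose[OF open_UNIV open_UNIV subset_UNIV _ Ck_on_pos_cube] Ck_on_diff Ck_on_inner open_UNIV
        Ck_on_const Ck_on_bounded_linear[OF open_UNIV bounded_linear_ident])
  have sq: "(y - i) \<bullet> (y - i) < (\<rho> i)\<^sup>2 \<longleftrightarrow> y \<in> ball i (\<rho> i)" if "i \<in> I" for i y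
  proof -
    have "0 \<le> \<rho> i" using q(2)[of i] that I(1) by force
    then have "(norm (y - i))\<^sup>2 < (\<rho> i)\<^sup>2 \<longleftrightarrow> norm (y - i) < \<rho> i"
      by (simp add: not_le[symmetric] power_mono_iff)
    then show ?thesis by (simp add: power2_norm_eq_inner[symmetric] dist_norm norm_minus_commute[of i y])
  qed
  have bpos: "0 < b i y \<longleftrightarrow> y \<in> ball i (\<rho> i)" if "i \<in> I" for i y
    using sq[OF that] by (simp add: b_def pos_cube_pos_iff)
  have b0: "0 \<le> b i y" for i y by (simp add: b_def)
  define S where "S y = (\<Sum>i\<in>I. b i y)" for y
  have SC: "Ck_on UNIV 2 S" unfolding S_def[abs_def] by (intro Ck_on_sum open_UNIV bC)
  have S0: "0 \<le> S y" for y unfolding S_def by (intro sum_nonneg b0)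
  have Spos: "0 < S y" if y: "y \<in> frontier \<Omega>" for y
  proof -
    obtain i where i: "i \<in> I" "y \<in> ball i (\<rho> i)" using I(3) y by blast
    have "b i y \<le> S y" unfolding S_def by (rule member_le_sum[OF i(1)]) (simp_all add: b0 I(2))
    then show ?thesis using bpos[OF i(1)] i(2) by force
  qed
  \<comment> \<open>The minimum of \<open>S\<close> on the compact boundary, or 1 if the boundary is
    empty.\<close>
  obtain c where c: "0 < c" "\<And>y. y \<in> frontier \<Omega> \<Longrightarrow> c \<le> S y"
  proof (cases "frontier \<Omega> = {}")
    case True
    then show ?thesis using that[of 1] by simp
  next
    case False
    obtain z where "z \<in> frontier \<Omega>" "\<forall>y\<in>frontier \<Omega>. S z \<le> S y"
      using continuous_attains_inf[OF cf False continuous_on_subset[OF Ck_on_continuous[OF SC] subset_UNIV]] by blast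
    then show ?thesis using that[of "S z"] Spos by blast
  qed
  define W where "W y = S y + pos_cube (c - S y)" for y
  have WC: "Ck_on UNIV 2 W" unfolding W_def[abs_def]
    by (intro Ck_on_add SC open_UNIV Ck_on_compose[OF open_UNIV open_UNIV subset_UNIV _ Ck_on_pos_cube] Ck_on_diff Ck_on_const)
  have Wpos: "0 < W y" for y
    using S0[of y] pos_cube_pos_iff[of "c - S y"] pos_cube_nonneg[of "c - S y"] c(1) unfolding W_def by linarith
  \<comment> \<open>Division written as a power for \<open>Ck_on_powr_compose\<close>.\<close>
  define \<psi> where "\<psi> i y = b i y * W y powr (-1)" for i y
  have "boundary_atlas \<Omega> k I \<nu> \<gamma> r \<rho> \<psi>"
  proof (rule boundary_atlas.intro)
    show "Ck_domain (Suc k) \<Omega>" "1 \<le> k" "bounded \<Omega>" "finite I" by (fact dom k bd I(2))+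
    fix i assume i: "i \<in> I"
    then have fi: "i \<in> frontier \<Omega>" using I(1) by blast
    show "boundary_chart \<Omega> k i (\<nu> i) (\<gamma> i) (r i)" "0 < \<rho> i" "2 * \<rho> i \<le> r i" using q[OF fi] by auto
    show "boundary_chart.foot (\<nu> i) (\<gamma> i) y \<in> frontier \<Omega>" if "y \<in> ball i (2 * \<rho> i)" for y
      by (rule q(4)[OF fi that])
    show "Ck_on UNIV 2 (\<psi> i)" unfolding \<psi>_def[abs_def]
      by (intro Ck_on_mult open_UNIV bC Ck_on_powr_compose WC Wpos)
    show "\<psi> i y = 0" if "y \<notin> cball i (\<rho> i)" for y
    proof -
      have "\<not> 0 < b i y" using that bpos[OF i] by auto
      then show ?thesis using b0[of i y] by (simp add: \<psi>_def)
    qed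
  next
    fix y assume y: "y \<in> frontier \<Omega>"
    have "W y = S y" using c(2)[OF y] by (simp add: W_def pos_cube_eq_0_iff)
    moreover have "(\<Sum>i\<in>I. \<psi> i y) = S y * W y powr (-1)"
      by (simp only: \<psi>_def S_def sum_distrib_right[symmetric])
    ultimately have "(\<Sum>i\<in>I. \<psi> i y) = S y * S y powr (-1)" by simp
    then show "(\<Sum>i\<in>I. \<psi> i y) = 1" using Spos[OF y] by (simp add: powr_minus)
  qed
  then show ?thesis by (rule that)
qed

lemma apply_W1inf_sum: "apply_W1inf (\<Sum>i\<in>I. \<theta> i) x = (\<Sum>i\<in>I. apply_W1inf (\<theta> i) x)"
  by (induction I rule: infinite_finite_induct) (simp_all add: zero_W1inf.rep_eq plus_W1inf.rep_eq)

context boundary_atlas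
begin

text \<open>A compactly supported extension of the exterior normal; it need not have unit length off
  the boundary.\<close>

definition N :: "'a \<Rightarrow> 'a" where "N y = (\<Sum>i\<in>I. \<psi> i y *\<^sub>R boundary_chart.normal (\<nu> i) (\<gamma> i) y)"
text \<open>A linear extension operator: local extensions, constant along the vertical direction of
  each chart, are glued by the cutoffs.\<close>

definition ext :: "('a \<Rightarrow> real) \<Rightarrow> 'a \<Rightarrow> real"
  where "ext f y = (\<Sum>i\<in>I. \<psi> i y *\<^sub>R f (boundary_chart.foot (\<nu> i) (\<gamma> i) y))"
definition support :: "'a set" where "support = (\<Union>i\<in>I. cball i (\<rho> i))"
abbreviation field where "field f \<equiv> \<lambda>y. ext f y *\<^sub>R N y"
abbreviation foot_at where "foot_at i \<equiv> boundary_chart.foot (\<nu> i) (\<gamma> i)"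
text \<open>Equal to 1 on the boundary and of compact support, so it truncates fields without
  changing their traces.\<close>

definition cut :: "'a \<Rightarrow> real" where "cut y = (\<Sum>i\<in>I. \<psi> i y)"

lemma compact_support: "compact support"
  unfolding support_def by (intro compact_UN finite_index compact_cball)

lemma cutoff_support: "i \<in> I \<Longrightarrow> y \<notin> support \<Longrightarrow> \<psi> i y = 0"
  using cutoff(2) unfolding support_def by blast

lemma cutoff_C1: "i \<in> I \<Longrightarrow> Ck_on UNIV 1 (\<psi> i)"
  using C2_derivative(2) cutoff(1) by blast

lemma off_support: "y \<notin> support \<Longrightarrow> N y = 0" "y \<notin> support \<Longrightarrow> ext f y = 0" "y \<notin> support \<Longrightarrow> cut y = 0"
  unfolding N_def ext_def cut_def using cutoff_support by (simp_all add: sum.neutral)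

lemma cutoff_ball: "i \<in> I \<Longrightarrow> \<psi> i y \<noteq> 0 \<Longrightarrow> y \<in> ball i (2 * \<rho> i) \<and> y \<in> ball i (r i)"
  using cutoff(2)[of i y] radius[of i] by fastforce

lemma N_Ck: assumes "j \<le> k" "j \<le> 2" shows "Ck_on UNIV j N"
  unfolding N_def[abs_def]
proof (intro Ck_on_sum Ck_on_scaleR open_UNIV)
  fix i assume i: "i \<in> I"
  show "Ck_on UNIV j (\<psi> i)" by (rule Ck_on_mono[OF cutoff(1)[OF i] assms(2)])
  show "Ck_on UNIV j (boundary_chart.normal (\<nu> i) (\<gamma> i))"
    by (rule Ck_on_mono[OF boundary_chart.normal_Ck[OF charts[OF i]] assms(1)])
qed

lemma N_C1: "Ck_on UNIV 1 N" using order by (intro N_Ck) auto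

lemma cut_C2: "Ck_on UNIV 2 cut"
  unfolding cut_def[abs_def] by (intro Ck_on_sum open_UNIV cutoff)

lemma cut_eq_1: "y \<in> frontier \<Omega> \<Longrightarrow> cut y = 1" unfolding cut_def by (rule partition)

lemma N_eq: assumes y: "y \<in> frontier \<Omega>" shows "N y = exterior_normal \<Omega> y"
proof -
  have "\<psi> i y *\<^sub>R boundary_chart.normal (\<nu> i) (\<gamma> i) y = \<psi> i y *\<^sub>R exterior_normal \<Omega> y" if i: "i \<in> I" for i
    using cutoff_ball[OF i] boundary_chart.exterior_normal_eq[OF charts[OF i] _ y] by (cases "\<psi> i y = 0") auto
  then have "N y = (\<Sum>i\<in>I. \<psi> i y *\<^sub>R exterior_normal \<Omega> y)" unfolding N_def by (rule sum.cong[OF refl])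
  then show ?thesis by (simp only: scaleR_sum_left[symmetric] partition[OF y] scaleR_one)
qed

lemma ext_eq: assumes y: "y \<in> frontier \<Omega>" shows "ext f y = f y"
proof -
  have "\<psi> i y *\<^sub>R f (foot_at i y) = \<psi> i y *\<^sub>R f y" if i: "i \<in> I" for i
    using cutoff_ball[OF i] boundary_chart.foot_frontier[OF charts[OF i] _ y] by (cases "\<psi> i y = 0") auto
  then have "ext f y = (\<Sum>i\<in>I. \<psi> i y *\<^sub>R f y)" unfolding ext_def by (rule sum.cong[OF refl])
  then show ?thesis by (simp only: scaleR_sum_left[symmetric] partition[OF y] scaleR_one)
qed

text \<open>Where a cutoff is nonzero the foot lies on the boundary, so only boundary values of
  \<open>f\<close> are read. This makes the forms functions of boundary values.\<close>

lemma ext_cong: assumes "\<And>x. x \<in> frontier \<Omega> \<Longrightarrow> f x = g x" shows "ext f = ext g"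
proof
  fix y
  show "ext f y = ext g y" unfolding ext_def
  proof (rule sum.cong[OF refl])
    fix i assume i: "i \<in> I"
    show "\<psi> i y *\<^sub>R f (foot_at i y) = \<psi> i y *\<^sub>R g (foot_at i y)"
      using cutoff_ball[OF i] foot_in[OF i, of y] assms by (cases "\<psi> i y = 0") auto
  qed
qed

lemma ext_add: "ext (\<lambda>x. f x + g x) y = ext f y + ext g y"
  by (simp add: ext_def distrib_left sum.distrib)

lemma ext_mult: "ext (\<lambda>x. c * f x) y = c * ext f y"
  by (simp add: ext_def sum_distrib_left algebra_simps)

text \<open>The chart constants of \<open>vertical_extension\<close> and the bound of
  \<open>N\<close> are independent of \<open>f\<close>. The empty boundary is set apart because the
  supremum of the empty set has no useful value.\<close>

lemma ext_field_bdd: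
  "\<exists>K\<ge>0. \<forall>f. frontier \<Omega> \<noteq> {} \<longrightarrow> Ck_boundary 1 \<Omega> f \<longrightarrow>
    C1_bdd (field f) (K * Ck_boundary_norm 1 \<Omega> f)"
proof -
  have "\<exists>M. \<forall>f::'a \<Rightarrow> real. frontier \<Omega> \<noteq> {} \<longrightarrow> Ck_boundary 1 \<Omega> f \<longrightarrow>
      C1_bdd (\<lambda>y. \<psi> i y *\<^sub>R f (foot_at i y)) (M * Ck_boundary_norm 1 \<Omega> f)" if i: "i \<in> I" for i
  proof -
    interpret boundary_chart \<Omega> k i "\<nu> i" "\<gamma> i" "r i" by (rule charts[OF i])
    obtain M1 where M1: "0 < M1" "\<And>y. y \<in> cball i (\<rho> i) \<Longrightarrow> norm (\<psi> i y) \<le> M1"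
      "\<And>y b. y \<in> cball i (\<rho> i) \<Longrightarrow> b \<in> Basis \<Longrightarrow> norm (Df (\<psi> i) y b) \<le> M1"
      using C1_bounded_on_compact[OF cutoff_C1[OF i] compact_cball[of i "\<rho> i"]] by blast
    have fC: "Ck_on UNIV 1 foot" using Ck_on_mono[OF foot_Ck, of 1] by simp
    obtain M2 where M2: "0 < M2" "\<And>y. y \<in> cball i (\<rho> i) \<Longrightarrow> norm (foot y) \<le> M2"
      "\<And>y b. y \<in> cball i (\<rho> i) \<Longrightarrow> b \<in> Basis \<Longrightarrow> norm (Df foot y b) \<le> M2"
      using C1_bounded_on_compact[OF fC compact_cball[of i "\<rho> i"]] by blast
    define M where "M = max M1 M2"
    have M: "0 < M" "M1 \<le> M" "M2 \<le> M" using M1(1) by (auto simp: M_def)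
    show ?thesis
    proof (intro exI[of _ "M + real DIM('a) * M * M"] allI impI)
      fix f :: "'a \<Rightarrow> real" assume "frontier \<Omega> \<noteq> {}" and f: "Ck_boundary 1 \<Omega> f"
      then obtain z where z: "z \<in> frontier \<Omega>" by blast
      note g = Ck_boundary_norm_1_ge[OF bounded_domain f]
      show "C1_bdd (\<lambda>y. \<psi> i y *\<^sub>R f (foot y)) ((M + real DIM('a) * M * M) * Ck_boundary_norm 1 \<Omega> f)"
      proof (rule vertical_extension[OF radius(1)[OF i] foot_in[OF i] cutoff_C1[OF i] cutoff(2)[OF i] domain M(1) _ _ _ f])
        show "\<bar>\<psi> i y\<bar> \<le> M" if "y \<in> cball i (\<rho> i)" for y using M1(2)[OF that] M by simp
        show "\<bar>Df (\<psi> i) y b\<bar> \<le> M" if "y \<in> cball i (\<rho> i)" "b \<in> Basis" for y b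
          using M1(3)[OF that] M by simp
        show "norm (Df foot y b) \<le> M" if "y \<in> cball i (\<rho> i)" "b \<in> Basis" for y b
          using M2(3)[OF that] M by simp
        show "0 \<le> Ck_boundary_norm 1 \<Omega> f" by (rule g(4)[OF z])
        show "\<bar>f x\<bar> \<le> Ck_boundary_norm 1 \<Omega> f" if "x \<in> frontier \<Omega>" for x using g(1)[OF that] by simp
        show "\<bar>tangential_derivative \<Omega> f x b\<bar> \<le> Ck_boundary_norm 1 \<Omega> f" if "x \<in> frontier \<Omega>" "b \<in> Basis" for x b
          using g(2)[OF that] by simp
      qed
    qed
  qed
  then have "\<forall>i\<in>I. \<exists>M. \<forall>f::'a \<Rightarrow> real. frontier \<Omega> \<noteq> {} \<longrightarrow> Ck_boundary 1 \<Omega> f \<longrightarrow>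
      C1_bdd (\<lambda>y. \<psi> i y *\<^sub>R f (foot_at i y)) (M * Ck_boundary_norm 1 \<Omega> f)" by blast
  from bchoice[OF this] obtain M where M: "\<And>i (f::'a \<Rightarrow> real). i \<in> I \<Longrightarrow> frontier \<Omega> \<noteq> {} \<Longrightarrow> Ck_boundary 1 \<Omega> f \<Longrightarrow>
      C1_bdd (\<lambda>y. \<psi> i y *\<^sub>R f (foot_at i y)) (M i * Ck_boundary_norm 1 \<Omega> f)" by blast
  obtain B where B: "C1_bdd N B" using C1_bdd_compact_support[OF N_C1 compact_support off_support(1)] .
  define K where "K = 2 * (\<Sum>i\<in>I. M i) * B"
  have main: "C1_bdd (field f) (K * Ck_boundary_norm 1 \<Omega> f)" if f: "frontier \<Omega> \<noteq> {}" "Ck_boundary 1 \<Omega> f" for f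
  proof -
    have "C1_bdd (ext f) (\<Sum>i\<in>I. M i * Ck_boundary_norm 1 \<Omega> f)"
      unfolding ext_def[abs_def] by (rule C1_bdd_sum) (rule M[OF _ f])
    moreover have "2 * (\<Sum>i\<in>I. M i * n) * B = K * n" for n
      by (simp add: K_def sum_distrib_right[symmetric])
    ultimately show ?thesis using C1_bdd_scaleR[OF _ B] by metis
  qed
  \<comment> \<open>Passing to the absolute value gives a nonnegative constant, since the boundary
    norm is nonnegative.\<close>
  have "C1_bdd (field f) (\<bar>K\<bar> * Ck_boundary_norm 1 \<Omega> f)" if f: "frontier \<Omega> \<noteq> {}" "Ck_boundary 1 \<Omega> f" for f
  proof -
    obtain z where z: "z \<in> frontier \<Omega>" using f(1) by blast
    show ?thesis
      by (rule C1_bdd_mono[OF main[OF f]])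
        (intro mult_right_mono Ck_boundary_norm_1_ge(4)[OF bounded_domain f(2) z]; simp)
  qed
  then show ?thesis using abs_ge_zero by blast
qed

lemma ext_field_W1inf:
  assumes "Ck_boundary 1 \<Omega> f"
  shows "apply_W1inf (W1inf (field f)) = (field f)"
    "Ck_on UNIV 1 (field f)"
proof -
  have "\<exists>B. C1_bdd (field f) B"
  proof (cases "frontier \<Omega> = {}")
    case True
    have "ext f = ext (\<lambda>x. 0)" by (rule ext_cong) (simp add: True)
    then show ?thesis using C1_bdd_zero by (auto simp: ext_def)
  next
    case False
    then show ?thesis using ext_field_bdd assms by blast
  qed
  then obtain B where B: "C1_bdd (field f) B" ..
  show "apply_W1inf (W1inf (field f)) = (field f)" by (rule C1_bdd_W1inf(1)[OF B])
  show "Ck_on UNIV 1 (field f)" using B by (simp add: C1_bdd_def)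
qed

section \<open>Derivatives along tangential fields\<close>

text \<open>In the chart the displacement is \<psi> times the horizontal part of \<open>V\<close>.
  Tangency, \<open>grad y \<bullet> V y = 0\<close>, says that the derivative of \<gamma> along
  \<open>base (V y)\<close> equals \<open>V y \<bullet> \<nu> i\<close>, so the vertical correction
  restores exactly \<psi> V as initial velocity on the boundary.\<close>

lemma tangential_field_paths:
  assumes V: "Ck_on UNIV 1 V" "\<And>x. x \<in> frontier \<Omega> \<Longrightarrow> V x \<bullet> exterior_normal \<Omega> x = 0" and i: "i \<in> I"
  shows "\<exists>\<phi> \<phi>' \<delta>. invariant_path \<Omega> (cball i (\<rho> i)) \<phi> \<phi>' \<delta> \<and> (\<forall>y\<in>frontier \<Omega>. \<phi>' 0 y = \<psi> i y *\<^sub>R V y)"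
proof -
  interpret boundary_chart \<Omega> k i "\<nu> i" "\<gamma> i" "r i" by (rule charts[OF i])
  define U where "U y = \<psi> i y *\<^sub>R base (V y)" for y
  have U1: "Ck_on UNIV 1 U" unfolding U_def[abs_def]
    by (intro Ck_on_scaleR open_UNIV cutoff_C1[OF i]
        Ck_on_compose[OF open_UNIV open_UNIV subset_UNIV V(1) Ck_on_bounded_linear[OF open_UNIV base_linear]])
  have U2: "U y \<bullet> \<nu> i = 0" for y by (simp add: U_def base_def inner_diff_left unit_inner)
  have U3: "U y = 0" if "y \<notin> cball i (\<rho> i)" for y using cutoff(2)[OF i that] by (simp add: U_def)
  have g: "Ck_on UNIV 2 (\<gamma> i)" using Ck_on_mono[OF graph, of 2] order by simp
  have rr: "\<rho> i < r i" using radius[OF i] by simp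
  have e: "U y + Df (\<gamma> i) (y - (y \<bullet> \<nu> i) *\<^sub>R \<nu> i) (U y) *\<^sub>R \<nu> i = \<psi> i y *\<^sub>R V y" if y: "y \<in> frontier \<Omega>" for y
  proof (cases "\<psi> i y = 0")
    case True then show ?thesis
      using linear_0[OF C1D(2)[OF graph_C1 UNIV_I]] by (simp add: U_def)
  next
    case False
    then have yb: "y \<in> ball i (r i)" using cutoff_ball[OF i] by blast
    have "V y \<bullet> normal y = 0" using V(2)[OF y] exterior_normal_eq[OF yb y] by simp
    then have "grad y \<bullet> V y = 0" by (subst grad_eq) (simp add: inner_commute)
    then have "Df (\<gamma> i) (base y) (base (V y)) = V y \<bullet> \<nu> i" using grad_inner[of y "V y"] by simp
    then have "Df (\<gamma> i) (base y) (U y) = \<psi> i y * (V y \<bullet> \<nu> i)"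
      unfolding U_def by (simp add: linear_cmul[OF C1D(2)[OF graph_C1 UNIV_I]])
    then have "U y + Df (\<gamma> i) (base y) (U y) *\<^sub>R \<nu> i = \<psi> i y *\<^sub>R (base (V y) + (V y \<bullet> \<nu> i) *\<^sub>R \<nu> i)"
      by (simp add: U_def scaleR_add_right)
    then show ?thesis by (simp add: base_def)
  qed
  obtain \<phi> \<phi>' \<delta> where P: "invariant_path \<Omega> (cball i (\<rho> i)) \<phi> \<phi>' \<delta>"
    "\<forall>y. \<phi>' 0 y = U y + Df (\<gamma> i) (y - (y \<bullet> \<nu> i) *\<^sub>R \<nu> i) (U y) *\<^sub>R \<nu> i"
    using chart_invariant_path[OF unit g radius(1)[OF i] rr chart U1 U2 U3] by blast
  then show ?thesis using e by (intro exI[of _ \<phi>] exI[of _ \<phi>'] exI[of _ \<delta>]) simp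
qed

text \<open>The chart velocities sum to \<open>V\<close> on the boundary by the partition of unity;
  off it they may differ, which the trace lemmas ignore. Linearity then adds up the chart
  results.\<close>

lemma derivative_tangential:
  assumes J: "shape_functional J \<Omega> differentiable (at 0)" and V: "C1W V"
    "\<And>x. x \<in> frontier \<Omega> \<Longrightarrow> apply_W1inf V x \<bullet> exterior_normal \<Omega> x = 0"
  shows "Df (shape_functional J \<Omega>) 0 V = 0"
    and "twice_differentiable_at (shape_functional J \<Omega>) 0 \<Longrightarrow> Ck_on UNIV 2 \<zeta> \<Longrightarrow> compact L \<Longrightarrow> (\<And>x. x \<notin> L \<Longrightarrow> \<zeta> x = 0) \<Longrightarrow>
      D2f (shape_functional J \<Omega>) 0 V (W1inf \<zeta>) =
      - Df (shape_functional J \<Omega>) 0 (W1inf (\<lambda>x. Df \<zeta> x (apply_W1inf V x)))"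
proof -
  let ?J = "shape_functional J \<Omega>"
  let ?D = "Df ?J 0"
  have lin: "linear ?D" using J by (metis frechet_derivative_works has_derivative_linear)
  have "\<forall>i\<in>I. \<exists>q. case q of (\<phi>, \<phi>', \<delta>) \<Rightarrow> invariant_path \<Omega> (cball i (\<rho> i)) \<phi> \<phi>' \<delta> \<and> (\<forall>y\<in>frontier \<Omega>. \<phi>' 0 y = \<psi> i y *\<^sub>R apply_W1inf V y)"
    using tangential_field_paths[OF V] by auto
  from bchoice[OF this] obtain Q where Q: "\<forall>i\<in>I. case Q i of (\<phi>, \<phi>', \<delta>) \<Rightarrow> invariant_path \<Omega> (cball i (\<rho> i)) \<phi> \<phi>' \<delta> \<and> (\<forall>y\<in>frontier \<Omega>. \<phi>' 0 y = \<psi> i y *\<^sub>R apply_W1inf V y)" ..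
  define \<phi> \<phi>' \<delta> where "\<phi> i = fst (Q i)" and "\<phi>' i = fst (snd (Q i))" and "\<delta> i = snd (snd (Q i))" for i
  have P: "C1_path (\<phi> i) (\<phi>' i)" "\<And>t x. x \<notin> cball i (\<rho> i) \<Longrightarrow> \<phi> i t x = x" "\<And>x. \<phi> i 0 x = x"
    "0 < \<delta> i" "\<And>t. \<bar>t\<bar> < \<delta> i \<Longrightarrow> \<phi> i t ` \<Omega> = \<Omega>" "\<And>y. y \<in> frontier \<Omega> \<Longrightarrow> \<phi>' i 0 y = \<psi> i y *\<^sub>R apply_W1inf V y"
    if "i \<in> I" for i
    using bspec[OF Q that] by (auto simp: \<phi>_def \<phi>'_def \<delta>_def split: prod.splits)
  have P0: "\<phi> i t x = \<phi> i 0 x" if "i \<in> I" "x \<notin> cball i (\<rho> i)" for i t x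
    using P(2)[OF that, of t] P(3)[OF that(1), of x] by simp
  have ap: "apply_W1inf (W1inf (\<phi>' i 0)) = \<phi>' i 0" "Ck_on UNIV 1 (\<phi>' i 0)" if i: "i \<in> I" for i
  proof -
    obtain B where "C1_bdd (\<phi>' i 0) B" using C1_path_W1inf(1)[OF P(1)[OF i] compact_cball P0[OF i]] by blast
    then show "apply_W1inf (W1inf (\<phi>' i 0)) = \<phi>' i 0" "Ck_on UNIV 1 (\<phi>' i 0)" using C1_bdd_W1inf(1) by (auto simp: C1_bdd_def)
  qed
  let ?W = "\<Sum>i\<in>I. W1inf (\<phi>' i 0)"
  have aW: "apply_W1inf ?W = (\<lambda>x. \<Sum>i\<in>I. \<phi>' i 0 x)" by (rule HOL.ext) (simp add: apply_W1inf_sum ap)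
  have CW: "C1W ?W" unfolding aW by (intro Ck_on_sum open_UNIV ap)
  have eW: "apply_W1inf V x = apply_W1inf ?W x" if "x \<in> frontier \<Omega>" for x
    by (simp add: aW P(6)[OF _ that] scaleR_sum_left[symmetric] partition[OF that])
  have "?D V = ?D ?W" by (rule shape_derivative_trace[OF bounded_domain J V(1) CW eW])
  also have "\<dots> = (\<Sum>i\<in>I. ?D (W1inf (\<phi>' i 0)))" by (rule linear_sum[OF lin])
  also have "\<dots> = 0"
    by (rule sum.neutral) (use invariant_path_derivative[OF J P(1) compact_cball P(2,3,4,5)] in blast)
  finally show "?D V = 0" .
  assume J2: "twice_differentiable_at ?J 0" and z: "Ck_on UNIV 2 \<zeta>" "compact L" "\<And>x. x \<notin> L \<Longrightarrow> \<zeta> x = 0"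
  let ?D2 = "D2f ?J 0"
  obtain B where zB: "C1_bdd \<zeta> B" using C1_bdd_compact_support[OF C2_derivative(2)[OF z(1)] z(2,3)] .
  have az: "apply_W1inf (W1inf \<zeta>) = \<zeta>" by (rule C1_bdd_W1inf(1)[OF zB])
  have Cz: "C1W (W1inf \<zeta>)" using C2_derivative(2)[OF z(1)] by (simp add: az)
  have DzC: "Ck_on UNIV 1 (\<lambda>x. Df \<zeta> x (v x))" if v: "Ck_on UNIV 1 v" for v
  proof -
    have "Df \<zeta> x (v x) = (\<Sum>b\<in>Basis. (v x \<bullet> b) *\<^sub>R Df \<zeta> x b)" for x
      by (rule linear_basis_expansion[OF C1D(2)[OF C2_derivative(2)[OF z(1)] UNIV_I]])
    then show ?thesis
      by (simp only:) (intro Ck_on_sum Ck_on_scaleR Ck_on_inner open_UNIV Ck_on_const v C2_derivative(1)[OF z(1)])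
  qed
  have aDz: "apply_W1inf (W1inf (\<lambda>x. Df \<zeta> x (v x))) = (\<lambda>x. Df \<zeta> x (v x))"
    if v: "Ck_on UNIV 1 v" for v
  proof -
    obtain B where "C1_bdd (\<lambda>x. Df \<zeta> x (v x)) B"
      by (rule C1_bdd_compact_support[OF DzC[OF v] z(2) frechet_derivative_zero_off[OF compact_imp_closed[OF z(2)] z(3)]])
    then show ?thesis by (rule C1_bdd_W1inf(1))
  qed
  \<comment> \<open>Agrees on the boundary with D\<zeta> V, since D\<zeta> is linear and the chart
    velocities add up to \<open>V\<close> there.\<close>
  let ?Z = "\<Sum>i\<in>I. W1inf (\<lambda>x. Df \<zeta> x (\<phi>' i 0 x))"
  have aZ: "apply_W1inf ?Z = (\<lambda>x. \<Sum>i\<in>I. Df \<zeta> x (\<phi>' i 0 x))"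
    by (rule HOL.ext) (simp add: apply_W1inf_sum aDz ap del: One_nat_def)
  have CZ: "C1W ?Z" unfolding aZ by (intro Ck_on_sum open_UNIV DzC ap)
  have D2sum: "?D2 (\<Sum>i\<in>A. \<theta> i) \<eta> = (\<Sum>i\<in>A. ?D2 (\<theta> i) \<eta>)" for A and \<theta> :: "'a \<Rightarrow> ('a, 'a) W1inf" and \<eta>
  proof -
    have "linear (\<lambda>h. ?D2 h \<eta>)"
      using second_frechet_derivative_linear(1,2)[OF J2] by (intro linearI) auto
    then show ?thesis by (rule linear_sum)
  qed
  have "?D2 V (W1inf \<zeta>) = ?D2 ?W (W1inf \<zeta>)"
    by (rule shape_second_derivative_trace[OF bounded_domain J2 V(1) CW Cz Cz eW refl])
  also have "\<dots> = (\<Sum>i\<in>I. ?D2 (W1inf (\<phi>' i 0)) (W1inf \<zeta>))" by (rule D2sum)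
  also have "\<dots> = (\<Sum>i\<in>I. - ?D (W1inf (\<lambda>x. Df \<zeta> x (\<phi>' i 0 x))))"
    by (rule sum.cong[OF refl]) (use invariant_path_second_derivative[OF J2 P(1) compact_cball P(2,3,4,5) z] in blast)
  also have "\<dots> = - ?D ?Z" by (simp add: sum_negf linear_sum[OF lin])
  also have "?D ?Z = ?D (W1inf (\<lambda>x. Df \<zeta> x (apply_W1inf V x)))"
  proof (rule shape_derivative_trace[OF bounded_domain J CZ])
    show "C1W (W1inf (\<lambda>x. Df \<zeta> x (apply_W1inf V x)))" by (simp only: aDz[OF V(1)] DzC[OF V(1)])
    fix x assume x: "x \<in> frontier \<Omega>"
    have "(\<Sum>i\<in>I. Df \<zeta> x (\<phi>' i 0 x)) = Df \<zeta> x (\<Sum>i\<in>I. \<phi>' i 0 x)"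
      by (rule linear_sum[OF C1D(2)[OF C2_derivative(2)[OF z(1)] UNIV_I], symmetric])
    then show "apply_W1inf ?Z x = apply_W1inf (W1inf (\<lambda>x. Df \<zeta> x (apply_W1inf V x))) x"
      using eW[OF x] by (simp add: aZ aDz[OF V(1)] aW)
  qed
  finally show "?D2 V (W1inf \<zeta>) = - ?D (W1inf (\<lambda>x. Df \<zeta> x (apply_W1inf V x)))" .
qed

end

section \<open>Structure of the shape derivatives\<close>

text \<open>Named so that it can be compared, pointwise on the boundary, with other arguments of
  \<open>l1\<close>.\<close>

definition curvature_term :: "'a::euclidean_space set \<Rightarrow> ('a \<Rightarrow> 'a) \<Rightarrow> ('a \<Rightarrow> 'a) \<Rightarrow> 'a \<Rightarrow> real"
  where "curvature_term \<Omega> \<xi> \<zeta> x = second_fundamental_form \<Omega> x (tangential_part \<Omega> \<zeta> x) (tangential_part \<Omega> \<xi> x)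
    - tangential_gradient \<Omega> (\<lambda>y. \<zeta> y \<bullet> exterior_normal \<Omega> y) x \<bullet> tangential_part \<Omega> \<xi> x
    - tangential_gradient \<Omega> (\<lambda>y. \<xi> y \<bullet> exterior_normal \<Omega> y) x \<bullet> tangential_part \<Omega> \<zeta> x"

context boundary_atlas
begin

lemma within_restrict:
  assumes g: "Ck_on UNIV 1 g" "\<And>x. x \<in> frontier \<Omega> \<Longrightarrow> f x = g x" and x: "x \<in> frontier \<Omega>"
  shows "(f has_derivative Df g x) (at x within frontier \<Omega>)"
  by (rule has_derivative_transform[OF x g(2) has_derivative_at_withinI[OF C1D(1)[OF g(1) UNIV_I]]])

lemma tangential_derivative_restrict:
  assumes g: "Ck_on UNIV 1 g" "\<And>x. x \<in> frontier \<Omega> \<Longrightarrow> f x = g x" and x: "x \<in> frontier \<Omega>"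
  shows "tangential_derivative \<Omega> f x v = Df g x (v - (v \<bullet> N x) *\<^sub>R N x)"
  unfolding N_eq[OF x] by (rule tangential_derivative_within(1)[OF domain x within_restrict[OF g x]])

lemma Ck_boundary_restrict:
  assumes g: "Ck_on UNIV 1 g" "\<And>x. x \<in> frontier \<Omega> \<Longrightarrow> f x = g x"
  shows "Ck_boundary 1 \<Omega> f"
  unfolding Ck_boundary_1
proof (intro conjI ballI allI)
  show "f differentiable (at x within frontier \<Omega>)" if "x \<in> frontier \<Omega>" for x
    using within_restrict[OF g that] by (rule differentiableI)
  fix v
  have cN: "continuous_on (frontier \<Omega>) N" by (rule continuous_on_subset[OF C1D(4)[OF N_C1] subset_UNIV])
  have "continuous_on (frontier \<Omega>) (\<lambda>x. Df g x (v - (v \<bullet> N x) *\<^sub>R N x))"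
    by (rule C1_blinfun_continuous[OF g(1) continuous_on_id subset_UNIV]) (intro continuous_intros cN)
  then show "continuous_on (frontier \<Omega>) (\<lambda>x. tangential_derivative \<Omega> f x v)"
    by (rule continuous_on_eq) (simp add: tangential_derivative_restrict[OF g])
qed

text \<open>\<open>g\<close> and the zero map are two C^1 extensions of the same boundary function,
  so their tangential derivatives coincide. This differentiates identities that hold on the boundary
  only.\<close>

lemma derivative_zero_on_boundary:
  assumes g: "Ck_on UNIV 1 g" "\<And>x. x \<in> frontier \<Omega> \<Longrightarrow> g x = 0" and x: "x \<in> frontier \<Omega>" "w \<bullet> N x = 0"
  shows "Df g x w = 0"
proof -
  have "Df g x (w - (w \<bullet> N x) *\<^sub>R N x) = tangential_derivative \<Omega> (\<lambda>_. 0) x w"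
    using tangential_derivative_restrict[OF g(1), of "\<lambda>_. 0" x w] g(2) x(1) by simp
  also have "\<dots> = Df (\<lambda>_. 0) x (w - (w \<bullet> N x) *\<^sub>R N x)"
    by (rule tangential_derivative_restrict[OF Ck_on_const refl x(1)])
  finally show ?thesis by (simp add: x(2) frechet_derivative_const)
qed

lemma N_unit: "x \<in> frontier \<Omega> \<Longrightarrow> N x \<bullet> N x = 1"
  using exterior_normal_unit(2)[OF domain] by (simp add: N_eq)

lemma W1inf_support:
  assumes "Ck_on UNIV 1 f" "\<And>y. y \<notin> support \<Longrightarrow> f y = 0"
  shows "apply_W1inf (W1inf f) = f"
proof -
  obtain B where "C1_bdd f B" by (rule C1_bdd_compact_support[OF assms(1) compact_support assms(2)])
  then show ?thesis by (rule C1_bdd_W1inf(1))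
qed

lemma ext_field_add:
  assumes "Ck_boundary 1 \<Omega> f" "Ck_boundary 1 \<Omega> g" "Ck_boundary 1 \<Omega> (\<lambda>x. f x + g x)"
  shows "W1inf (field (\<lambda>x. f x + g x)) = W1inf (field f) + W1inf (field g)"
  by (rule W1inf_eqI, simp only: plus_W1inf.rep_eq assms[THEN ext_field_W1inf(1)])
    (simp only: ext_add scaleR_add_left)

lemma ext_field_scale:
  assumes "Ck_boundary 1 \<Omega> f" "Ck_boundary 1 \<Omega> (\<lambda>x. c * f x)"
  shows "W1inf (field (\<lambda>x. c * f x)) = c *\<^sub>R W1inf (field f)"
  by (rule W1inf_eqI, simp only: scaleR_W1inf.rep_eq assms[THEN ext_field_W1inf(1)])
    (simp only: ext_mult scaleR_scaleR)

text \<open>On the boundary \<open>f\<close> is the inner product of \<open>field f\<close> with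
  \<open>N\<close>, because \<open>N\<close> is a unit vector there. This is a C^1 extension, and
  extensions can be added.\<close>

lemma Ck_boundary_1_add:
  fixes f g :: "'a \<Rightarrow> real"
  assumes "Ck_boundary 1 \<Omega> f" "Ck_boundary 1 \<Omega> g" shows "Ck_boundary 1 \<Omega> (\<lambda>x. f x + g x)"
proof (rule Ck_boundary_restrict)
  have e: "f x + g x = (ext f x *\<^sub>R N x) \<bullet> N x + (ext g x *\<^sub>R N x) \<bullet> N x" if "x \<in> frontier \<Omega>" for x
    by (simp add: ext_eq[OF that] N_unit[OF that])
  then show "f x + g x = (ext f x *\<^sub>R N x) \<bullet> N x + (ext g x *\<^sub>R N x) \<bullet> N x" if "x \<in> frontier \<Omega>" for x
    using that .
  show "Ck_on UNIV 1 (\<lambda>x. (ext f x *\<^sub>R N x) \<bullet> N x + (ext g x *\<^sub>R N x) \<bullet> N x)"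
    by (intro Ck_on_add Ck_on_inner open_UNIV ext_field_W1inf(2) assms N_C1)
qed

lemma Ck_boundary_1_mult:
  fixes f :: "'a \<Rightarrow> real"
  assumes "Ck_boundary 1 \<Omega> f" shows "Ck_boundary 1 \<Omega> (\<lambda>x. c * f x)"
proof (rule Ck_boundary_restrict)
  show "c * f x = c * ((ext f x *\<^sub>R N x) \<bullet> N x)" if "x \<in> frontier \<Omega>" for x
    by (simp add: ext_eq[OF that] N_unit[OF that])
  show "Ck_on UNIV 1 (\<lambda>x. c * ((ext f x *\<^sub>R N x) \<bullet> N x))"
    by (intro Ck_on_mult Ck_on_const Ck_on_inner open_UNIV ext_field_W1inf(2) assms N_C1)
qed

lemma ext_field_norm:
  "\<exists>K\<ge>0. \<forall>f. Ck_boundary 1 \<Omega> f \<longrightarrow> frontier \<Omega> \<noteq> {} \<longrightarrow>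
    norm (W1inf (field f)) \<le> K * Ck_boundary_norm 1 \<Omega> f"
proof -
  obtain K where K: "0 \<le> K" "\<And>f. frontier \<Omega> \<noteq> {} \<Longrightarrow> Ck_boundary 1 \<Omega> f \<Longrightarrow>
    C1_bdd (field f) (K * Ck_boundary_norm 1 \<Omega> f)" using ext_field_bdd by blast
  show ?thesis
  proof (intro exI[of _ "(real DIM('a) + 1) * K"] conjI allI impI)
    show "0 \<le> (real DIM('a) + 1) * K" using K(1) by simp
    fix f :: "'a \<Rightarrow> real" assume f: "Ck_boundary 1 \<Omega> f" "frontier \<Omega> \<noteq> {}"
    show "norm (W1inf (field f)) \<le> (real DIM('a) + 1) * K * Ck_boundary_norm 1 \<Omega> f"
      using C1_bdd_W1inf(2)[OF K(2)[OF f(2,1)]] by (simp only: mult.assoc)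
  qed
qed

lemma ext_field_empty:
  assumes "frontier \<Omega> = {}" shows "W1inf (field f) = 0"
proof -
  have "ext f = ext (\<lambda>x. 0)" by (rule ext_cong) (simp add: assms)
  then have z: "(field f) = (\<lambda>y. 0)" by (simp add: ext_def)
  show ?thesis unfolding z by (rule W1inf_eqI) (simp add: C1_bdd_W1inf(1)[OF C1_bdd_zero] zero_W1inf.rep_eq)
qed

text \<open>The formula is obtained for all C^1 fields, and dependence on boundary values alone is
  exported: both are used when \<open>l1\<close> meets the fields D\<zeta> V of the second-order
  formula, which are merely C^1.\<close>

lemma first_order_structure:
  assumes J: "shape_functional J \<Omega> differentiable (at 0)"
  obtains l1 where "continuous_linear_form 1 \<Omega> l1"
    "\<And>V. C1W V \<Longrightarrow> Df (shape_functional J \<Omega>) 0 V = l1 (\<lambda>x. apply_W1inf V x \<bullet> exterior_normal \<Omega> x)"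
    "\<And>f g. (\<And>x. x \<in> frontier \<Omega> \<Longrightarrow> f x = g x) \<Longrightarrow> l1 f = l1 g"
proof -
  let ?D = "Df (shape_functional J \<Omega>) 0"
  have hd: "(shape_functional J \<Omega> has_derivative ?D) (at 0)" using J by (simp add: frechet_derivative_works)
  note lin = has_derivative_linear[OF hd]
  define l1 where "l1 f = ?D (W1inf (field f))" for f
  have clf: "continuous_linear_form 1 \<Omega> l1"
    unfolding continuous_linear_form_def
  proof (intro conjI allI impI)
    show "l1 (\<lambda>x. f x + g x) = l1 f + l1 g" if "Ck_boundary 1 \<Omega> f" "Ck_boundary 1 \<Omega> g" for f g
      unfolding l1_def ext_field_add[OF that Ck_boundary_1_add[OF that]] by (rule linear_add[OF lin])
    show "l1 (\<lambda>x. c * f x) = c * l1 f" if "Ck_boundary 1 \<Omega> f" for c f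
      unfolding l1_def ext_field_scale[OF that Ck_boundary_1_mult[OF that]] by (simp add: linear_cmul[OF lin])
    show "\<exists>K. \<forall>f. Ck_boundary 1 \<Omega> f \<longrightarrow> \<bar>l1 f\<bar> \<le> K * Ck_boundary_norm 1 \<Omega> f"
    proof (cases "frontier \<Omega> = {}")
      case True
      then show ?thesis by (intro exI[of _ 0]) (simp add: l1_def ext_field_empty linear_0[OF lin])
    next
      case False
      obtain K where K: "0 \<le> K" "\<And>f. Ck_boundary 1 \<Omega> f \<Longrightarrow> norm (W1inf (field f)) \<le> K * Ck_boundary_norm 1 \<Omega> f"
        using ext_field_norm False by blast
      obtain C where C: "0 \<le> C" "\<And>\<theta>. norm (?D \<theta>) \<le> norm \<theta> * C"
        using bounded_linear.nonneg_bounded[OF has_derivative_bounded_linear[OF hd]] by blast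
      have "\<bar>l1 f\<bar> \<le> (K * C) * Ck_boundary_norm 1 \<Omega> f" if f: "Ck_boundary 1 \<Omega> f" for f
      proof -
        have "\<bar>l1 f\<bar> \<le> norm (W1inf (field f)) * C" using C(2) by (simp add: l1_def)
        also have "\<dots> \<le> (K * Ck_boundary_norm 1 \<Omega> f) * C" by (rule mult_right_mono[OF K(2)[OF f] C(1)])
        finally show ?thesis by (simp only: mult.assoc mult.commute[of C])
      qed
      then show ?thesis by blast
    qed
  qed
  have rep: "?D V = l1 (\<lambda>x. apply_W1inf V x \<bullet> exterior_normal \<Omega> x)" if V: "C1W V" for V
  proof -
    let ?f = "\<lambda>x. apply_W1inf V x \<bullet> exterior_normal \<Omega> x"
    \<comment> \<open>The extension of the normal component of \<open>V\<close>; subtracting it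
      leaves a field tangential on the boundary, on which the derivative vanishes.\<close>
    let ?W = "W1inf (field ?f)"
    have f: "Ck_boundary 1 \<Omega> ?f"
      by (rule Ck_boundary_restrict[OF Ck_on_inner[OF open_UNIV V N_C1]]) (simp add: N_eq)
    note W = ext_field_W1inf[OF f]
    have "apply_W1inf (V - ?W) = (\<lambda>x. apply_W1inf V x - ext ?f x *\<^sub>R N x)" by (simp add: minus_W1inf.rep_eq W(1))
    then have "C1W (V - ?W)" "\<And>x. x \<in> frontier \<Omega> \<Longrightarrow> apply_W1inf (V - ?W) x \<bullet> exterior_normal \<Omega> x = 0"
      using Ck_on_diff[OF open_UNIV V W(2)] by (simp_all add: inner_diff_left ext_eq N_eq exterior_normal_unit(2)[OF domain] del: Ck_on.simps One_nat_def)
    then have "?D (V - ?W) = 0" by (rule derivative_tangential(1)[OF J])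
    then show ?thesis by (simp add: linear_diff[OF lin] l1_def)
  qed
  show ?thesis
  proof (rule that[OF clf rep])
    fix f g :: "'a \<Rightarrow> real" assume "\<And>x. x \<in> frontier \<Omega> \<Longrightarrow> f x = g x"
    then show "l1 f = l1 g" unfolding l1_def by (simp only: ext_cong[of f g])
  qed
qed

lemma tangential_gradient_inner:
  assumes g: "Ck_on UNIV 1 g" "\<And>x. x \<in> frontier \<Omega> \<Longrightarrow> f x = g x" and x: "x \<in> frontier \<Omega>" "w \<bullet> N x = 0"
  shows "tangential_gradient \<Omega> f x \<bullet> w = Df g x w"
proof -
  have "linear (tangential_derivative \<Omega> f x)"
    by (rule has_derivative_linear[OF tangential_derivative_within(2)[OF domain x(1) within_restrict[OF g x(1)]]])
  from linear_basis_expansion[OF this, of w]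
  have "tangential_gradient \<Omega> f x \<bullet> w = tangential_derivative \<Omega> f x w"
    by (simp add: tangential_gradient_def inner_sum_right inner_commute mult.commute)
  then show ?thesis by (simp add: tangential_derivative_restrict[OF g x(1)] x(2))
qed

text \<open>\<open>l1\<close> enters through two properties instead of its construction, because it
  will come from a different atlas.\<close>

lemma second_order_structure:
  assumes J: "twice_differentiable_at (shape_functional J \<Omega>) 0" and k: "2 \<le> k"
    and l1: "\<And>V. C1W V \<Longrightarrow> Df (shape_functional J \<Omega>) 0 V = l1 (\<lambda>x. apply_W1inf V x \<bullet> exterior_normal \<Omega> x)"
      "\<And>f g. (\<And>x. x \<in> frontier \<Omega> \<Longrightarrow> f x = g x) \<Longrightarrow> l1 f = l1 g"
  obtains l2 where "continuous_symmetric_bilinear_form 2 \<Omega> l2"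
    "\<And>\<xi> \<zeta>. Ck_on UNIV 2 (apply_W1inf \<xi>) \<Longrightarrow> Ck_on UNIV 2 (apply_W1inf \<zeta>) \<Longrightarrow>
      D2f (shape_functional J \<Omega>) 0 \<xi> \<zeta> =
        l2 (\<lambda>x. apply_W1inf \<xi> x \<bullet> exterior_normal \<Omega> x) (\<lambda>x. apply_W1inf \<zeta> x \<bullet> exterior_normal \<Omega> x) +
        l1 (curvature_term \<Omega> (apply_W1inf \<xi>) (apply_W1inf \<zeta>))"
proof -
  let ?J = "shape_functional J \<Omega>"
  let ?D = "Df ?J 0" and ?D2 = "D2f ?J 0"
  note J1 = twice_differentiableD(1)[OF J]
  have lin: "linear ?D" using J1 by (metis frechet_derivative_works has_derivative_linear)
  note D2 = second_frechet_derivative_linear[OF J]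
  have sym: "?D2 h h' = ?D2 h' h" for h h' by (rule second_frechet_derivative_symmetric[OF J])
  let ?E = "\<lambda>f. W1inf (field f)"
  define l2 where "l2 f g = ?D2 (?E f) (?E g)" for f g
  have form: "continuous_symmetric_bilinear_form 2 \<Omega> l2"
    unfolding continuous_symmetric_bilinear_form_def
  proof (intro conjI allI impI)
    fix f g h :: "'a \<Rightarrow> real" assume f: "Ck_boundary 2 \<Omega> f" and g: "Ck_boundary 2 \<Omega> g"
    note c = f[THEN Ck_boundary_2_imp_1(1)] g[THEN Ck_boundary_2_imp_1(1)]
    show "l2 (\<lambda>x. f x + g x) h = l2 f h + l2 g h"
      unfolding l2_def ext_field_add[OF c Ck_boundary_1_add[OF c]] by (rule D2(1))
  next
    fix c :: real and f g :: "'a \<Rightarrow> real" assume "Ck_boundary 2 \<Omega> f"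
    then have f: "Ck_boundary 1 \<Omega> f" by (rule Ck_boundary_2_imp_1(1))
    show "l2 (\<lambda>x. c * f x) g = c * l2 f g"
      unfolding l2_def ext_field_scale[OF f Ck_boundary_1_mult[OF f]] by (simp add: D2(2))
  next
    show "l2 f g = l2 g f" for f g unfolding l2_def by (rule sym)
    show "\<exists>K. \<forall>f g. Ck_boundary 2 \<Omega> f \<longrightarrow> Ck_boundary 2 \<Omega> g \<longrightarrow>
       \<bar>l2 f g\<bar> \<le> K * Ck_boundary_norm 2 \<Omega> f * Ck_boundary_norm 2 \<Omega> g"
    proof (cases "frontier \<Omega> = {}")
      case True
      then have "l2 f g = 0" for f g using D2(2)[of 0 0] by (simp add: l2_def ext_field_empty)
      then show ?thesis by (intro exI[of _ 0]) simp
    next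
      case False
      then obtain z where z: "z \<in> frontier \<Omega>" by blast
      obtain K where K: "0 \<le> K" "\<And>f. Ck_boundary 1 \<Omega> f \<Longrightarrow> norm (?E f) \<le> K * Ck_boundary_norm 1 \<Omega> f"
        using ext_field_norm False by blast
      obtain C where C: "0 \<le> C" "\<And>h k. norm (?D2 h k) \<le> C * norm h * norm k" using D2(5) by blast
      \<comment> \<open>The extension is bounded in the C^1 norm, which the C^2 norm
        dominates.\<close>
      have E: "norm (?E f) \<le> K * Ck_boundary_norm 2 \<Omega> f" if f: "Ck_boundary 2 \<Omega> f" for f
        by (rule order_trans[OF K(2)[OF Ck_boundary_2_imp_1(1)[OF f]] mult_left_mono[OF Ck_boundary_norm_1_le_2[OF bounded_domain f z] K(1)]])
      have "\<bar>l2 f g\<bar> \<le> (C * K * K) * Ck_boundary_norm 2 \<Omega> f * Ck_boundary_norm 2 \<Omega> g"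
        if f: "Ck_boundary 2 \<Omega> f" and g: "Ck_boundary 2 \<Omega> g" for f g
      proof -
        have "\<bar>l2 f g\<bar> \<le> C * (norm (?E f) * norm (?E g))" using C(2) by (simp add: l2_def mult.assoc)
        also have "\<dots> \<le> C * ((K * Ck_boundary_norm 2 \<Omega> f) * (K * Ck_boundary_norm 2 \<Omega> g))"
          by (intro mult_left_mono[OF mult_mono[OF E[OF f] E[OF g]] C(1)] order_trans[OF norm_ge_zero E[OF f]] norm_ge_zero)
        finally show ?thesis by (simp only: ac_simps)
      qed
      then show ?thesis by blast
    qed
  qed
  \<comment> \<open>Here \<open>2 \<le> k\<close> enters: normal parts of C^2 fields are again
    C^2.\<close>
  have N2: "Ck_on UNIV 2 N" using k by (intro N_Ck) auto
  have C2f: "Ck_on UNIV 2 (\<lambda>y. cut y *\<^sub>R v y)" "Ck_on UNIV 2 (\<lambda>y. (v y \<bullet> N y) *\<^sub>R N y)" if v: "Ck_on UNIV 2 v" for v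
    by (intro Ck_on_scaleR Ck_on_inner open_UNIV cut_C2 v N2)+
  have main: "?D2 \<xi> \<zeta> = l2 (\<lambda>x. apply_W1inf \<xi> x \<bullet> exterior_normal \<Omega> x) (\<lambda>x. apply_W1inf \<zeta> x \<bullet> exterior_normal \<Omega> x) +
        l1 (curvature_term \<Omega> (apply_W1inf \<xi>) (apply_W1inf \<zeta>))"
    if smooth: "Ck_on UNIV 2 (apply_W1inf \<xi>)" "Ck_on UNIV 2 (apply_W1inf \<zeta>)" for \<xi> \<zeta>
  proof -
    define x where "x = apply_W1inf \<xi>"
    define z where "z = apply_W1inf \<zeta>"
    have x2: "Ck_on UNIV 2 x" and z2: "Ck_on UNIV 2 z" using smooth by (simp_all only: x_def z_def)
    \<comment> \<open>\<open>xc\<close> and \<open>zc\<close> keep the traces of the given fields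
      but have compact support, as the rule for tangential fields requires; \<open>X\<close> and
      \<open>Z\<close> are tangential on the boundary.\<close>
    define xc zc xn zn where "xc y = cut y *\<^sub>R x y" and "zc y = cut y *\<^sub>R z y"
      and "xn y = (x y \<bullet> N y) *\<^sub>R N y" and "zn y = (z y \<bullet> N y) *\<^sub>R N y" for y
    define X Z where "X y = xc y - xn y" and "Z y = zc y - zn y" for y
    have c2: "Ck_on UNIV 2 xc" "Ck_on UNIV 2 zc" "Ck_on UNIV 2 xn" "Ck_on UNIV 2 zn"
      unfolding xc_def[abs_def] zc_def[abs_def] xn_def[abs_def] zn_def[abs_def] by (intro C2f x2 z2)+
    have c2': "Ck_on UNIV 2 X" "Ck_on UNIV 2 Z"
      unfolding X_def[abs_def] Z_def[abs_def] by (intro Ck_on_diff open_UNIV c2)+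
    note c1 = c2[THEN C2_derivative(2)] c2'[THEN C2_derivative(2)]
    have off: "xc y = 0" "zc y = 0" "xn y = 0" "zn y = 0" "X y = 0" "Z y = 0" if "y \<notin> support" for y
      using off_support[OF that] by (simp_all add: xc_def zc_def xn_def zn_def X_def Z_def)
    have ap: "apply_W1inf (W1inf xc) = xc" "apply_W1inf (W1inf zc) = zc" "apply_W1inf (W1inf xn) = xn"
      "apply_W1inf (W1inf zn) = zn" "apply_W1inf (W1inf X) = X" "apply_W1inf (W1inf Z) = Z"
      by (rule W1inf_support, rule c1, rule off, assumption)+
    have C: "C1W \<xi>" "C1W \<zeta>" "C1W (W1inf xc)" "C1W (W1inf zc)" "C1W (W1inf xn)" "C1W (W1inf zn)"
      "C1W (W1inf X)" "C1W (W1inf Z)"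
      by (simp_all only: ap smooth[THEN C2_derivative(2)] c1)
    have on: "xc y = x y" "zc y = z y" if "y \<in> frontier \<Omega>" for y by (simp_all add: xc_def zc_def cut_eq_1[OF that])
    have tan: "X y \<bullet> N y = 0" "Z y \<bullet> N y = 0" if "y \<in> frontier \<Omega>" for y
      by (simp_all add: X_def Z_def xn_def zn_def on[OF that] inner_diff_left N_unit[OF that])
    have split: "W1inf xc = W1inf xn + W1inf X" "W1inf zc = W1inf zn + W1inf Z"
      by (rule W1inf_eqI; simp add: plus_W1inf.rep_eq ap X_def Z_def)+
    let ?A = "W1inf (\<lambda>y. Df xc y (Z y))" and ?B = "W1inf (\<lambda>y. Df zn y (X y))"
    have DvC: "Ck_on UNIV 1 (\<lambda>y. Df g y (w y))" if g: "Ck_on UNIV 2 g" and w: "Ck_on UNIV 1 w" for g w :: "'a \<Rightarrow> 'a"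
    proof -
      have "Df g y (w y) = (\<Sum>b\<in>Basis. (w y \<bullet> b) *\<^sub>R Df g y b)" for y
        by (rule linear_basis_expansion[OF C1D(2)[OF C2_derivative(2)[OF g] UNIV_I]])
      then show ?thesis
        by (simp only:) (intro Ck_on_sum Ck_on_scaleR Ck_on_inner open_UNIV Ck_on_const w C2_derivative(1)[OF g])
    qed
    have lD: "linear (Df g y)" if "Ck_on UNIV 1 g" for g :: "'a \<Rightarrow> 'a" and y
      by (rule C1D(2)[OF that UNIV_I])
    have aA: "apply_W1inf ?A = (\<lambda>y. Df xc y (Z y))"
      by (rule W1inf_support[OF DvC[OF c2(1) c1(6)]]) (simp add: off(6) linear_0[OF lD[OF c1(1)]])
    have aB: "apply_W1inf ?B = (\<lambda>y. Df zn y (X y))"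
      by (rule W1inf_support[OF DvC[OF c2(4) c1(5)]]) (simp add: off(5) linear_0[OF lD[OF c1(4)]])
    have "?D2 \<xi> \<zeta> = ?D2 (W1inf xc) (W1inf zc)"
      by (rule shape_second_derivative_trace[OF bounded_domain J C(1,3,2,4)]) (simp_all add: ap on x_def z_def)
    \<comment> \<open>Each mixed term gets a tangential field in the first slot and a compactly
      supported C^2 field in the second: (X, zn) and, after symmetry, (Z, xc).\<close>
    also have "\<dots> = ?D2 (W1inf xn) (W1inf zn) + ?D2 (W1inf X) (W1inf zn) + ?D2 (W1inf Z) (W1inf xc)"
      by (simp only: split(2) D2(3)) (simp only: split(1)[symmetric] sym[of "W1inf Z"], simp add: split(1) D2(1))
    also have "?D2 (W1inf X) (W1inf zn) = - ?D ?B"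
      using derivative_tangential(2)[OF J1 C(7) _ J c2(4) compact_support off(4)] tan(1) by (simp add: ap(5) N_eq)
    also have "?D2 (W1inf Z) (W1inf xc) = - ?D ?A"
      using derivative_tangential(2)[OF J1 C(8) _ J c2(1) compact_support off(1)] tan(2) by (simp add: ap(6) N_eq)
    also have "?D2 (W1inf xn) (W1inf zn) = l2 (\<lambda>y. x y \<bullet> exterior_normal \<Omega> y) (\<lambda>y. z y \<bullet> exterior_normal \<Omega> y)"
    proof -
      have f: "Ck_boundary 1 \<Omega> (\<lambda>y. v y \<bullet> exterior_normal \<Omega> y)" if "Ck_on UNIV 2 v" for v
        by (rule Ck_boundary_restrict[OF Ck_on_inner[OF open_UNIV C2_derivative(2)[OF that] N_C1]]) (simp add: N_eq)
      note E = ext_field_W1inf[OF f[OF x2]] ext_field_W1inf[OF f[OF z2]]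
      show ?thesis unfolding l2_def
        by (rule shape_second_derivative_trace[OF bounded_domain J C(5) _ C(6)])
          (simp_all only: E ap, simp_all add: xn_def zn_def ext_eq N_eq)
    qed
    \<comment> \<open>Both first-derivative terms are collected into one field, so that
      \<open>l1\<close> is applied once, to its normal component.\<close>
    also have "l2 (\<lambda>y. x y \<bullet> exterior_normal \<Omega> y) (\<lambda>y. z y \<bullet> exterior_normal \<Omega> y) + - ?D ?B + - ?D ?A =
        l2 (\<lambda>y. x y \<bullet> exterior_normal \<Omega> y) (\<lambda>y. z y \<bullet> exterior_normal \<Omega> y) + ?D (- (?A + ?B))"
      by (simp add: linear_neg[OF lin] linear_add[OF lin] linear_diff[OF lin])
    also have "?D (- (?A + ?B)) = l1 (\<lambda>y. apply_W1inf (- (?A + ?B)) y \<bullet> exterior_normal \<Omega> y)"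
    proof (rule l1(1))
      show "C1W (- (?A + ?B))"
        unfolding uminus_W1inf.rep_eq plus_W1inf.rep_eq aA aB
        by (intro Ck_on_minus Ck_on_add open_UNIV DvC c2 c1)
    qed
    also have "\<dots> = l1 (curvature_term \<Omega> x z)"
    proof (rule l1(2))
      fix y assume y: "y \<in> frontier \<Omega>"
      note nn = N_eq[OF y, symmetric]
      have tp: "tangential_part \<Omega> x y = X y" "tangential_part \<Omega> z y = Z y"
        by (simp_all add: tangential_part_def nn X_def Z_def xn_def zn_def on[OF y])
      let ?DN = "Df N y"
      have dN: "(N has_derivative ?DN) (at y)" by (rule C1D(1)[OF N_C1 UNIV_I])
      have B: "second_fundamental_form \<Omega> y (Z y) (X y) = ?DN (Z y) \<bullet> X y"
        using tangential_derivative_restrict[OF N_C1 N_eq[symmetric] y, of "Z y"]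
        by (simp add: second_fundamental_form_def tan(2)[OF y])
      have gr: "tangential_gradient \<Omega> (\<lambda>y. v y \<bullet> exterior_normal \<Omega> y) y \<bullet> w = Df (\<lambda>y. v y \<bullet> N y) y w"
        if v: "Ck_on UNIV 2 v" and w: "w \<bullet> N y = 0" for v w
        by (rule tangential_gradient_inner[OF Ck_on_inner[OF open_UNIV C2_derivative(2)[OF v] N_C1] _ y w]) (simp add: N_eq)
      \<comment> \<open>Derivative of \<open>N y \<bullet> N y = 1\<close> along the boundary: DN
        sends tangent vectors to tangent vectors.\<close>
      have NN: "?DN w \<bullet> N y = 0" if w: "w \<bullet> N y = 0" for w
      proof -
        have "Ck_on UNIV 1 (\<lambda>y. N y \<bullet> N y - 1)" by (intro Ck_on_diff Ck_on_inner open_UNIV N_C1 Ck_on_const)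
        then have "Df (\<lambda>y. N y \<bullet> N y - 1) y w = 0"
          by (rule derivative_zero_on_boundary) (use N_unit y w in auto)
        moreover have "((\<lambda>y. N y \<bullet> N y - 1) has_derivative (\<lambda>w. N y \<bullet> ?DN w + ?DN w \<bullet> N y)) (at y)"
          using has_derivative_diff[OF has_derivative_inner[OF dN dN] has_derivative_const[of 1]] by simp
        ultimately show ?thesis by (simp add: frechet_derivative_eq inner_commute)
      qed
      \<comment> \<open>By \<open>NN\<close>, differentiating the factor \<open>N\<close>
        contributes nothing in the normal direction.\<close>
      have Dn: "Df (\<lambda>y. (v y \<bullet> N y) *\<^sub>R N y) y w \<bullet> N y = Df (\<lambda>y. v y \<bullet> N y) y w"
        if v: "Ck_on UNIV 2 v" and w: "w \<bullet> N y = 0" for v w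
      proof -
        have d: "((\<lambda>y. v y \<bullet> N y) has_derivative Df (\<lambda>y. v y \<bullet> N y) y) (at y)"
          by (rule C1D(1)[OF Ck_on_inner[OF open_UNIV C2_derivative(2)[OF v] N_C1] UNIV_I])
        from frechet_derivative_eq[OF bounded_bilinear.FDERIV[OF bounded_bilinear_scaleR d dN]]
        show ?thesis by (simp add: inner_add_left NN[OF w] N_unit[OF y])
      qed
      \<comment> \<open>Derivative of \<open>X y \<bullet> N y = 0\<close> along \<open>Z y\<close>;
        this is the source of the second fundamental form.\<close>
      have DX: "Df X y (Z y) \<bullet> N y = - (X y \<bullet> ?DN (Z y))"
      proof -
        have "Df (\<lambda>y. X y \<bullet> N y) y (Z y) = 0"
          by (rule derivative_zero_on_boundary[OF Ck_on_inner[OF open_UNIV c1(5) N_C1]]) (use tan y in auto)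
        then show ?thesis
          using frechet_derivative_eq[OF has_derivative_inner[OF C1D(1)[OF c1(5) UNIV_I] dN]] by simp
      qed
      have "Df X y w = Df xc y w - Df xn y w" for w
        unfolding X_def[abs_def]
        using frechet_derivative_eq[OF has_derivative_diff[OF C1D(1)[OF c1(1) UNIV_I] C1D(1)[OF c1(3) UNIV_I]]] by simp
      then have "Df xc y (Z y) \<bullet> N y = Df xn y (Z y) \<bullet> N y - X y \<bullet> ?DN (Z y)"
        using DX by (simp add: inner_diff_left)
      also have "Df xn y (Z y) \<bullet> N y = Df (\<lambda>y. x y \<bullet> N y) y (Z y)"
        unfolding xn_def[abs_def] by (rule Dn[OF x2 tan(2)[OF y]])
      finally have A: "Df xc y (Z y) \<bullet> N y = Df (\<lambda>y. x y \<bullet> N y) y (Z y) - X y \<bullet> ?DN (Z y)" .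
      have A': "Df zn y (X y) \<bullet> N y = Df (\<lambda>y. z y \<bullet> N y) y (X y)"
        unfolding zn_def[abs_def] by (rule Dn[OF z2 tan(1)[OF y]])
      have L: "apply_W1inf (- (?A + ?B)) y \<bullet> N y = - (Df (\<lambda>y. x y \<bullet> N y) y (Z y) - X y \<bullet> ?DN (Z y)
          + Df (\<lambda>y. z y \<bullet> N y) y (X y))"
        by (simp only: uminus_W1inf.rep_eq plus_W1inf.rep_eq aA aB inner_minus_left inner_add_left A A')
      show "apply_W1inf (- (?A + ?B)) y \<bullet> exterior_normal \<Omega> y = curvature_term \<Omega> x z y"
        unfolding curvature_term_def tp B gr[OF z2 tan(1)[OF y]] gr[OF x2 tan(2)[OF y]] nn L
        using inner_commute[of "X y" "?DN (Z y)"] by linarith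
    qed
    finally show ?thesis by (simp only: x_def z_def)
  qed
  show ?thesis by (rule that[OF form main])
qed

end

theorem theorem2p1:
  fixes \<Omega> :: "(real ^ 'd) set" and J :: "(real ^ 'd) set \<Rightarrow> real"
  defines "\<J> \<equiv> shape_functional J \<Omega>" and "n \<equiv> exterior_normal \<Omega>"
  assumes "open \<Omega>" and "bounded \<Omega>"
    and "\<J> differentiable (at 0)" and "Ck_domain 2 \<Omega>"
  shows "\<exists>l1. continuous_linear_form 1 \<Omega> l1 \<and>
    (\<forall>\<xi>. smooth (apply_W1inf \<xi>) \<longrightarrow>
      frechet_derivative \<J> (at 0) \<xi> = l1 (\<lambda>x. apply_W1inf \<xi> x \<bullet> n x)) \<and>
    (twice_differentiable_at \<J> 0 \<and> Ck_domain 3 \<Omega> \<longrightarrow>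
      (\<exists>l2. continuous_symmetric_bilinear_form 2 \<Omega> l2 \<and>
        (\<forall>\<xi> \<zeta>. smooth (apply_W1inf \<xi>) \<longrightarrow> smooth (apply_W1inf \<zeta>) \<longrightarrow>
          second_frechet_derivative \<J> 0 \<xi> \<zeta> =
            l2 (\<lambda>x. apply_W1inf \<xi> x \<bullet> n x) (\<lambda>x. apply_W1inf \<zeta> x \<bullet> n x) +
            l1 (\<lambda>x.
              second_fundamental_form \<Omega> x
                (tangential_part \<Omega> (apply_W1inf \<zeta>) x) (tangential_part \<Omega> (apply_W1inf \<xi>) x)
              - tangential_gradient \<Omega> (\<lambda>y. apply_W1inf \<zeta> y \<bullet> n y) x
                \<bullet> tangential_part \<Omega> (apply_W1inf \<xi>) x
              - tangential_gradient \<Omega> (\<lambda>y. apply_W1inf \<xi> y \<bullet> n y) x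
                \<bullet> tangential_part \<Omega> (apply_W1inf \<zeta>) x))))"
proof -
  \<comment> \<open>The order of an atlas is the class of its normal, one below the class of the
    domain.\<close>
  have d2: "Ck_domain (Suc 1) \<Omega>" using assms(6) by (simp add: numeral_2_eq_2)
  obtain I \<nu> \<gamma> r \<rho> \<psi> where "boundary_atlas \<Omega> 1 I \<nu> \<gamma> r \<rho> \<psi>"
    using boundary_atlas_exists[OF d2 order_refl assms(4)] .
  then obtain l1 where l1: "continuous_linear_form 1 \<Omega> l1"
    "\<And>V. C1W V \<Longrightarrow> frechet_derivative \<J> (at 0) V = l1 (\<lambda>x. apply_W1inf V x \<bullet> n x)"
    "\<And>f g. (\<And>x. x \<in> frontier \<Omega> \<Longrightarrow> f x = g x) \<Longrightarrow> l1 f = l1 g"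
    using boundary_atlas.first_order_structure[of \<Omega> 1 I \<nu> \<gamma> r \<rho> \<psi> J] assms(5) unfolding \<J>_def n_def by blast
  show ?thesis
  proof (intro exI[of _ l1] conjI allI impI, goal_cases)
    case 1
    show ?case by (rule l1(1))
  next
    case (2 \<xi>)
    then show ?case unfolding smooth_def by (intro l1(2)) blast
  next
    case J2: 3
    then have d3: "Ck_domain (Suc 2) \<Omega>" by (simp add: numeral_3_eq_3 numeral_2_eq_2)
    have smooth2: "Ck_on UNIV 2 f" if "smooth f" for f :: "real ^ 'd \<Rightarrow> real ^ 'd"
      using that unfolding smooth_def ..
    \<comment> \<open>A smoother atlas for \<open>l2\<close>; \<open>l1\<close> stays the form built
      above, since both parts must share it.\<close>
    obtain I \<nu> \<gamma> r \<rho> \<psi> where at: "boundary_atlas \<Omega> 2 I \<nu> \<gamma> r \<rho> \<psi>"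
      using boundary_atlas_exists[OF d3 one_le_numeral assms(4)] .
    obtain l2 where l2: "continuous_symmetric_bilinear_form 2 \<Omega> l2"
      "\<And>\<xi> \<zeta>. Ck_on UNIV 2 (apply_W1inf \<xi>) \<Longrightarrow> Ck_on UNIV 2 (apply_W1inf \<zeta>) \<Longrightarrow>
        second_frechet_derivative \<J> 0 \<xi> \<zeta> = l2 (\<lambda>x. apply_W1inf \<xi> x \<bullet> n x) (\<lambda>x. apply_W1inf \<zeta> x \<bullet> n x) +
          l1 (curvature_term \<Omega> (apply_W1inf \<xi>) (apply_W1inf \<zeta>))"
      by (rule boundary_atlas.second_order_structure[OF at conjunct1[OF J2, unfolded \<J>_def] order_refl
            l1(2,3)[unfolded \<J>_def n_def], folded \<J>_def n_def])
        (assumption, assumption, rule that)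
    note eq = l2(2)[unfolded curvature_term_def[abs_def], folded n_def]
    show ?case
      by (intro exI[of _ l2] conjI allI impI l2(1)) (simp only: eq smooth2)
  qed
qed

end
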